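(* Let $T>0$ and let $Z:=\int^{\infty}_0 f(s)\,dM_s\in\Gamma_{\infty}(M)$, where $f\in L^2([0,\infty),d\langle M\rangle)$. Then $$Z = L^2(\mathbb{P})\text{-}\sum_{n\in\mathbb{Z}}\left(\int^{\infty}_0 f(s)\mathcal{L}^{M,T}_n(s)\,d\langle M\rangle_s\right)\cdot \varepsilon^{M,T}_n,$$ where the sequence $\left\{\varepsilon_n^{M,T}\right\}_{n\in\mathbb{Z}}:=\left\{\frac{\mathcal{T}^n_T(M)}{\sqrt{\langle M\rangle_T}}\right\}_{n\in\mathbb{Z}}$ is i.i.d. with $\varepsilon^{M,T}_0\sim \mathcal{N}(0,1)$, and $$\mathcal{L}^{M,T}_n(s) :=\begin{cases} \frac{1}{\sqrt{\langle M\rangle_T}}\, L_n\left(\ln\frac{\langle M\rangle_{T}}{\langle M\rangle_{s}}\right)1_{(0,T)}(s), & n\in\mathbb{N}_0,\\[2mm] -\frac{\sqrt{\langle M\rangle_T}}{\langle M\rangle_s}\, L_{-n-1}\left(\ln\frac{\langle M\rangle_{s}}{\langle M\rangle_{T}}\right)1_{(T,\infty)}(s), & n\in -\mathbb{N},\end{cases}$$ with $L_n(x):=\sum_{k=0}^n \binom{n}{k}\frac{1}{k!}(-x)^k$ denoting the $n$-th Laguerre polynomial, $n\in\mathbb{N}_0$.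
   Context: $M=(M_t)_{t\in[0,\infty)}$ is a continuous Gaussian martingale with $M_0=0$ a.s., whose (deterministic) quadratic variation $\langle M\rangle$ is strictly increasing with $\lim_{t\to\infty}\langle M\rangle_t=\infty$. The probability space $(\Omega,\mathcal F,\mathbb P)$ is the coordinate space of $M$: $\Omega=C([0,\infty))$, $M_t(\omega)=\omega(t)$, $\mathcal F=\sigma(M_t\mid t\ge0)$. $\Gamma_\infty(M)$ is the closure of $\mathrm{span}\{M_t\mid t\in[0,\infty)\}$ in $L^2(\mathbb P)$; it is the set of Wiener integrals $\int_0^\infty f(s)\,dM_s$ with $f\in L^2([0,\infty),d\langle M\rangle)$. $L^2(\mathbb P)\text{-}\sum$ denotes a series converging in $L^2(\mathbb P)$. $\mathbb N=\{1,2,\dots\}$, $\mathbb N_0=\mathbb N\cup\{0\}$, $-\mathbb N=\{-1,-2,\dots\}$. The transformation $\mathcal T$ is defined by $$\mathcal T_t(M):=M_t-\int_0^t\frac{M_s}{\langle M\rangle_s}\,d\langle M\rangle_s\quad\text{a.s.},\ t\in[0,\infty).$$ It is a measure-preserving transformation of the path space ($\mathcal T(M)$ has the same law as $M$), and it is an automorphism, with measurable inverse $$\mathcal T^{-1}_t(M)=-\langle M\rangle_t\int_t^\infty\frac1{\langle M\rangle_s}\,dM_s\quad\text{a.s.},\ t\in(0,\infty)$$ (and $\mathcal T^{-1}_0(M)=0$). For $n\in\mathbb Z$, $\mathcal T^n$ denotes the $n$-th iterate ($\mathcal T^0=\mathrm{id}$; negative powers are iterates of $\mathcal T^{-1}$),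 and $\mathcal T^n_T(M)$ is the value of the process $\mathcal T^n(M)$ at time $T$. *)

theory Defs
  imports "HOL-Probability.Probability"
begin

section \<open>The coordinate space\<close>

text \<open>
  An element of \<open>C([0,\<infinity>))\<close> is a function on \<open>real\<close> that is continuous on \<open>{0..}\<close> and, by the
  convention of \<^const>\<open>PiM\<close>, equal to \<^const>\<open>undefined\<close> off \<open>{0..}\<close>. The trace of the product
  sigma-algebra is the one generated by the coordinates.
\<close>

definition path_space :: "(real \<Rightarrow> real) measure" where
  "path_space = restrict_space (PiM {0..} (\<lambda>_. borel)) {\<omega>. continuous_on {0..} \<omega>}"

definition coord :: "real \<Rightarrow> (real \<Rightarrow> real) \<Rightarrow> real" where
  "coord t \<omega> = \<omega> t"

section \<open>Gaussian martingales and quadratic variation\<close>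

definition natural_filtration :: "'a measure \<Rightarrow> (real \<Rightarrow> 'a \<Rightarrow> real) \<Rightarrow> real \<Rightarrow> 'a measure" where
  "natural_filtration P X t =
     sigma (space P) {X u -` A \<inter> space P | u A. u \<in> {0..t} \<and> A \<in> sets borel}"

definition martingale :: "'a measure \<Rightarrow> (real \<Rightarrow> 'a measure) \<Rightarrow> (real \<Rightarrow> 'a \<Rightarrow> real) \<Rightarrow> bool" where
  "martingale P F X \<longleftrightarrow>
     (\<forall>t\<ge>0. X t \<in> borel_measurable (F t) \<and> integrable P (X t)) \<and>
     (\<forall>s t. 0 \<le> s \<and> s \<le> t \<longrightarrow> (AE \<omega> in P. real_cond_exp P (F s) (X t) \<omega> = X s \<omega>))"

text \<open>Normal laws are allowed to be degenerate.\<close>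

definition gaussian_rv :: "'a measure \<Rightarrow> ('a \<Rightarrow> real) \<Rightarrow> bool" where
  "gaussian_rv P Y \<longleftrightarrow> Y \<in> borel_measurable P \<and>
     ((\<exists>m. AE \<omega> in P. Y \<omega> = m) \<or>
      (\<exists>m \<sigma>. \<sigma> > 0 \<and> distributed P lborel Y (normal_density m \<sigma>)))"

definition gaussian_process :: "'a measure \<Rightarrow> (real \<Rightarrow> 'a \<Rightarrow> real) \<Rightarrow> bool" where
  "gaussian_process P X \<longleftrightarrow>
     (\<forall>I c. finite I \<and> I \<subseteq> {0..} \<longrightarrow> gaussian_rv P (\<lambda>\<omega>. \<Sum>t\<in>I. c t * X t \<omega>))"

text \<open>
  The definition for square-integrable continuous martingales (every Gaussian martingale is
  square-integrable), so \<open>X\<^sup>2 - A\<close> is required to be a true martingale, not just a local one.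
\<close>

definition quadratic_variation ::
    "'a measure \<Rightarrow> (real \<Rightarrow> 'a measure) \<Rightarrow> (real \<Rightarrow> 'a \<Rightarrow> real) \<Rightarrow> (real \<Rightarrow> 'a \<Rightarrow> real) \<Rightarrow> bool" where
  "quadratic_variation P F X A \<longleftrightarrow>
     (\<forall>t\<ge>0. A t \<in> borel_measurable (F t)) \<and>
     (AE \<omega> in P. A 0 \<omega> = 0 \<and> continuous_on {0..} (\<lambda>t. A t \<omega>) \<and> mono_on {0..} (\<lambda>t. A t \<omega>)) \<and>
     martingale P F (\<lambda>t \<omega>. (X t \<omega>)\<^sup>2 - A t \<omega>)"

text \<open>
  The measure \<open>d\<langle>M\<rangle>\<close> on \<open>[0,\<infinity>)\<close> for deterministic \<open>\<langle>M\<rangle> = V\<close>. Since \<^const>\<open>interval_measure\<close>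
  expects a function on all of \<open>real\<close>, \<open>V\<close> is extended to the left by \<open>V 0\<close>.
\<close>

definition qv_measure :: "(real \<Rightarrow> real) \<Rightarrow> real measure" where
  "qv_measure V = restrict_space (interval_measure (\<lambda>t. V (max 0 t))) {0..}"

section \<open>Square-integrable functions and Wiener integrals\<close>

definition square_integrable :: "'a measure \<Rightarrow> ('a \<Rightarrow> real) \<Rightarrow> bool" where
  "square_integrable N g \<longleftrightarrow> g \<in> borel_measurable N \<and> integrable N (\<lambda>x. (g x)\<^sup>2)"

definition L2_tendsto ::
    "'a measure \<Rightarrow> ('i \<Rightarrow> 'a \<Rightarrow> real) \<Rightarrow> ('a \<Rightarrow> real) \<Rightarrow> 'i filter \<Rightarrow> bool" where
  "L2_tendsto N g h F \<longleftrightarrow>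
     (\<forall>i. square_integrable N (g i)) \<and> square_integrable N h \<and>
     ((\<lambda>i. \<integral>x. (g i x - h x)\<^sup>2 \<partial>N) \<longlongrightarrow> 0) F"

text \<open>Unconditional summation, as for \<^const>\<open>has_sum\<close>; sums over infinite \<open>J\<close> are \<open>0\<close> and play no role.\<close>

definition has_L2_sum :: "'a measure \<Rightarrow> ('i \<Rightarrow> 'a \<Rightarrow> real) \<Rightarrow> ('a \<Rightarrow> real) \<Rightarrow> bool" where
  "has_L2_sum N g h \<longleftrightarrow>
     L2_tendsto N (\<lambda>J x. \<Sum>n\<in>J. g n x) h (finite_subsets_at_top UNIV)"

text \<open>A triple \<open>(c, a, b)\<close> stands for the step function with value \<open>c\<close> on \<open>(a,b]\<close>.\<close>

definition step_fun :: "(real \<times> real \<times> real) list \<Rightarrow> real \<Rightarrow> real" where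
  "step_fun xs s = (\<Sum>(c, a, b)\<leftarrow>xs. c * indicator {a<..b} s)"

definition step_integral ::
    "(real \<Rightarrow> 'a \<Rightarrow> real) \<Rightarrow> (real \<times> real \<times> real) list \<Rightarrow> 'a \<Rightarrow> real" where
  "step_integral X xs \<omega> = (\<Sum>(c, a, b)\<leftarrow>xs. c * (X b \<omega> - X a \<omega>))"

text \<open>
  \<open>wiener_integral P X V f Z\<close>: \<open>f \<in> L\<^sup>2([0,\<infinity>), dV)\<close> and \<open>Z\<close> is a version of \<open>\<integral>\<^sub>0\<^sup>\<infinity> f(s) dX\<^sub>s\<close>,
  where \<open>V\<close> is the quadratic variation of \<open>X\<close>.
\<close>

definition wiener_integral ::
    "'a measure \<Rightarrow> (real \<Rightarrow> 'a \<Rightarrow> real) \<Rightarrow> (real \<Rightarrow> real) \<Rightarrow> (real \<Rightarrow> real) \<Rightarrow> ('a \<Rightarrow> real) \<Rightarrow> bool" where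
  "wiener_integral P X V f Z \<longleftrightarrow>
     (\<exists>xs. (\<forall>k. \<forall>(c, a, b)\<in>set (xs k). 0 \<le> a \<and> a \<le> b) \<and>
           L2_tendsto (qv_measure V) (\<lambda>k. step_fun (xs k)) f sequentially \<and>
           L2_tendsto P (\<lambda>k. step_integral X (xs k)) Z sequentially)"

section \<open>The transformation and its iterates\<close>

text \<open>
  The transformation and its inverse are given by almost sure identities only, so they are
  rendered as properties of measurable maps of the path space; any two maps with the property
  agree almost surely.
\<close>

definition transformation ::
    "(real \<Rightarrow> real) measure \<Rightarrow> (real \<Rightarrow> real) \<Rightarrow> ((real \<Rightarrow> real) \<Rightarrow> (real \<Rightarrow> real)) \<Rightarrow> bool" where
  "transformation P V \<tau> \<longleftrightarrow> \<tau> \<in> measurable P P \<and>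
     (\<forall>t\<ge>0. AE \<omega> in P. coord t (\<tau> \<omega>) =
        coord t \<omega> - (LINT s:{0..t}|qv_measure V. coord s \<omega> / V s))"

definition inverse_transformation ::
    "(real \<Rightarrow> real) measure \<Rightarrow> (real \<Rightarrow> real) \<Rightarrow> ((real \<Rightarrow> real) \<Rightarrow> (real \<Rightarrow> real)) \<Rightarrow> bool" where
  "inverse_transformation P V \<tau>' \<longleftrightarrow> \<tau>' \<in> measurable P P \<and>
     (AE \<omega> in P. coord 0 (\<tau>' \<omega>) = 0) \<and>
     (\<forall>t>0. \<exists>W. wiener_integral P coord V (\<lambda>s. indicator {t<..} s * (1 / V s)) W \<and>
        (AE \<omega> in P. coord t (\<tau>' \<omega>) = - V t * W \<omega>))"

definition iterate :: "('a \<Rightarrow> 'a) \<Rightarrow> ('a \<Rightarrow> 'a) \<Rightarrow> int \<Rightarrow> 'a \<Rightarrow> 'a" where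
  "iterate \<tau> \<tau>' n = (if n \<ge> 0 then \<tau> ^^ nat n else \<tau>' ^^ nat (- n))"

definition eps ::
    "(real \<Rightarrow> real) \<Rightarrow> ((real \<Rightarrow> real) \<Rightarrow> (real \<Rightarrow> real)) \<Rightarrow> ((real \<Rightarrow> real) \<Rightarrow> (real \<Rightarrow> real)) \<Rightarrow>
     real \<Rightarrow> int \<Rightarrow> (real \<Rightarrow> real) \<Rightarrow> real" where
  "eps V \<tau> \<tau>' T n \<omega> = coord T (iterate \<tau> \<tau>' n \<omega>) / sqrt (V T)"

section \<open>Laguerre functions\<close>

definition laguerre :: "nat \<Rightarrow> real \<Rightarrow> real" where
  "laguerre n x = (\<Sum>k=0..n. real (n choose k) * (1 / fact k) * (- x) ^ k)"

definition laguerre_fun :: "(real \<Rightarrow> real) \<Rightarrow> real \<Rightarrow> int \<Rightarrow> real \<Rightarrow> real" where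
  "laguerre_fun V T n s =
     (if n \<ge> 0
      then 1 / sqrt (V T) * laguerre (nat n) (ln (V T / V s)) * indicator {0<..<T} s
      else - (sqrt (V T) / V s) * laguerre (nat (- n - 1)) (ln (V s / V T)) * indicator {T<..} s)"

end

theory Submission
  imports Defs "HOL-Computational_Algebra.Polynomial"
begin

text \<open>
  The transformation acts on Wiener integrals through an isometry \<open>U\<close> of \<open>L\<^sup>2(dV)\<close>: on the clock
  scale \<open>x = ln (V T / V s)\<close> and below \<open>T\<close> it is \<open>p \<mapsto> p - \<integral>\<^sub>0 p\<close>, which maps \<open>L\<^sub>n\<close> to \<open>L\<^sub>n\<^sub>+\<^sub>1\<close>, and the inverse
  transformation moves the Laguerre functions beyond \<open>T\<close> in the same way. A variable in \<open>L\<^sup>2(P)\<close> is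
  recognised as the Wiener integral of \<open>h\<close> by its covariances with \<open>M\<close> and its variance, so it
  suffices to track pairings with \<open>M\<^sub>r\<close>: by invariance of \<open>P\<close> these are pairings with the adjoint
  kernels \<open>U\<^sup>* 1_(0,r)\<close>, explicit integrals of Laguerre polynomials. Invariance itself follows from
  the covariances, since a Gaussian law is determined by the characteristic functions of linear
  combinations; the same device turns orthonormality of the \<open>\<epsilon>\<^sub>n\<close> into independence.

  For completeness of the Laguerre functions, Parseval's identity is checked directly for the
  powers \<open>u^m\<close> with \<open>u = V s / V T\<close> below \<open>T\<close> (and \<open>u = V T / V s\<close> beyond), where it is a geometric
  series; the Weierstrass theorem then reaches the indicators \<open>1_(0,t)\<close> and hence all of \<open>L\<^sup>2(dV)\<close>.
\<close>

section \<open>Square-integrable functions\<close>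

text \<open>The maps \<open>\<tau>\<close> and \<open>\<tau>'\<close> are known only through almost
  sure identities at fixed times. Composing such an identity, or an L2 limit, with them is
  legitimate once \<open>P\<close> is known to be invariant, so invariance precedes iteration. An
  iterate is formed by letting one more application act first; what has to be identified is then
  \<open>Y (\<tau> \<omega>)\<close> for a Wiener integral \<open>Y\<close> without pathwise
  formula. Its pairing with \<open>M_r\<close> is linear and continuous in the kernel of
  \<open>Y\<close>, hence determined by the pairings of \<open>M_r\<close> with single transformed
  coordinates. Only two families of adjoint kernels arise: \<open>K (-1) r\<close> for
  \<open>\<tau>\<close> and \<open>K 1 r\<close> for \<open>\<tau>'\<close>. Below \<open>T\<close>
  the substitution \<open>V s = V T * exp (- x)\<close> supplies the weight
  \<open>exp (- x)\<close>; beyond \<open>T\<close> the Jacobian \<open>exp x\<close> is beaten by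
  the factor \<open>(V T / V s)^2\<close> of two kernels, which again leaves
  \<open>exp (- x)\<close>. Both halves of the index set thus rest on the same polynomial
  orthogonality. The error of the series in L2(P) equals, by Pythagoras, the Parseval remainder in
  L2(dV), and monotonicity of that remainder in the index set gives unconditional summation.\<close>

lemma square_integrableD:
  assumes "square_integrable N f"
  shows "f \<in> borel_measurable N" "integrable N (\<lambda>x. (f x)\<^sup>2)"
  using assms by (auto simp: square_integrable_def)

lemma square_integrable_integrable_mult:
  assumes "square_integrable N f" "square_integrable N g"
  shows "integrable N (\<lambda>x. f x * g x)"
proof -
  note [measurable] = square_integrableD(1)[OF assms(1)] square_integrableD(1)[OF assms(2)]
  have "integrable N (\<lambda>x. (f x)\<^sup>2 + (g x)\<^sup>2)"
    using assms by (auto simp: square_integrable_def)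
  then show ?thesis
  proof (rule Bochner_Integration.integrable_bound)
    show "AE x in N. norm (f x * g x) \<le> norm ((f x)\<^sup>2 + (g x)\<^sup>2)"
    proof (rule AE_I2)
      fix x
      have "2 * \<bar>f x * g x\<bar> \<le> (f x)\<^sup>2 + (g x)\<^sup>2"
        using sum_squares_bound[of "\<bar>f x\<bar>" "\<bar>g x\<bar>"] by (simp add: abs_mult)
      then show "norm (f x * g x) \<le> norm ((f x)\<^sup>2 + (g x)\<^sup>2)"
        by simp
    qed
  qed measurable
qed

lemma square_integrable_add:
  assumes "square_integrable N f" "square_integrable N g"
  shows "square_integrable N (\<lambda>x. f x + g x)"
  unfolding square_integrable_def
proof
  show "(\<lambda>x. f x + g x) \<in> borel_measurable N"
    using assms by (intro borel_measurable_add square_integrableD(1))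
  have "integrable N (\<lambda>x. (f x)\<^sup>2 + (g x)\<^sup>2 + 2 * (f x * g x))"
    using assms square_integrable_integrable_mult[OF assms]
    by (intro Bochner_Integration.integrable_add integrable_mult_right square_integrableD(2))
  then show "integrable N (\<lambda>x. (f x + g x)\<^sup>2)"
    by (simp add: power2_sum mult.assoc)
qed

lemma square_integrable_cmult:
  assumes "square_integrable N f"
  shows "square_integrable N (\<lambda>x. c * f x)"
  using assms by (auto simp: square_integrable_def power_mult_distrib)

lemma square_integrable_diff:
  assumes "square_integrable N f" "square_integrable N g"
  shows "square_integrable N (\<lambda>x. f x - g x)"
  using square_integrable_add[OF assms(1) square_integrable_cmult[OF assms(2), of "-1"]] by simp

lemma square_integrable_zero: "square_integrable N (\<lambda>x. 0)"
  by (simp add: square_integrable_def)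

lemma square_integrable_sum:
  assumes "\<And>i. i \<in> I \<Longrightarrow> square_integrable N (f i)"
  shows "square_integrable N (\<lambda>x. \<Sum>i\<in>I. f i x)"
  using assms
proof (induction I rule: infinite_finite_induct)
  case (insert i I)
  then show ?case by (simp add: square_integrable_add)
qed (simp_all add: square_integrable_zero)

lemma square_integrable_bound:
  assumes "square_integrable N g" "f \<in> borel_measurable N" "AE x in N. \<bar>f x\<bar> \<le> \<bar>g x\<bar>"
  shows "square_integrable N f"
  unfolding square_integrable_def
proof
  show "integrable N (\<lambda>x. (f x)\<^sup>2)"
  proof (rule Bochner_Integration.integrable_bound[OF square_integrableD(2)[OF assms(1)]])
    show "AE x in N. norm ((f x)\<^sup>2) \<le> norm ((g x)\<^sup>2)"
      using assms(3) by eventually_elim (simp add: abs_le_square_iff)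
  qed (intro borel_measurable_power assms(2))
qed fact

lemma integral_square_add_cmult:
  assumes "square_integrable N f" "square_integrable N g"
  shows "(\<integral>x. (f x + c * g x)\<^sup>2 \<partial>N) =
    (\<integral>x. (f x)\<^sup>2 \<partial>N) + 2 * c * (\<integral>x. f x * g x \<partial>N) + c\<^sup>2 * (\<integral>x. (g x)\<^sup>2 \<partial>N)"
proof -
  have "(\<integral>x. (f x + c * g x)\<^sup>2 \<partial>N) =
     (\<integral>x. (f x)\<^sup>2 + (2 * c) * (f x * g x) + c\<^sup>2 * (g x)\<^sup>2 \<partial>N)"
    by (intro Bochner_Integration.integral_cong) (auto simp: power2_eq_square algebra_simps)
  also have "\<dots> = (\<integral>x. (f x)\<^sup>2 \<partial>N) + 2 * c * (\<integral>x. f x * g x \<partial>N) + c\<^sup>2 * (\<integral>x. (g x)\<^sup>2 \<partial>N)"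
    using assms square_integrable_integrable_mult[OF assms]
    by (simp add: square_integrable_def)
  finally show ?thesis .
qed

lemma integral_square_diff:
  assumes "square_integrable N f" "square_integrable N g"
  shows "(\<integral>x. (f x - g x)\<^sup>2 \<partial>N) =
    (\<integral>x. (f x)\<^sup>2 \<partial>N) - 2 * (\<integral>x. f x * g x \<partial>N) + (\<integral>x. (g x)\<^sup>2 \<partial>N)"
  using integral_square_add_cmult[OF assms, of "-1"] by simp

lemma Cauchy_Schwarz_integral:
  assumes "square_integrable N f" "square_integrable N g"
  shows "(\<integral>x. f x * g x \<partial>N)\<^sup>2 \<le> (\<integral>x. (f x)\<^sup>2 \<partial>N) * (\<integral>x. (g x)\<^sup>2 \<partial>N)"
proof -
  define a b c where "a = (\<integral>x. (f x)\<^sup>2 \<partial>N)" "b = (\<integral>x. f x * g x \<partial>N)" "c = (\<integral>x. (g x)\<^sup>2 \<partial>N)"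
  have nn: "0 \<le> a + 2 * t * b + t\<^sup>2 * c" for t
  proof -
    have "0 \<le> (\<integral>x. (f x + t * g x)\<^sup>2 \<partial>N)" by simp
    then show ?thesis
      using integral_square_add_cmult[OF assms, of t] unfolding a_b_c_def by simp
  qed
  have "c \<ge> 0" unfolding a_b_c_def by simp
  have "b\<^sup>2 \<le> a * c"
  proof (cases "c = 0")
    case True
    have "b = 0"
    proof (rule ccontr)
      assume "b \<noteq> 0"
      \<comment> \<open>With \<open>c = 0\<close> the quadratic in \<open>t\<close> is affine; this
        \<open>t\<close> gives it the value \<open>-1\<close>.\<close>
      then have "2 * (- (a + 1) / (2 * b)) * b = - (a + 1)" by simp
      with nn[of "- (a + 1) / (2 * b)"] True show False by simp
    qed
    then show ?thesis using True by simp
  next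
    case False
    with \<open>c \<ge> 0\<close> have "c > 0" by simp
    \<comment> \<open>\<open>- b / c\<close> is the minimiser of the quadratic.\<close>
    have "a + 2 * (- b / c) * b + (- b / c)\<^sup>2 * c = a - b\<^sup>2 / c"
      using False by (simp add: power2_eq_square)
    with nn[of "- b / c"] have "b\<^sup>2 / c \<le> a" by simp
    then show ?thesis using \<open>c > 0\<close> by (simp add: pos_divide_le_eq)
  qed
  then show ?thesis by (simp only: a_b_c_def)
qed

text \<open>The parallelogram law with one nonnegative term dropped. It takes the place of the
  triangle inequality, so that estimates of sums stay with squared norms.\<close>

lemma integral_square_sum_le:
  assumes "square_integrable N f" "square_integrable N g"
  shows "(\<integral>x. (f x + g x)\<^sup>2 \<partial>N) \<le> 2 * (\<integral>x. (f x)\<^sup>2 \<partial>N) + 2 * (\<integral>x. (g x)\<^sup>2 \<partial>N)"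
proof -
  have "(\<integral>x. (f x + g x)\<^sup>2 \<partial>N) + (\<integral>x. (f x - g x)\<^sup>2 \<partial>N) =
      2 * (\<integral>x. (f x)\<^sup>2 \<partial>N) + 2 * (\<integral>x. (g x)\<^sup>2 \<partial>N)"
    using integral_square_add_cmult[OF assms, of 1] integral_square_diff[OF assms] by simp
  moreover have "0 \<le> (\<integral>x. (f x - g x)\<^sup>2 \<partial>N)" by simp
  ultimately show ?thesis by linarith
qed

lemma square_integrable_AE_eq:
  assumes "square_integrable N f" "square_integrable N g" "(\<integral>x. (f x - g x)\<^sup>2 \<partial>N) = 0"
  shows "AE x in N. f x = g x"
proof -
  have "AE x in N. (f x - g x)\<^sup>2 = 0"
    using assms(3) square_integrableD(2)[OF square_integrable_diff[OF assms(1,2)]]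
    by (subst (asm) integral_nonneg_eq_0_iff_AE) auto
  then show ?thesis by eventually_elim simp
qed

lemma square_integrable_cong_AE:
  assumes "square_integrable N f" "g \<in> borel_measurable N" "AE x in N. f x = g x"
  shows "square_integrable N g"
proof (rule square_integrable_bound[OF assms(1,2)])
  show "AE x in N. \<bar>g x\<bar> \<le> \<bar>f x\<bar>"
    using assms(3) by eventually_elim simp
qed

section \<open>Convergence in mean square\<close>

lemma L2_tendstoD:
  assumes "L2_tendsto N g h F"
  shows "square_integrable N (g i)" "square_integrable N h"
    "((\<lambda>i. \<integral>x. (g i x - h x)\<^sup>2 \<partial>N) \<longlongrightarrow> 0) F"
  using assms by (auto simp: L2_tendsto_def)

lemma L2_tendsto_const: "square_integrable N h \<Longrightarrow> L2_tendsto N (\<lambda>_. h) h F"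
  by (simp add: L2_tendsto_def)

lemma L2_tendsto_add:
  assumes "L2_tendsto N g h F" "L2_tendsto N g' h' F"
  shows "L2_tendsto N (\<lambda>i x. g i x + g' i x) (\<lambda>x. h x + h' x) F"
proof -
  note A = L2_tendstoD[OF assms(1)] note B = L2_tendstoD[OF assms(2)]
  have "((\<lambda>i. 2 * (\<integral>x. (g i x - h x)\<^sup>2 \<partial>N) + 2 * (\<integral>x. (g' i x - h' x)\<^sup>2 \<partial>N)) \<longlongrightarrow> 2 * 0 + 2 * 0) F"
    by (rule tendsto_add[OF tendsto_mult_left[OF A(3)] tendsto_mult_left[OF B(3)]])
  then have lim: "((\<lambda>i. 2 * (\<integral>x. (g i x - h x)\<^sup>2 \<partial>N) + 2 * (\<integral>x. (g' i x - h' x)\<^sup>2 \<partial>N)) \<longlongrightarrow> 0) F"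
    by simp
  have bound: "(\<integral>x. (g i x + g' i x - (h x + h' x))\<^sup>2 \<partial>N) \<le>
      2 * (\<integral>x. (g i x - h x)\<^sup>2 \<partial>N) + 2 * (\<integral>x. (g' i x - h' x)\<^sup>2 \<partial>N)" for i
    using integral_square_sum_le[OF square_integrable_diff[OF A(1,2)] square_integrable_diff[OF B(1,2)], of i i]
    by (simp only: add_diff_add)
  have "((\<lambda>i. \<integral>x. (g i x + g' i x - (h x + h' x))\<^sup>2 \<partial>N) \<longlongrightarrow> 0) F"
    by (rule tendsto_sandwich[OF always_eventually[OF allI] always_eventually[OF allI] tendsto_const lim])
       (simp, rule bound)
  moreover have "square_integrable N (\<lambda>x. g i x + g' i x)" for i
    using A(1) B(1) by (rule square_integrable_add)
  moreover have "square_integrable N (\<lambda>x. h x + h' x)"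
    using A(2) B(2) by (rule square_integrable_add)
  ultimately show ?thesis unfolding L2_tendsto_def by blast
qed

lemma L2_tendsto_cmult:
  assumes "L2_tendsto N g h F"
  shows "L2_tendsto N (\<lambda>i x. c * g i x) (\<lambda>x. c * h x) F"
proof -
  note A = L2_tendstoD[OF assms]
  have "(\<integral>x. (c * g i x - c * h x)\<^sup>2 \<partial>N) = c\<^sup>2 * (\<integral>x. (g i x - h x)\<^sup>2 \<partial>N)" for i
    by (simp add: right_diff_distrib[symmetric] power_mult_distrib)
  moreover have "((\<lambda>i. c\<^sup>2 * (\<integral>x. (g i x - h x)\<^sup>2 \<partial>N)) \<longlongrightarrow> c\<^sup>2 * 0) F"
    by (rule tendsto_mult_left[OF A(3)])
  ultimately show ?thesis
    using A by (auto simp: L2_tendsto_def square_integrable_cmult)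
qed

lemma L2_tendsto_inner:
  assumes "L2_tendsto N g h F" "square_integrable N k"
  shows "((\<lambda>i. \<integral>x. g i x * k x \<partial>N) \<longlongrightarrow> (\<integral>x. h x * k x \<partial>N)) F"
proof -
  note A = L2_tendstoD[OF assms(1)]
  have "((\<lambda>i. sqrt ((\<integral>x. (g i x - h x)\<^sup>2 \<partial>N) * (\<integral>x. (k x)\<^sup>2 \<partial>N))) \<longlongrightarrow> sqrt (0 * (\<integral>x. (k x)\<^sup>2 \<partial>N))) F"
    by (intro tendsto_real_sqrt tendsto_mult_right A(3))
  then have lim: "((\<lambda>i. sqrt ((\<integral>x. (g i x - h x)\<^sup>2 \<partial>N) * (\<integral>x. (k x)\<^sup>2 \<partial>N))) \<longlongrightarrow> 0) F" by simp
  have "\<bar>(\<integral>x. g i x * k x \<partial>N) - (\<integral>x. h x * k x \<partial>N)\<bar>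
      \<le> sqrt ((\<integral>x. (g i x - h x)\<^sup>2 \<partial>N) * (\<integral>x. (k x)\<^sup>2 \<partial>N))" for i
  proof -
    have "(\<integral>x. g i x * k x \<partial>N) - (\<integral>x. h x * k x \<partial>N) = (\<integral>x. (g i x - h x) * k x \<partial>N)"
      using square_integrable_integrable_mult[OF A(1) assms(2)] square_integrable_integrable_mult[OF A(2) assms(2)]
      by (simp add: left_diff_distrib)
    then show ?thesis
      using Cauchy_Schwarz_integral[OF square_integrable_diff[OF A(1,2)] assms(2), of i]
      by (metis real_sqrt_abs real_sqrt_le_mono)
  qed
  then have "((\<lambda>i. (\<integral>x. g i x * k x \<partial>N) - (\<integral>x. h x * k x \<partial>N)) \<longlongrightarrow> 0) F"
    by (intro Lim_null_comparison[OF _ lim]) simp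
  then show ?thesis by (rule Lim_null[THEN iffD2])
qed

lemma L2_tendsto_norm:
  assumes "L2_tendsto N g h F"
  shows "((\<lambda>i. \<integral>x. (g i x)\<^sup>2 \<partial>N) \<longlongrightarrow> (\<integral>x. (h x)\<^sup>2 \<partial>N)) F"
proof -
  note A = L2_tendstoD[OF assms]
  have "(\<integral>x. (g i x)\<^sup>2 \<partial>N) = (\<integral>x. (g i x - h x)\<^sup>2 \<partial>N) + 2 * (\<integral>x. g i x * h x \<partial>N) - (\<integral>x. (h x)\<^sup>2 \<partial>N)" for i
    using integral_square_diff[OF A(1,2), of i] by simp
  moreover have "((\<lambda>i. (\<integral>x. (g i x - h x)\<^sup>2 \<partial>N) + 2 * (\<integral>x. g i x * h x \<partial>N) - (\<integral>x. (h x)\<^sup>2 \<partial>N)) \<longlongrightarrow>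
      0 + 2 * (\<integral>x. h x * h x \<partial>N) - (\<integral>x. (h x)\<^sup>2 \<partial>N)) F"
    by (intro tendsto_diff tendsto_add tendsto_mult_left tendsto_const A(3) L2_tendsto_inner[OF assms A(2)])
  ultimately show ?thesis by (simp add: power2_eq_square)
qed

lemma L2_tendsto_sequentiallyI:
  assumes "square_integrable N h"
    and "\<And>e. e > 0 \<Longrightarrow> \<exists>g. Q g \<and> square_integrable N (F g) \<and> (\<integral>x. (F g x - h x)\<^sup>2 \<partial>N) < e"
  shows "\<exists>g. (\<forall>k. Q (g k)) \<and> L2_tendsto N (\<lambda>k. F (g k)) h sequentially"
proof -
  have "\<forall>k. \<exists>g. Q g \<and> square_integrable N (F g) \<and> (\<integral>x. (F g x - h x)\<^sup>2 \<partial>N) < inverse (real (Suc k))"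
    using assms(2) by (metis inverse_positive_iff_positive of_nat_0_less_iff zero_less_Suc)
  then obtain g where g: "\<And>k. Q (g k)" "\<And>k. square_integrable N (F (g k))"
      "\<And>k. (\<integral>x. (F (g k) x - h x)\<^sup>2 \<partial>N) < inverse (real (Suc k))"
    by metis
  have "(\<lambda>k. \<integral>x. (F (g k) x - h x)\<^sup>2 \<partial>N) \<longlonglongrightarrow> 0"
    by (rule tendsto_sandwich[OF _ _ tendsto_const LIMSEQ_inverse_real_of_nat])
       (simp, intro always_eventually allI less_imp_le g(3))
  with g assms(1) show ?thesis by (auto simp: L2_tendsto_def)
qed

lemma L2_tendsto_dominated:
  assumes "\<And>k. g k \<in> borel_measurable N" "square_integrable N w"
    and "\<And>k. AE x in N. \<bar>g k x\<bar> \<le> w x" "h \<in> borel_measurable N"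
    and "AE x in N. (\<lambda>k. g k x) \<longlonglongrightarrow> h x"
  shows "L2_tendsto N g h sequentially"
proof -
  have gb: "AE x in N. \<forall>k. \<bar>g k x\<bar> \<le> w x" using assms(3) by (simp add: AE_all_countable)
  then have hb: "AE x in N. \<bar>h x\<bar> \<le> w x"
    using assms(5)
  proof eventually_elim
    case (elim x)
    show ?case by (rule LIMSEQ_le_const2[OF tendsto_rabs[OF elim(2)]]) (use elim(1) in auto)
  qed
  have sg: "square_integrable N (g k)" for k
    using assms(3)[of k] by (intro square_integrable_bound[OF assms(2,1)]) auto
  have sh: "square_integrable N h"
    using hb by (intro square_integrable_bound[OF assms(2,4)]) auto
  have "(\<lambda>k. \<integral>x. (g k x - h x)\<^sup>2 \<partial>N) \<longlonglongrightarrow> (\<integral>x. 0 \<partial>N)"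
  \<comment> \<open>Both \<open>g k\<close> and \<open>h\<close> are bounded by \<open>w\<close>, so
    the squared difference is at most \<open>(2 * w x)^2\<close>.\<close>
  proof (rule integral_dominated_convergence[where w = "\<lambda>x. 4 * (w x)\<^sup>2"])
    show "AE x in N. (\<lambda>k. (g k x - h x)\<^sup>2) \<longlonglongrightarrow> 0"
      using assms(5)
    proof eventually_elim
      case (elim x)
      then have "(\<lambda>k. (g k x - h x)\<^sup>2) \<longlonglongrightarrow> (h x - h x)\<^sup>2" by (intro tendsto_intros)
      then show ?case by simp
    qed
    show "AE x in N. norm ((g k x - h x)\<^sup>2) \<le> 4 * (w x)\<^sup>2" for k
      using gb hb
    proof eventually_elim
      case (elim x)
      then have "\<bar>g k x\<bar> \<le> w x" by simp
      then have "\<bar>g k x - h x\<bar> \<le> \<bar>2 * w x\<bar>" using elim(2) by linarith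
      then have "(g k x - h x)\<^sup>2 \<le> (2 * w x)\<^sup>2" by (simp only: abs_le_square_iff)
      then show ?case by (simp add: power_mult_distrib)
    qed
  qed (use assms sg sh in \<open>auto simp: square_integrable_def\<close>)
  then show ?thesis using sg sh by (simp add: L2_tendsto_def)
qed

section \<open>Joint laws and characteristic functions\<close>

lemma iexp_minus: "iexp (- x) = cnj (iexp x)"
  by (simp add: complex_eq_iff Re_exp Im_exp)

text \<open>A bounded nonnegative weight turns into a probability density, so that Levy's uniqueness
  theorem applies to the weighted laws.\<close>

lemma weighted_law_unique_nonneg:
  fixes X :: "'a \<Rightarrow> real" and Y :: "'b \<Rightarrow> real"
  assumes "prob_space P" "prob_space Q"
    and [measurable]: "X \<in> borel_measurable P" "Y \<in> borel_measurable Q"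
    and [measurable]: "w \<in> borel_measurable P" "v \<in> borel_measurable Q"
    and w: "\<And>x. 0 \<le> w x" "\<And>x. w x \<le> B" and v: "\<And>x. 0 \<le> v x" "\<And>x. v x \<le> B"
    and eq: "\<And>s. (CLINT x|P. complex_of_real (w x) * iexp (s * X x)) =
                 (CLINT x|Q. complex_of_real (v x) * iexp (s * Y x))"
    and A[measurable]: "A \<in> sets borel"
  shows "(LINT x|P. w x * indicator A (X x)) = (LINT x|Q. v x * indicator A (Y x))"
proof -
  interpret P: prob_space P by fact
  interpret Q: prob_space Q by fact
  have iw[simp]: "integrable P w" by (rule P.integrable_const_bound[of _ B]) (use w in auto)
  have iv[simp]: "integrable Q v" by (rule Q.integrable_const_bound[of _ B]) (use v in auto)
  define m where "m = (LINT x|P. w x)"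
  have "complex_of_real m = (CLINT x|P. complex_of_real (w x))" by (simp add: m_def)
  \<comment> \<open>At \<open>s = 0\<close> the hypothesis compares the total masses of the two
    weights.\<close>
  also have "\<dots> = complex_of_real (LINT x|Q. v x)" using eq[of 0] by simp
  finally have mv: "m = (LINT x|Q. v x)" by (simp only: of_real_eq_iff)
  have "m \<ge> 0" unfolding m_def using w by simp
  show ?thesis
  \<comment> \<open>A vanishing total mass cannot be normalised, but then both weights vanish almost
    everywhere.\<close>
  proof (cases "m = 0")
    case True
    have "AE x in P. w x = 0"
      using True w(1) by (subst (asm) m_def, subst (asm) integral_nonneg_eq_0_iff_AE) auto
    then have "(LINT x|P. w x * indicator A (X x)) = (LINT x|P. 0)"
      by (intro integral_cong_AE) (auto elim!: eventually_mono)
    moreover have "AE x in Q. v x = 0"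
      using True v(1) by (subst (asm) mv, subst (asm) integral_nonneg_eq_0_iff_AE) auto
    then have "(LINT x|Q. v x * indicator A (Y x)) = (LINT x|Q. 0)"
      by (intro integral_cong_AE) (auto elim!: eventually_mono)
    ultimately show ?thesis by simp
  next
    case False
    with \<open>m \<ge> 0\<close> have m: "m > 0" by simp
    have prob: "real_distribution (distr (density R (\<lambda>x. ennreal (u x / m))) borel U)"
      if [measurable]: "u \<in> borel_measurable R" "U \<in> borel_measurable R"
        and "integrable R u" "\<And>x. 0 \<le> u x" "(LINT x|R. u x) = m"
      for R :: "'c measure" and u U
    proof -
      have "prob_space (density R (\<lambda>x. ennreal (u x / m)))"
      proof
        have "emeasure (density R (\<lambda>x. ennreal (u x / m))) (space R) = (\<integral>\<^sup>+x. ennreal (u x / m) \<partial>R)"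
          by (subst emeasure_density) (auto intro!: nn_integral_cong)
        also have "\<dots> = ennreal (LINT x|R. u x / m)"
          using that m by (intro nn_integral_eq_integral) auto
        also have "\<dots> = 1" using that m by simp
        finally show "emeasure (density R (\<lambda>x. ennreal (u x / m))) (space (density R (\<lambda>x. ennreal (u x / m)))) = 1"
          by simp
      qed
      then have "prob_space (distr (density R (\<lambda>x. ennreal (u x / m))) borel U)"
        by (rule prob_space.prob_space_distr) simp
      then show ?thesis
        by (simp add: real_distribution_def real_distribution_axioms_def)
    qed
    have char: "char (distr (density R (\<lambda>x. ennreal (u x / m))) borel U) s =
        (CLINT x|R. complex_of_real (u x) * iexp (s * U x)) / m"
      if [measurable]: "u \<in> borel_measurable R" "U \<in> borel_measurable R" and "\<And>x. 0 \<le> u x"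
      for R :: "'c measure" and u U s
    proof -
      have "char (distr (density R (\<lambda>x. ennreal (u x / m))) borel U) s =
          (CLINT x|R. (u x / m) *\<^sub>R iexp (s * U x))"
        unfolding char_def using that m
        by (subst integral_distr) (auto simp: integral_density)
      also have "\<dots> = (CLINT x|R. complex_of_real (u x) * iexp (s * U x) / m)"
        by (intro Bochner_Integration.integral_cong) (auto simp: scaleR_conv_of_real)
      finally show ?thesis by simp
    qed
    have law: "measure (distr (density R (\<lambda>x. ennreal (u x / m))) borel U) A =
        (LINT x|R. u x * indicator A (U x)) / m"
      if [measurable]: "u \<in> borel_measurable R" "U \<in> borel_measurable R" and "\<And>x. 0 \<le> u x"
      for R :: "'c measure" and u U
    proof -
      have "measure (distr (density R (\<lambda>x. ennreal (u x / m))) borel U) A =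
        (LINT x|distr (density R (\<lambda>x. ennreal (u x / m))) borel U. indicator A x)"
        by simp
      also have "\<dots> = (LINT x|R. (u x / m) *\<^sub>R indicator A (U x))"
        using that m by (subst integral_distr) (auto simp: integral_density)
      also have "\<dots> = (LINT x|R. u x * indicator A (U x) / m)"
        by (intro Bochner_Integration.integral_cong) auto
      finally show ?thesis by simp
    qed
    have "distr (density P (\<lambda>x. ennreal (w x / m))) borel X = distr (density Q (\<lambda>x. ennreal (v x / m))) borel Y"
    proof (rule Levy_uniqueness)
      show "char (distr (density P (\<lambda>x. ennreal (w x / m))) borel X) =
          char (distr (density Q (\<lambda>x. ennreal (v x / m))) borel Y)"
        by (rule ext) (simp only: char[OF assms(5,3) w(1)] char[OF assms(6,4) v(1)] eq)
    qed (auto intro!: prob w v simp: m_def[symmetric] mv[symmetric])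
    then show ?thesis
      using law[of w P X] law[of v Q Y] m w v by simp
  qed
qed

text \<open>Reduction to nonnegative weights: for \<open>norm c = 1\<close> the weight
  \<open>1 + Re (c * w x)\<close> lies between 0 and 2. Its transform combines \<open>eq1\<close>,
  \<open>eq\<close> at \<open>s\<close>, and the conjugate of \<open>eq\<close> at
  \<open>- s\<close>. Taking \<open>c = 1\<close> and \<open>c = - \<i>\<close> recovers real and
  imaginary parts.\<close>

lemma weighted_law_unique:
  fixes X :: "'a \<Rightarrow> real" and Y :: "'b \<Rightarrow> real"
  assumes "prob_space P" "prob_space Q"
    and [measurable]: "X \<in> borel_measurable P" "Y \<in> borel_measurable Q"
    and [measurable]: "w \<in> borel_measurable P" "v \<in> borel_measurable Q"
    and w: "\<And>x. norm (w x) \<le> 1" and v: "\<And>x. norm (v x) \<le> 1"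
    and eq: "\<And>s. (CLINT x|P. w x * iexp (s * X x)) = (CLINT x|Q. v x * iexp (s * Y x))"
    and eq1: "\<And>s. (CLINT x|P. iexp (s * X x)) = (CLINT x|Q. iexp (s * Y x))"
    and A[measurable]: "A \<in> sets borel"
  shows "(CLINT x|P. w x * indicator A (X x)) = (CLINT x|Q. v x * indicator A (Y x))"
proof -
  interpret P: prob_space P by fact
  interpret Q: prob_space Q by fact
  have bP: "integrable P f" if "f \<in> borel_measurable P" "\<And>x. norm (f x) \<le> 1" for f :: "'a \<Rightarrow> complex"
    using that by (intro P.integrable_const_bound[of _ 1]) auto
  have bQ: "integrable Q f" if "f \<in> borel_measurable Q" "\<And>x. norm (f x) \<le> 1" for f :: "'b \<Rightarrow> complex"
    using that by (intro Q.integrable_const_bound[of _ 1]) auto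
  have rP: "integrable P f" if "f \<in> borel_measurable P" "\<And>x. \<bar>f x\<bar> \<le> 1" for f :: "'a \<Rightarrow> real"
    using that by (intro P.integrable_const_bound[of _ 1]) auto
  have rQ: "integrable Q f" if "f \<in> borel_measurable Q" "\<And>x. \<bar>f x\<bar> \<le> 1" for f :: "'b \<Rightarrow> real"
    using that by (intro Q.integrable_const_bound[of _ 1]) auto
  have real_part: "(LINT x|P. Re (c * w x) * indicator A (X x)) = (LINT x|Q. Re (c * v x) * indicator A (Y x))"
    if c: "norm c = 1" for c
  proof -
    have Re1: "\<bar>Re (c * z)\<bar> \<le> 1" if "norm z \<le> 1" for z
      using abs_Re_le_cmod[of "c * z"] c that by (simp add: norm_mult)
    have "(LINT x|P. (1 + Re (c * w x)) * indicator A (X x)) = (LINT x|Q. (1 + Re (c * v x)) * indicator A (Y x))"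
    proof (rule weighted_law_unique_nonneg[where B = 2])
      fix s
      have split: "complex_of_real (1 + Re (c * z)) * iexp y =
          iexp y + c / 2 * (z * iexp y) + cnj c / 2 * cnj (z * iexp (- y))" for y z
      proof -
        have "complex_of_real (Re (c * z)) = (c * z + cnj (c * z)) / 2"
          by (simp add: complex_eq_iff)
        moreover have "cnj (iexp (- y)) = iexp y" using iexp_minus[of y] by (metis complex_cnj_cnj)
        moreover have "complex_of_real (1 + Re (c * z)) = 1 + complex_of_real (Re (c * z))"
          by (simp only: of_real_add of_real_1)
        ultimately show ?thesis
          by (simp only: complex_cnj_mult) (simp add: field_simps)
      qed
      have "(CLINT x|P. complex_of_real (1 + Re (c * w x)) * iexp (s * X x)) =
        (CLINT x|P. iexp (s * X x)) + c / 2 * (CLINT x|P. w x * iexp (s * X x))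
         + cnj c / 2 * cnj (CLINT x|P. w x * iexp (- s * X x))"
        unfolding split using w
        by (simp add: bP norm_mult del: complex_cnj_mult)
      also have "\<dots> = (CLINT x|Q. iexp (s * Y x)) + c / 2 * (CLINT x|Q. v x * iexp (s * Y x))
         + cnj c / 2 * cnj (CLINT x|Q. v x * iexp (- s * Y x))"
        unfolding eq eq1 ..
      also have "\<dots> = (CLINT x|Q. complex_of_real (1 + Re (c * v x)) * iexp (s * Y x))"
        unfolding split using v
        by (simp add: bQ norm_mult del: complex_cnj_mult)
      finally show "(CLINT x|P. complex_of_real (1 + Re (c * w x)) * iexp (s * X x)) =
         (CLINT x|Q. complex_of_real (1 + Re (c * v x)) * iexp (s * Y x))" .
    next
      fix x show "0 \<le> 1 + Re (c * w x)" "1 + Re (c * w x) \<le> 2" using Re1[OF w, of x] by auto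
    next
      fix x show "0 \<le> 1 + Re (c * v x)" "1 + Re (c * v x) \<le> 2" using Re1[OF v, of x] by auto
    qed (use assms in auto)
    moreover have "(LINT x|P. 1 * indicator A (X x)) = (LINT x|Q. 1 * indicator A (Y x) :: real)"
      by (rule weighted_law_unique_nonneg[where B = 1]) (use assms in auto)
    moreover have "integrable P (\<lambda>x. indicator A (X x) :: real)" "integrable Q (\<lambda>x. indicator A (Y x) :: real)"
      by (auto intro!: rP rQ simp: indicator_def)
    moreover have "integrable P (\<lambda>x. Re (c * w x) * indicator A (X x))"
      using Re1[OF w] by (intro rP) (auto simp: indicator_def simp del: Re_complex_of_real times_complex.sel)
    moreover have "integrable Q (\<lambda>x. Re (c * v x) * indicator A (Y x))"
      using Re1[OF v] by (intro rQ) (auto simp: indicator_def simp del: Re_complex_of_real times_complex.sel)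
    ultimately show ?thesis by (simp add: distrib_right del: times_complex.sel)
  qed
  have iP: "integrable P (\<lambda>x. w x * indicator A (X x))"
    using w by (intro bP) (auto simp: indicator_def norm_mult)
  have iQ: "integrable Q (\<lambda>x. v x * indicator A (Y x))"
    using v by (intro bQ) (auto simp: indicator_def norm_mult)
  have Re: "Re (z * indicator A y) = Re (1 * z) * indicator A y"
    and Im: "Im (z * indicator A y) = Re (- \<i> * z) * indicator A y" for z y
    by (cases "y \<in> A"; simp)+
  show ?thesis
  proof (rule complex_eqI)
    show "Re (CLINT x|P. w x * indicator A (X x)) = Re (CLINT x|Q. v x * indicator A (Y x))"
      unfolding integral_Re[OF iP, symmetric] integral_Re[OF iQ, symmetric] Re
      by (rule real_part) simp
    show "Im (CLINT x|P. w x * indicator A (X x)) = Im (CLINT x|Q. v x * indicator A (Y x))"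
      unfolding integral_Im[OF iP, symmetric] integral_Im[OF iQ, symmetric] Im
      by (rule real_part) simp
  qed
qed

text \<open>The indices are moved one at a time from the exponential to the indicators, the exponential
  of the remaining ones being part of the bounded weight.\<close>

lemma joint_law_unique_aux:
  fixes X :: "'i \<Rightarrow> 'a \<Rightarrow> real" and Y :: "'i \<Rightarrow> 'b \<Rightarrow> real"
  assumes "prob_space P" "prob_space Q" "finite J" "finite K" "J \<inter> K = {}"
    and X: "\<And>i. i \<in> J \<union> K \<Longrightarrow> X i \<in> borel_measurable P"
    and Y: "\<And>i. i \<in> J \<union> K \<Longrightarrow> Y i \<in> borel_measurable Q"
    and eq: "\<And>c. (CLINT x|P. iexp (\<Sum>i\<in>J \<union> K. c i * X i x)) = (CLINT x|Q. iexp (\<Sum>i\<in>J \<union> K. c i * Y i x))"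
    and A: "\<And>i. i \<in> J \<Longrightarrow> A i \<in> sets borel"
  shows "(CLINT x|P. (\<Prod>i\<in>J. indicator (A i) (X i x)) * iexp (\<Sum>i\<in>K. c i * X i x)) =
    (CLINT x|Q. (\<Prod>i\<in>J. indicator (A i) (Y i x)) * iexp (\<Sum>i\<in>K. c i * Y i x))"
  using assms(3-)
proof (induction J arbitrary: K c rule: finite_induct)
  case empty
  then show ?case by simp
next
  case (insert j J)
  note [measurable] = insert.prems(3)[of j] insert.prems(4)[of j]
  have XJ[measurable]: "X i \<in> borel_measurable P" "Y i \<in> borel_measurable Q" if "i \<in> J \<union> K" for i
    using that insert.prems by auto
  have AJ[measurable]: "A i \<in> sets borel" if "i \<in> J" for i using that insert.prems by auto
  have jK: "j \<notin> K" "j \<notin> J" using insert by auto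
  have IH: "(CLINT x|P. (\<Prod>i\<in>J. indicator (A i) (X i x)) * iexp (\<Sum>i\<in>insert j K. c i * X i x)) =
    (CLINT x|Q. (\<Prod>i\<in>J. indicator (A i) (Y i x)) * iexp (\<Sum>i\<in>insert j K. c i * Y i x))" for c
    by (rule insert.IH) (use insert in auto)
  let ?w = "\<lambda>c x. (\<Prod>i\<in>J. indicator (A i) (X i x)) * iexp (\<Sum>i\<in>K. c i * X i x)"
  let ?v = "\<lambda>c x. (\<Prod>i\<in>J. indicator (A i) (Y i x)) * iexp (\<Sum>i\<in>K. c i * Y i x)"
  have "(CLINT x|P. ?w c x * indicator (A j) (X j x)) = (CLINT x|Q. ?v c x * indicator (A j) (Y j x))"
  proof (rule weighted_law_unique)
    show "norm (?w c x) \<le> 1" "norm (?v c y) \<le> 1" for x y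
      by (auto simp: norm_mult prod_norm[symmetric] indicator_def intro!: prod_le_1)
    fix s
    \<comment> \<open>The coefficient of \<open>X j\<close> is free in the induction hypothesis;
      setting it to \<open>s\<close> turns that equation into the weighted transform of
      \<open>X j\<close> at \<open>s\<close>.\<close>
    let ?c = "c(j := s)"
    have 1: "(\<Sum>i\<in>insert j K. ?c i * Z i x) = (\<Sum>i\<in>K. c i * Z i x) + s * Z j x"
      for Z :: "'i \<Rightarrow> 'c \<Rightarrow> real" and x
    proof -
      have "(\<Sum>i\<in>K. ?c i * Z i x) = (\<Sum>i\<in>K. c i * Z i x)"
        using jK by (intro sum.cong) auto
      then show ?thesis using jK insert.prems(1) by (simp del: fun_upd_apply) simp
    qed
    show "(CLINT x|P. ?w c x * iexp (s * X j x)) = (CLINT x|Q. ?v c x * iexp (s * Y j x))"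
      using IH[of ?c] unfolding 1 by (simp add: exp_add distrib_left mult.assoc)
  next
    fix s
    \<comment> \<open>Coefficients supported at \<open>j\<close> give the unweighted characteristic
      function of \<open>X j\<close>.\<close>
    have 2: "(\<Sum>i\<in>insert j J \<union> K. (if i = j then s else 0) * Z i x) = s * Z j x"
      for Z :: "'i \<Rightarrow> 'c \<Rightarrow> real" and x
    proof -
      have "(\<Sum>i\<in>insert j J \<union> K. (if i = j then s else 0) * Z i x) =
          (\<Sum>i\<in>insert j J \<union> K. (if i = j then s * Z j x else 0))"
        by (intro sum.cong) auto
      then show ?thesis using insert.hyps insert.prems(1) by (simp add: sum.delta)
    qed
    show "(CLINT x|P. iexp (s * X j x)) = (CLINT x|Q. iexp (s * Y j x))"
      using insert.prems(5)[of "\<lambda>i. if i = j then s else 0"] unfolding 2 .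
  next
    show "?w c \<in> borel_measurable P" by measurable
    show "?v c \<in> borel_measurable Q" by measurable
  qed (use assms(1,2) insert.prems in auto)
  then show ?case
    using jK insert.hyps by (simp add: mult_ac)
qed

text \<open>A Cramer-Wold statement for product events: \<open>joint_law_unique_aux\<close> with
  every index moved to the indicators. It serves to compare \<open>P\<close> with its image under a
  map, and the \<open>eps\<close> variables with a product measure.\<close>

theorem joint_law_unique:
  fixes X :: "'i \<Rightarrow> 'a \<Rightarrow> real" and Y :: "'i \<Rightarrow> 'b \<Rightarrow> real"
  assumes "prob_space P" "prob_space Q" "finite J"
    and X: "\<And>i. i \<in> J \<Longrightarrow> X i \<in> borel_measurable P"
    and Y: "\<And>i. i \<in> J \<Longrightarrow> Y i \<in> borel_measurable Q"
    and eq: "\<And>c. (CLINT x|P. iexp (\<Sum>i\<in>J. c i * X i x)) = (CLINT x|Q. iexp (\<Sum>i\<in>J. c i * Y i x))"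
    and A: "\<And>i. i \<in> J \<Longrightarrow> A i \<in> sets borel"
  shows "measure P {x \<in> space P. \<forall>i\<in>J. X i x \<in> A i} = measure Q {x \<in> space Q. \<forall>i\<in>J. Y i x \<in> A i}"
proof -
  have conv: "complex_of_real (measure R {x \<in> space R. \<forall>i\<in>J. Z i x \<in> A i}) = (CLINT x|R. (\<Prod>i\<in>J. indicator (A i) (Z i x)))"
    if "prob_space R" and Z: "\<And>i. i \<in> J \<Longrightarrow> Z i \<in> borel_measurable R"
    for R :: "'c measure" and Z :: "'i \<Rightarrow> 'c \<Rightarrow> real"
  proof -
    interpret R: prob_space R by fact
    note [measurable] = Z A
    have "{x \<in> space R. \<forall>i\<in>J. Z i x \<in> A i} \<in> sets R" using assms(3) by measurable
    then have "measure R {x \<in> space R. \<forall>i\<in>J. Z i x \<in> A i} = (LINT x|R. indicator {x \<in> space R. \<forall>i\<in>J. Z i x \<in> A i} x)"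
      by simp
    then have "complex_of_real (measure R {x \<in> space R. \<forall>i\<in>J. Z i x \<in> A i}) =
       (CLINT x|R. complex_of_real (indicator {x \<in> space R. \<forall>i\<in>J. Z i x \<in> A i} x))"
      by (simp only: integral_complex_of_real)
    also have "\<dots> = (CLINT x|R. (\<Prod>i\<in>J. indicator (A i) (Z i x)))"
      using assms(3) by (intro Bochner_Integration.integral_cong) (auto simp: indicator_def of_bool_def prod_zero_iff)
    finally show ?thesis .
  qed
  have "complex_of_real (measure P {x \<in> space P. \<forall>i\<in>J. X i x \<in> A i}) = measure Q {x \<in> space Q. \<forall>i\<in>J. Y i x \<in> A i}"
    using joint_law_unique_aux[of P Q J "{}" X Y A] assms by (simp add: conv)
  then show ?thesis by (simp only: of_real_eq_iff)
qed

section \<open>Laguerre polynomials\<close>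

text \<open>\<open>exp_moment a p\<close> is \<open>\<integral>\<^sub>0\<^sup>\<infinity> p(x) exp (-a x) dx\<close>, as a formula in the coefficients of \<open>p\<close>.\<close>

definition exp_moment :: "real \<Rightarrow> real poly \<Rightarrow> real" where
  "exp_moment a p = (\<Sum>k\<le>degree p. coeff p k * fact k / a ^ Suc k)"

lemma exp_moment_eq:
  assumes "degree p \<le> n"
  shows "exp_moment a p = (\<Sum>k\<le>n. coeff p k * fact k / a ^ Suc k)"
  unfolding exp_moment_def
  using assms by (intro sum.mono_neutral_left) (auto simp: coeff_eq_0)

lemma exp_moment_add: "exp_moment a (p + q) = exp_moment a p + exp_moment a q"
proof -
  let ?n = "max (degree p) (degree q)"
  have "exp_moment a (p + q) = (\<Sum>k\<le>?n. coeff (p + q) k * fact k / a ^ Suc k)"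
    by (rule exp_moment_eq) (simp add: degree_add_le_max)
  also have "\<dots> = (\<Sum>k\<le>?n. coeff p k * fact k / a ^ Suc k) + (\<Sum>k\<le>?n. coeff q k * fact k / a ^ Suc k)"
    by (simp add: sum.distrib[symmetric] distrib_right add_divide_distrib)
  also have "\<dots> = exp_moment a p + exp_moment a q"
    by (simp add: exp_moment_eq[of p ?n] exp_moment_eq[of q ?n])
  finally show ?thesis .
qed

lemma exp_moment_smult: "exp_moment a (smult c p) = c * exp_moment a p"
  by (simp add: exp_moment_eq[of "smult c p" "degree p"] degree_smult_le exp_moment_eq[of p "degree p"]
      sum_distrib_left mult.assoc)

lemma exp_moment_diff: "exp_moment a (p - q) = exp_moment a p - exp_moment a q"
  using exp_moment_add[of a p "smult (-1) q"] exp_moment_smult[of a "-1" q] by simp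

text \<open>Integration by parts for the weight \<open>exp (- x)\<close>, done on coefficients:
  \<open>fact (Suc k)\<close> absorbs the factor \<open>Suc k\<close> produced by differentiation,
  and only the constant term is lost.\<close>

lemma exp_moment_pderiv: "exp_moment 1 (pderiv p) = exp_moment 1 p - poly p 0"
proof -
  have "exp_moment 1 (pderiv p) = (\<Sum>k\<le>degree p. coeff p (Suc k) * fact (Suc k))"
    by (subst exp_moment_eq[of _ "degree p"]) (auto simp: degree_pderiv coeff_pderiv mult_ac)
  also have "\<dots> = (\<Sum>k\<in>{1..Suc (degree p)}. coeff p k * fact k)"
    by (rule sum.reindex_bij_witness[of _ "\<lambda>k. k - 1" Suc]) auto
  also have "\<dots> = (\<Sum>k\<in>{..Suc (degree p)} - {0}. coeff p k * fact k)"
    by (rule sum.cong) auto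
  also have "\<dots> = (\<Sum>k\<le>Suc (degree p). coeff p k * fact k) - coeff p 0"
    by (subst sum_diff1) auto
  also have "\<dots> = exp_moment 1 p - poly p 0"
    by (subst exp_moment_eq[of p "Suc (degree p)"]) (auto simp: poly_0_coeff_0)
  finally show ?thesis .
qed

definition laguerre_poly :: "nat \<Rightarrow> real poly" where
  "laguerre_poly n = Abs_poly (\<lambda>k. real (n choose k) * (-1) ^ k / fact k)"

lemma coeff_laguerre_poly: "coeff (laguerre_poly n) k = real (n choose k) * (-1) ^ k / fact k"
  unfolding laguerre_poly_def by (subst coeff_Abs_poly[of n]) auto

lemma degree_laguerre_poly: "degree (laguerre_poly n) \<le> n"
  by (rule degree_le) (auto simp: coeff_laguerre_poly)

lemma laguerre_eq_poly: "laguerre n x = poly (laguerre_poly n) x"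
proof -
  have "poly (laguerre_poly n) x = (\<Sum>k\<le>n. coeff (laguerre_poly n) k * x ^ k)"
    unfolding poly_altdef using degree_laguerre_poly[of n]
    by (intro sum.mono_neutral_left) (auto simp: coeff_eq_0)
  also have "\<dots> = (\<Sum>k=0..n. real (n choose k) * (1 / fact k) * (- x) ^ k)"
    by (intro sum.cong) (auto simp: coeff_laguerre_poly power_minus[of x])
  finally show ?thesis by (simp add: laguerre_def)
qed

lemma laguerre_poly_0: "laguerre_poly 0 = 1"
  by (rule poly_eqI) (auto simp: coeff_laguerre_poly)

text \<open>The antiderivative of \<open>L_n\<close> that vanishes at 0. With the difference as
  definition the recursion from \<open>L_n\<close> to \<open>L_(n+1)\<close> is immediate, and the
  derivative and the value at 0 are what has to be checked.\<close>

definition laguerre_prim :: "nat \<Rightarrow> real poly" where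
  "laguerre_prim n = laguerre_poly n - laguerre_poly (Suc n)"

lemma pderiv_laguerre_prim: "pderiv (laguerre_prim n) = laguerre_poly n"
proof (rule poly_eqI)
  fix k
  \<comment> \<open>Pascal's rule: \<open>n choose Suc k\<close> cancels and
    \<open>- (n choose k)\<close> survives; its sign turns \<open>(-1) ^ Suc k\<close> into
    \<open>(-1) ^ k\<close>.\<close>
  have "coeff (laguerre_prim n) (Suc k) = real (n choose k) * (-1) ^ k / fact (Suc k)"
    by (simp add: laguerre_prim_def coeff_laguerre_poly add_divide_distrib[symmetric]
        diff_divide_distrib[symmetric] algebra_simps)
  then show "coeff (pderiv (laguerre_prim n)) k = coeff (laguerre_poly n) k"
    by (simp add: coeff_pderiv coeff_laguerre_poly del: of_nat_Suc)
qed

lemma laguerre_prim_0: "poly (laguerre_prim n) 0 = 0"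
  by (simp add: laguerre_prim_def coeff_laguerre_poly poly_0_coeff_0)

lemma laguerre_poly_Suc: "laguerre_poly (Suc n) = laguerre_poly n - laguerre_prim n"
  by (simp add: laguerre_prim_def)

text \<open>As \<open>laguerre_prim m\<close> vanishes at 0, integration by parts gives it the same
  moment as its derivative \<open>laguerre_poly m\<close>, and the recursion subtracts one from the
  other.\<close>

lemma exp_moment_laguerre_poly: "exp_moment 1 (laguerre_poly n) = (if n = 0 then 1 else 0)"
proof (cases n)
  case 0
  then show ?thesis by (simp add: laguerre_poly_0 exp_moment_def)
next
  case (Suc m)
  have "exp_moment 1 (laguerre_poly m) = exp_moment 1 (laguerre_prim m)"
    using exp_moment_pderiv[of "laguerre_prim m"] by (simp add: pderiv_laguerre_prim laguerre_prim_0)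
  then show ?thesis by (simp add: Suc laguerre_poly_Suc exp_moment_diff)
qed

text \<open>The map \<open>p \<mapsto> p - \<integral>\<^sub>0 p\<close> is an isometry for the weight \<open>exp (-x)\<close>, by integration by parts.\<close>

lemma exp_moment_laguerre_mult:
  "exp_moment 1 (laguerre_poly n * laguerre_poly m) = (if n = m then 1 else 0)"
proof (induction n arbitrary: m)
  case 0
  then show ?case by (simp add: laguerre_poly_0 exp_moment_laguerre_poly)
next
  case (Suc n)
  show ?case
  proof (cases m)
    case 0
    then show ?thesis by (simp add: laguerre_poly_0 exp_moment_laguerre_poly)
  next
    case m: (Suc k)
    let ?p = "laguerre_prim n" and ?q = "laguerre_prim k"
    have "exp_moment 1 (laguerre_poly n * ?q + ?p * laguerre_poly k) = exp_moment 1 (?p * ?q)"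
      using exp_moment_pderiv[of "?p * ?q"]
      by (simp add: pderiv_mult pderiv_laguerre_prim laguerre_prim_0 mult.commute add.commute)
    \<comment> \<open>By the preceding equation the last two summands have opposite moments, so the
      moment for \<open>(Suc n, Suc k)\<close> equals the one for \<open>(n, k)\<close>.\<close>
    moreover have "laguerre_poly (Suc n) * laguerre_poly m =
        laguerre_poly n * laguerre_poly k - (laguerre_poly n * ?q + ?p * laguerre_poly k) + ?p * ?q"
      by (simp add: m laguerre_poly_Suc algebra_simps)
    ultimately show ?thesis
      using Suc.IH[of k] by (simp only: exp_moment_add exp_moment_diff) (simp add: m)
  qed
qed

text \<open>The Laplace transform of \<open>L_n\<close>, from the binomial theorem in
  \<open>- 1 / a\<close>. At \<open>a = m + 1\<close> it yields the Laguerre coefficients of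
  \<open>u ^ m\<close>.\<close>

lemma exp_moment_laguerre_general:
  assumes "a \<noteq> 0"
  shows "exp_moment a (laguerre_poly n) = (1 - 1 / a) ^ n / a"
proof -
  have "exp_moment a (laguerre_poly n) = (\<Sum>k\<le>n. real (n choose k) * (-1) ^ k / a ^ Suc k)"
    by (subst exp_moment_eq[OF degree_laguerre_poly]) (simp add: coeff_laguerre_poly)
  also have "\<dots> = (\<Sum>k\<le>n. real (n choose k) * (- 1 / a) ^ k * 1 ^ (n - k)) / a"
    unfolding sum_divide_distrib
    by (intro sum.cong refl) (simp only: power_divide power_one mult_1_right power_Suc2 times_divide_eq_right divide_divide_eq_left)
  also have "\<dots> = (1 - 1 / a) ^ n / a"
    using binomial_ring[of "- 1 / a" 1 n] by simp
  finally show ?thesis .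
qed

section \<open>Laplace integrals of polynomials over the half-line\<close>

lemma has_bochner_integral_power_exp:
  fixes a :: real
  assumes "a > 0"
  shows "has_bochner_integral lborel (\<lambda>x. indicator {0<..} x * (x ^ k * exp (- a * x))) (fact k / a ^ Suc k)"
proof -
  have "has_bochner_integral lborel (\<lambda>x::real. indicator {0..} x * (x ^ k * exp (- x))) (fact k)"
  proof (rule has_bochner_integral_nn_integral)
    have "(\<integral>\<^sup>+x. ennreal (indicator {0..} (x::real) * (x ^ k * exp (- x))) \<partial>lborel) =
       (\<integral>\<^sup>+x. ennreal (x ^ k * exp (- x)) * indicator {0..} x \<partial>lborel)"
      by (intro nn_integral_cong) (simp add: indicator_def)
    then show "(\<integral>\<^sup>+x. ennreal (indicator {0..} x * (x ^ k * exp (- x))) \<partial>lborel) = ennreal (fact k)"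
      by (simp add: nn_intergal_power_times_exp_Ici)
  qed (auto simp: indicator_def)
  from lborel_has_bochner_integral_real_affine_iff[THEN iffD1, OF _ this, of a 0]
  have "has_bochner_integral lborel (\<lambda>x. indicator {0..} (a * x) * ((a * x) ^ k * exp (- (a * x)))) (fact k / a)"
    using assms by (simp add: field_simps)
  then have "has_bochner_integral lborel (\<lambda>x. (1 / a ^ k) * (indicator {0..} (a * x) * ((a * x) ^ k * exp (- (a * x)))))
      ((1 / a ^ k) * (fact k / a))"
    by (rule has_bochner_integral_mult_right)
  moreover have "(1 / a ^ k) * (indicator {0..} (a * x) * ((a * x) ^ k * exp (- (a * x)))) =
      indicator {0..} x * (x ^ k * exp (- a * x))" for x
    using assms by (simp add: indicator_def power_mult_distrib zero_le_mult_iff)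
  ultimately have *: "has_bochner_integral lborel (\<lambda>x. indicator {0..} x * (x ^ k * exp (- a * x))) (fact k / a ^ Suc k)"
    by (simp add: mult.commute)
  show ?thesis
    by (rule has_bochner_integral_cong_AE[THEN iffD1, OF _ _ _ *])
       (use AE_lborel_singleton[of "0::real"] in \<open>auto elim!: eventually_mono simp: indicator_def\<close>)
qed

lemma has_bochner_integral_exp_moment:
  assumes "a > 0"
  shows "has_bochner_integral lborel (\<lambda>x. indicator {0<..} x * (poly p x * exp (- a * x))) (exp_moment a p)"
proof -
  have "has_bochner_integral lborel (\<lambda>x. \<Sum>k\<le>degree p. coeff p k * (indicator {0<..} x * (x ^ k * exp (- a * x))))
     (\<Sum>k\<le>degree p. coeff p k * (fact k / a ^ Suc k))"
    by (intro has_bochner_integral_sum has_bochner_integral_mult_right has_bochner_integral_power_exp assms)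
  then show ?thesis
    by (simp add: exp_moment_def poly_altdef sum_distrib_left sum_distrib_right mult_ac)
qed

section \<open>Integration with respect to the clock\<close>

lemma has_bochner_integral_eq_on_space:
  assumes "has_bochner_integral M f I" "\<And>x. x \<in> space M \<Longrightarrow> f x = g x"
  shows "has_bochner_integral M g I"
  using has_bochner_integral_cong[of M M f g I I] assms by simp

lemma borel_measurable_poly[measurable (raw)]:
  fixes f :: "'a \<Rightarrow> real"
  assumes "f \<in> borel_measurable M"
  shows "(\<lambda>x. poly p (f x)) \<in> borel_measurable M"
  using assms by (rule measurable_compose) (intro borel_measurable_continuous_onI continuous_intros)

text \<open>The theorem on change of variables is about absolute integrability over
  \<open>lebesgue\<close>. Borel measurability of the integrands allows passing to the completion of
  \<open>lborel\<close> and back without altering the integrals.\<close>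

lemma has_bochner_integral_lborel_substitution:
  fixes f g g' :: "real \<Rightarrow> real"
  assumes S[measurable]: "S \<in> sets borel" "g ` S \<in> sets borel"
    and der: "\<And>x. x \<in> S \<Longrightarrow> (g has_field_derivative g' x) (at x within S)"
    and inj: "inj_on g S"
    and f[measurable]: "f \<in> borel_measurable borel"
    and int: "has_bochner_integral lborel (\<lambda>x. indicator S x * (\<bar>g' x\<bar> * f (g x))) I"
  shows "has_bochner_integral lborel (\<lambda>x. indicator (g ` S) x * f x) I"
proof -
  have i: "integrable lborel (\<lambda>x. indicator S x * (\<bar>g' x\<bar> * f (g x)))"
    using int by (simp add: has_bochner_integral_iff)
  note im = borel_measurable_integrable[OF i]
  have *: "set_integrable lebesgue S (\<lambda>x. \<bar>g' x\<bar> * f (g x))"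
    using i integrable_completion[OF im] by (simp add: set_integrable_def)
  moreover have "integral S (\<lambda>x. \<bar>g' x\<bar> * f (g x)) = I"
    using int unfolding set_lebesgue_integral_eq_integral(2)[OF *, symmetric] set_lebesgue_integral_def has_bochner_integral_iff
    using integral_completion[OF im] by simp
  ultimately have A: "set_integrable lebesgue (g ` S) f" and B: "integral (g ` S) f = I"
    using has_absolute_integral_change_of_variables_1'[of S g g' f I] der inj S by auto
  have m: "(\<lambda>x. indicator (g ` S) x * f x) \<in> borel_measurable lborel" by measurable
  show ?thesis
    using A B m unfolding set_lebesgue_integral_eq_integral(2)[OF A, symmetric]
    by (simp add: set_integrable_def set_lebesgue_integral_def has_bochner_integral_iff
        integrable_completion integral_completion)
qed

text \<open>Substitution \<open>v = T * exp (- x)\<close>: the half-line is mapped decreasingly onto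
  \<open>(0, T)\<close>, and the Jacobian supplies the factor \<open>T\<close> and the weight
  \<open>exp (- x)\<close>.\<close>

lemma has_bochner_integral_ln_left:
  fixes T :: real and G :: "real \<Rightarrow> real"
  assumes "T > 0" and [measurable]: "G \<in> borel_measurable borel"
    and int: "has_bochner_integral lborel (\<lambda>x. indicator {0<..} x * (G x * exp (- x))) I"
  shows "has_bochner_integral lborel (\<lambda>v. indicator {0<..<T} v * G (ln (T / v))) (T * I)"
proof -
  have im: "(\<lambda>x. T * exp (- x)) ` {0<..} = {0<..<T}"
  proof (intro equalityI subsetI)
    fix v assume v: "v \<in> {0<..<T}"
    then have "exp (ln (T / v)) = T / v" by (subst exp_ln) auto
    then have "v = T * exp (- ln (T / v))" using v by (simp add: exp_minus)
    moreover have "ln (T / v) > 0" using v by simp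
    ultimately show "v \<in> (\<lambda>x. T * exp (- x)) ` {0<..}" by blast
  qed (use assms in auto)
  have "has_bochner_integral lborel (\<lambda>v. indicator ((\<lambda>x. T * exp (- x)) ` {0<..}) v * G (ln (T / v))) (T * I)"
  proof (rule has_bochner_integral_lborel_substitution[where g' = "\<lambda>x. - T * exp (- x)"])
    show "((\<lambda>x. T * exp (- x)) has_field_derivative - T * exp (- x)) (at x within {0<..})" for x
      by (auto intro!: derivative_eq_intros)
    show "inj_on (\<lambda>x. T * exp (- x)) {0<..}" using assms by (auto simp: inj_on_def)
    have "has_bochner_integral lborel (\<lambda>x. T * (indicator {0<..} x * (G x * exp (- x)))) (T * I)"
      by (rule has_bochner_integral_mult_right[OF int])
    moreover have "T * (indicator {0<..} x * (G x * exp (- x))) =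
        indicator {0<..} x * (\<bar>- T * exp (- x)\<bar> * G (ln (T / (T * exp (- x)))))" for x
    proof -
      have "T / (T * exp (- x)) = exp x" using assms by (simp add: exp_minus inverse_eq_divide)
      then show ?thesis using assms by (simp add: abs_mult)
    qed
    ultimately show "has_bochner_integral lborel
        (\<lambda>x. indicator {0<..} x * (\<bar>- T * exp (- x)\<bar> * G (ln (T / (T * exp (- x)))))) (T * I)"
      by simp
  qed (simp_all add: im)
  then show ?thesis by (simp add: im)
qed

text \<open>Substitution \<open>v = T * exp x\<close>. Here the Jacobian grows and the decay has to
  come from \<open>G\<close>; for products of two kernels it is
  \<open>exp (- 2 * x)\<close>.\<close>

lemma has_bochner_integral_ln_right:
  fixes T :: real and G :: "real \<Rightarrow> real"
  assumes "T > 0" and [measurable]: "G \<in> borel_measurable borel"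
    and int: "has_bochner_integral lborel (\<lambda>x. indicator {0<..} x * (G x * exp x)) I"
  shows "has_bochner_integral lborel (\<lambda>v. indicator {T<..} v * G (ln (v / T))) (T * I)"
proof -
  have im: "(\<lambda>x. T * exp x) ` {0<..} = {T<..}"
  proof (intro equalityI subsetI)
    fix v assume v: "v \<in> {T<..}"
    then have "exp (ln (v / T)) = v / T" using assms by (subst exp_ln) auto
    then have "v = T * exp (ln (v / T))" using assms by simp
    moreover have "ln (v / T) > 0" using v assms by simp
    ultimately show "v \<in> (\<lambda>x. T * exp x) ` {0<..}" by blast
  qed (use assms in auto)
  have "has_bochner_integral lborel (\<lambda>v. indicator ((\<lambda>x. T * exp x) ` {0<..}) v * G (ln (v / T))) (T * I)"
  proof (rule has_bochner_integral_lborel_substitution[where g' = "\<lambda>x. T * exp x"])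
    show "((\<lambda>x. T * exp x) has_field_derivative T * exp x) (at x within {0<..})" for x
      by (auto intro!: derivative_eq_intros)
    show "inj_on (\<lambda>x. T * exp x) {0<..}" using assms by (auto simp: inj_on_def)
    have "has_bochner_integral lborel (\<lambda>x. T * (indicator {0<..} x * (G x * exp x))) (T * I)"
      by (rule has_bochner_integral_mult_right[OF int])
    moreover have "T * (indicator {0<..} x * (G x * exp x)) =
        indicator {0<..} x * (\<bar>T * exp x\<bar> * G (ln (T * exp x / T)))" for x
      using assms by (simp add: abs_mult)
    ultimately show "has_bochner_integral lborel
        (\<lambda>x. indicator {0<..} x * (\<bar>T * exp x\<bar> * G (ln (T * exp x / T)))) (T * I)"
      by simp
  qed (simp_all add: im)
  then show ?thesis by (simp add: im)
qed

section \<open>The measure dV, seen as Lebesgue measure in the variable \<open>V s\<close>\<close>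

locale clock =
  fixes V :: "real \<Rightarrow> real"
  assumes V_strict_mono: "strict_mono_on {0..} V"
    and V_continuous: "continuous_on {0..} V"
    and V_0[simp]: "V 0 = 0"
    and V_at_top: "filterlim V at_top at_top"
begin

lemma V_less_iff:
  assumes "0 \<le> s" "0 \<le> t"
  shows "V s < V t \<longleftrightarrow> s < t"
  using strict_mono_onD[OF V_strict_mono, of s t] strict_mono_onD[OF V_strict_mono, of t s] assms
  by (cases s t rule: linorder_cases) auto

lemma V_le_iff: "0 \<le> s \<Longrightarrow> 0 \<le> t \<Longrightarrow> V s \<le> V t \<longleftrightarrow> s \<le> t"
  using V_less_iff[of t s] by (simp add: not_less[symmetric])

lemma V_pos: "0 < t \<Longrightarrow> 0 < V t"
  using V_less_iff[of 0 t] by simp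

lemma V_nonneg: "0 \<le> t \<Longrightarrow> 0 \<le> V t"
  using V_le_iff[of 0 t] by simp

lemma V_min: "0 \<le> s \<Longrightarrow> 0 \<le> t \<Longrightarrow> V (min s t) = min (V s) (V t)"
  using V_le_iff[of s t] by (simp add: min_def)

lemma V_surj:
  assumes "0 \<le> v"
  obtains s where "0 \<le> s" "V s = v"
proof -
  obtain N where N: "\<And>t. t \<ge> N \<Longrightarrow> V t \<ge> v"
    using V_at_top unfolding filterlim_at_top eventually_at_top_linorder by blast
  have "\<exists>s\<ge>0. s \<le> max 0 N \<and> V s = v"
    using assms N[of "max 0 N"] continuous_on_subset[OF V_continuous, of "{0..max 0 N}"]
    by (intro IVT') auto
  then show thesis using that by blast
qed

abbreviation "\<mu> \<equiv> qv_measure V"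

definition V0 :: "real \<Rightarrow> real" where "V0 t = V (max 0 t)"

lemma V0_mono: "x \<le> y \<Longrightarrow> V0 x \<le> V0 y"
  by (simp add: V0_def V_le_iff)

lemma V0_continuous: "continuous_on UNIV V0"
  unfolding V0_def
  by (intro continuous_on_compose2[OF V_continuous] continuous_intros) auto

lemma V0_right_cont: "continuous (at_right a) V0"
  using V0_continuous by (simp add: continuous_on_eq_continuous_at continuous_at_imp_continuous_at_within)

lemma V0_measurable[measurable]: "V0 \<in> borel_measurable borel"
  by (rule borel_measurable_continuous_onI[OF V0_continuous])

lemma qv_eq: "\<mu> = restrict_space (interval_measure V0) {0..}"
  by (simp add: qv_measure_def V0_def[abs_def])

lemma space_qv[simp]: "space \<mu> = {0..}"
  by (simp add: qv_eq space_restrict_space)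

lemma sets_qv: "sets \<mu> = sets (restrict_space borel {0..})"
  by (simp add: qv_eq sets_restrict_space)

lemma borel_measurable_qv: "f \<in> borel_measurable borel \<Longrightarrow> f \<in> borel_measurable \<mu>"
  unfolding measurable_cong_sets[OF sets_qv refl] by (rule measurable_restrict_space1)

lemma V_measurable[measurable]: "V \<in> borel_measurable \<mu>"
proof -
  have "V \<in> borel_measurable \<mu> \<longleftrightarrow> V0 \<in> borel_measurable \<mu>"
    by (rule measurable_cong) (simp add: V0_def)
  then show ?thesis using borel_measurable_qv[OF V0_measurable] by simp
qed

lemma ident_measurable_qv[measurable]: "(\<lambda>s. s) \<in> borel_measurable \<mu>"
  by (rule borel_measurable_qv) simp

lemma sigma_finite_qv: "sigma_finite_measure \<mu>"
  unfolding qv_eq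
  by (rule sigma_finite_measure_restrict_space[OF sigma_finite_interval_measure])
     (auto intro: V0_mono V0_right_cont)

lemma emeasure_qv_Icc: "0 \<le> a \<Longrightarrow> a \<le> b \<Longrightarrow> emeasure \<mu> {a..b} = V b - V a"
  unfolding qv_eq
  by (subst emeasure_restrict_space)
     (auto simp: emeasure_interval_measure_Icc V0_mono V0_continuous, simp add: V0_def)

lemma sets_qv_subset: "A \<in> sets borel \<Longrightarrow> A \<subseteq> {0..} \<Longrightarrow> A \<in> sets \<mu>"
  unfolding sets_qv by (simp add: sets_restrict_space_iff)

text \<open>Points are null because \<open>V\<close> is continuous; open and closed interval ends
  thereby become interchangeable under integrals.\<close>

lemma AE_qv_neq: "AE s in \<mu>. s \<noteq> c"
proof (cases "c \<ge> 0")
  case True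
  then have "{c} \<in> null_sets \<mu>"
    using emeasure_qv_Icc[of c c] sets_qv_subset[of "{c}"] by (auto simp: null_sets_def)
  then show ?thesis by (rule AE_I'[of "{c}"]) auto
next
  case False
  then show ?thesis by (intro AE_I2) auto
qed

text \<open>Both measures are compared on the half-lines \<open>{..a}\<close>. For
  \<open>a \<ge> 0\<close> surjectivity gives \<open>a = V s\<close>, and by monotonicity the
  preimage is \<open>{0..s}\<close>, of mass \<open>V s\<close>.\<close>

lemma distr_qv: "distr \<mu> borel V = density lborel (indicator {0..})"
proof (rule measure_eqI_generator_eq)
  show "Int_stable (range (\<lambda>a::real. {..a}))" by (auto simp: Int_stable_def)
  show "range (\<lambda>a::real. {..a}) \<subseteq> Pow UNIV" by auto
  show "sets (distr \<mu> borel V) = sigma_sets UNIV (range (\<lambda>a::real. {..a}))"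
    by (simp add: borel_eq_atMost)
  show "sets (density lborel (indicator {0..})) = sigma_sets UNIV (range (\<lambda>a::real. {..a}))"
    by (simp add: borel_eq_atMost)
  have L: "emeasure (distr \<mu> borel V) {..a} = ennreal (max 0 a)" for a
  proof (cases "a \<ge> 0")
    case True
    then obtain s where s: "0 \<le> s" "V s = a" by (rule V_surj)
    have "V -` {..a} \<inter> space \<mu> = {0..s}" using s V_le_iff by auto
    then show ?thesis using s True by (simp add: emeasure_distr emeasure_qv_Icc)
  next
    case False
    then have "V -` {..a} \<inter> space \<mu> = {}" using V_nonneg by force
    then show ?thesis using False by (simp add: emeasure_distr)
  qed
  have R: "emeasure (density lborel (indicator {0..})) {..a} = ennreal (max 0 a)" for a :: real
  proof -
    have "emeasure (density lborel (indicator {0..})) {..a} = (\<integral>\<^sup>+x. indicator {0..a} x \<partial>lborel)"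
      by (subst emeasure_density) (simp, simp, rule nn_integral_cong, simp add: indicator_def)
    also have "\<dots> = emeasure lborel {0..a}" by (rule nn_integral_indicator) simp
    finally show ?thesis by (simp add: max_def)
  qed
  show "emeasure (distr \<mu> borel V) X = emeasure (density lborel (indicator {0..})) X"
    if "X \<in> range (\<lambda>a::real. {..a})" for X
    using that L R by auto
  show "range (\<lambda>n::nat. {..real n}) \<subseteq> range (\<lambda>a::real. {..a})" by auto
  show "(\<Union>n::nat. {..real n}) = UNIV"
    by (auto intro: real_arch_simple)
  show "emeasure (distr \<mu> borel V) {..real n} \<noteq> \<infinity>" for n unfolding L by simp
qed

lemma has_bochner_integral_qv:
  fixes g :: "real \<Rightarrow> real"
  assumes [measurable]: "g \<in> borel_measurable borel"
    and "has_bochner_integral lborel (\<lambda>v. indicator {0..} v * g v) I"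
  shows "has_bochner_integral \<mu> (\<lambda>s. g (V s)) I"
proof -
  have "has_bochner_integral (density lborel (\<lambda>v. ennreal (indicator {0..} v))) g I"
    using assms(2) by (intro has_bochner_integral_density) (auto simp: indicator_def)
  then have "has_bochner_integral (distr \<mu> borel V) g I"
    by (simp add: distr_qv ennreal_indicator[abs_def])
  then show ?thesis
    by (simp add: has_bochner_integral_iff integrable_distr_eq integral_distr)
qed

lemma indicator_V_Ioo:
  "0 \<le> a \<Longrightarrow> 0 \<le> b \<Longrightarrow> 0 \<le> s \<Longrightarrow> indicator {V a<..<V b} (V s) = (indicator {a<..<b} s :: real)"
  by (simp add: indicator_def V_less_iff)

lemma indicator_V_Ioi:
  "0 \<le> a \<Longrightarrow> 0 \<le> s \<Longrightarrow> indicator {V a<..} (V s) = (indicator {a<..} s :: real)"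
  by (simp add: indicator_def V_less_iff)

text \<open>In terms of \<open>x = ln (V t / V s)\<close> the integrand is
  \<open>p(x) exp ((1 - a) x)\<close>, and the Jacobian \<open>exp (- x)\<close> completes this to
  \<open>exp (- a x)\<close>. The value \<open>a = 1\<close> serves products of kernels, larger
  \<open>a\<close> the powers of \<open>V s / V t\<close>, and \<open>a = 1 / 2\<close> the singular
  weight in the drift estimate.\<close>

lemma has_bochner_integral_qv_moment_left:
  assumes "t > 0" "a > 0"
  shows "has_bochner_integral \<mu>
    (\<lambda>s. indicator {0<..<t} s * (poly p (ln (V t / V s)) * exp ((1 - a) * ln (V t / V s)))) (V t * exp_moment a p)"
proof -
  have "has_bochner_integral lborel (\<lambda>x. indicator {0<..} x * ((poly p x * exp ((1 - a) * x)) * exp (- x))) (exp_moment a p)"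
    using has_bochner_integral_exp_moment[OF assms(2), of p]
    by (simp add: mult.assoc exp_add[symmetric] left_diff_distrib)
  then have "has_bochner_integral lborel (\<lambda>v. indicator {0<..<V t} v * (poly p (ln (V t / v)) * exp ((1 - a) * ln (V t / v)))) (V t * exp_moment a p)"
    by (intro has_bochner_integral_ln_left[where G = "\<lambda>x. poly p x * exp ((1 - a) * x)"] V_pos assms) auto
  then have "has_bochner_integral lborel (\<lambda>v. indicator {0..} v * (indicator {0<..<V t} v * (poly p (ln (V t / v)) * exp ((1 - a) * ln (V t / v))))) (V t * exp_moment a p)"
    by (rule has_bochner_integral_eq_on_space) (auto simp: indicator_def)
  then have "has_bochner_integral \<mu> (\<lambda>s. indicator {0<..<V t} (V s) * (poly p (ln (V t / V s)) * exp ((1 - a) * ln (V t / V s)))) (V t * exp_moment a p)"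
    by (intro has_bochner_integral_qv[where g = "\<lambda>v. indicator {0<..<V t} v * (poly p (ln (V t / v)) * exp ((1 - a) * ln (V t / v)))"]) auto
  then show ?thesis
    by (rule has_bochner_integral_eq_on_space) (use assms indicator_V_Ioo[of 0 t] in auto)
qed

text \<open>With \<open>x = ln (V s / V t)\<close> the Jacobian is \<open>exp x\<close>, so the
  exponent \<open>- (1 + a)\<close> leaves \<open>exp (- a x)\<close>. For \<open>a = 1\<close> the
  exponential is the factor \<open>(V t / V s)^2\<close> of two kernels.\<close>

lemma has_bochner_integral_qv_moment_right:
  assumes "t > 0" "a > 0"
  shows "has_bochner_integral \<mu>
    (\<lambda>s. indicator {t<..} s * (poly p (ln (V s / V t)) * exp (- (1 + a) * ln (V s / V t)))) (V t * exp_moment a p)"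
proof -
  have "has_bochner_integral lborel (\<lambda>x. indicator {0<..} x * ((poly p x * exp (- (1 + a) * x)) * exp x)) (exp_moment a p)"
  proof -
    have "exp (- (1 + a) * x) * exp x = exp (- a * x)" for x
      by (simp add: exp_add[symmetric] algebra_simps)
    then show ?thesis
      using has_bochner_integral_exp_moment[OF assms(2), of p] by (simp only: mult.assoc)
  qed
  then have "has_bochner_integral lborel (\<lambda>v. indicator {V t<..} v * (poly p (ln (v / V t)) * exp (- (1 + a) * ln (v / V t)))) (V t * exp_moment a p)"
    by (intro has_bochner_integral_ln_right[where G = "\<lambda>x. poly p x * exp (- (1 + a) * x)"] V_pos assms) auto
  then have "has_bochner_integral lborel (\<lambda>v. indicator {0..} v * (indicator {V t<..} v * (poly p (ln (v / V t)) * exp (- (1 + a) * ln (v / V t))))) (V t * exp_moment a p)"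
    by (rule has_bochner_integral_eq_on_space) (use V_pos[OF assms(1)] in \<open>auto simp: indicator_def\<close>)
  then have "has_bochner_integral \<mu> (\<lambda>s. indicator {V t<..} (V s) * (poly p (ln (V s / V t)) * exp (- (1 + a) * ln (V s / V t)))) (V t * exp_moment a p)"
    by (intro has_bochner_integral_qv[where g = "\<lambda>v. indicator {V t<..} v * (poly p (ln (v / V t)) * exp (- (1 + a) * ln (v / V t)))"]) auto
  then show ?thesis
    by (rule has_bochner_integral_eq_on_space) (use assms indicator_V_Ioi[of t] in auto)
qed

lemma has_bochner_integral_qv_FTC:
  assumes "0 \<le> a" "a \<le> b"
    and "\<And>v. V a \<le> v \<Longrightarrow> v \<le> V b \<Longrightarrow> DERIV F v :> f v"
    and "\<And>v. V a \<le> v \<Longrightarrow> v \<le> V b \<Longrightarrow> isCont f v"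
  shows "has_bochner_integral \<mu> (\<lambda>s. indicator {a<..<b} s * f (V s)) (F (V b) - F (V a))"
proof -
  have ab: "V a \<le> V b" using assms by (simp add: V_le_iff)
  have *: "has_bochner_integral lborel (\<lambda>v. f v * indicator {V a..V b} v) (F (V b) - F (V a))"
    by (rule has_bochner_integral_FTC_Icc_real[OF ab assms(3,4)])
  then have m: "(\<lambda>v. f v * indicator {V a..V b} v) \<in> borel_measurable borel"
    by (simp add: has_bochner_integral_iff borel_measurable_integrable[of lborel, simplified])
  have "has_bochner_integral lborel (\<lambda>v. indicator {0..} v * (f v * indicator {V a..V b} v)) (F (V b) - F (V a))"
    by (rule has_bochner_integral_eq_on_space[OF *]) (use V_nonneg[OF assms(1)] in \<open>auto simp: indicator_def\<close>)
  then have I: "has_bochner_integral \<mu> (\<lambda>s. f (V s) * indicator {V a..V b} (V s)) (F (V b) - F (V a))"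
    by (rule has_bochner_integral_qv[OF m])
  then have m2: "(\<lambda>s. f (V s) * indicator {V a..V b} (V s)) \<in> borel_measurable \<mu>"
    by (rule borel_measurable_has_bochner_integral)
  have "AE s in \<mu>. f (V s) * indicator {V a..V b} (V s) = indicator {a<..<b} s * f (V s)"
    using AE_qv_neq[of a] AE_qv_neq[of b] AE_space[of \<mu>]
    by eventually_elim (use assms in \<open>auto simp: indicator_def V_le_iff\<close>)
  moreover have "(\<lambda>s. indicator {a<..<b} s * f (V s)) \<in> borel_measurable \<mu>"
  proof -
    \<comment> \<open>Nothing is known about \<open>f\<close> outside \<open>[V a, V b]\<close>;
      measurability is inherited from the integrand already at hand, multiplied by
      \<open>indicator {a<..<b}\<close>.\<close>
    have "(\<lambda>s. indicator {a<..<b} s * (f (V s) * indicator {V a..V b} (V s))) \<in> borel_measurable \<mu>"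
      by (rule borel_measurable_times[OF _ m2]) measurable
    moreover have "indicator {a<..<b} s * (f (V s) * indicator {V a..V b} (V s)) = indicator {a<..<b} s * f (V s)"
      if "s \<in> space \<mu>" for s
      using that assms by (auto simp: indicator_def V_le_iff)
    ultimately show ?thesis by (subst measurable_cong[symmetric]) auto
  qed
  ultimately show ?thesis
    using has_bochner_integral_cong_AE[OF m2] I by blast
qed

end

section \<open>The kernels of the iterates\<close>

lemma DERIV_laguerre_prim:
  assumes "(g has_real_derivative g') (at v)"
  shows "((\<lambda>v. poly (laguerre_prim n) (g v)) has_real_derivative poly (laguerre_poly n) (g v) * g') (at v)"
  using DERIV_chain2[OF poly_DERIV[of "laguerre_prim n" "g v"] assms] by (simp add: pderiv_laguerre_prim)

context clock
begin

text \<open>The kernel of the Wiener integral \<open>\<T>^n_t(M)\<close>. It is \<open>0\<close> at \<open>t = 0\<close>, as \<open>V 0 = 0\<close>.\<close>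

definition K :: "int \<Rightarrow> real \<Rightarrow> real \<Rightarrow> real" where
  "K n t s = sqrt (V t) * laguerre_fun V t n s"

lemma K_nonneg:
  assumes "t > 0"
  shows "K (int n) t s = indicator {0<..<t} s * poly (laguerre_poly n) (ln (V t / V s))"
  using V_pos[OF assms] by (simp add: K_def laguerre_fun_def laguerre_eq_poly)

lemma K_neg:
  assumes "t > 0"
  shows "K (- int n - 1) t s = - (indicator {t<..} s * (V t / V s * poly (laguerre_poly n) (ln (V s / V t))))"
  using V_pos[OF assms] by (simp add: K_def laguerre_fun_def laguerre_eq_poly)

lemma K_at_0: "K n 0 s = 0"
  by (simp add: K_def)

text \<open>Matches the two branches of \<open>laguerre_fun\<close>: the index
  \<open>- int k - 1\<close> carries the Laguerre polynomial with number \<open>k\<close>.\<close>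

lemma int_cases_shift:
  obtains (nonneg) k where "n = int k" | (neg) k where "n = - int k - 1"
proof (cases "n \<ge> 0")
  case True
  then show thesis using nonneg[of "nat n"] by simp
next
  case False
  then show thesis using neg[of "nat (- n - 1)"] by simp
qed

lemma K_0: "0 \<le> t \<Longrightarrow> K 0 t s = indicator {0<..<t} s"
  using K_nonneg[of t 0 s] by (cases "t = 0") (auto simp: K_at_0 laguerre_poly_0)

lemma K_minus_1: "0 \<le> t \<Longrightarrow> K (- 1) t s = - (indicator {t<..} s * (V t / V s))"
  using K_neg[of t 0 s] by (cases "t = 0") (auto simp: K_at_0 laguerre_poly_0)

lemma K_measurable[measurable]: "K n t \<in> borel_measurable \<mu>"
  unfolding K_def[abs_def] laguerre_fun_def laguerre_eq_poly by measurable

text \<open>Within one branch this is Laguerre orthogonality, the moment with \<open>a = 1\<close>;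
  kernels from different branches have disjoint supports \<open>(0, t)\<close> and
  \<open>(t, \<infinity>)\<close>.\<close>

lemma K_orthogonal:
  assumes t: "t > 0"
  shows "has_bochner_integral \<mu> (\<lambda>s. K n t s * K m t s) (if n = m then V t else 0)"
proof -
  have left: "has_bochner_integral \<mu> (\<lambda>s. K (int k) t s * K (int l) t s) (if k = l then V t else 0)" for k l
  proof -
    have "has_bochner_integral \<mu> (\<lambda>s. K (int k) t s * K (int l) t s)
        (V t * exp_moment 1 (laguerre_poly k * laguerre_poly l))"
      by (rule has_bochner_integral_eq_on_space[OF has_bochner_integral_qv_moment_left[OF t, of 1 "laguerre_poly k * laguerre_poly l"]])
         (auto simp: K_nonneg[OF t] indicator_def)
    then show ?thesis by (simp add: exp_moment_laguerre_mult split: if_splits)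
  qed
  have right: "has_bochner_integral \<mu> (\<lambda>s. K (- int k - 1) t s * K (- int l - 1) t s) (if k = l then V t else 0)" for k l
  proof -
    have "has_bochner_integral \<mu> (\<lambda>s. K (- int k - 1) t s * K (- int l - 1) t s)
        (V t * exp_moment 1 (laguerre_poly k * laguerre_poly l))"
    proof (rule has_bochner_integral_eq_on_space[OF has_bochner_integral_qv_moment_right[OF t, of 1 "laguerre_poly k * laguerre_poly l"]])
      fix s assume "s \<in> space \<mu>"
      show "indicator {t<..} s * (poly (laguerre_poly k * laguerre_poly l) (ln (V s / V t)) * exp (- (1 + 1) * ln (V s / V t)))
         = K (- int k - 1) t s * K (- int l - 1) t s"
      proof (cases "t < s")
        case True
        then have "V s > 0" "V t > 0" using t by (auto intro: V_pos)
        then have "exp (- (1 + 1) * ln (V s / V t)) = (V t / V s) * (V t / V s)"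
          by (simp add: exp_diff mult_2[symmetric] ln_div exp_double power2_eq_square)
        then show ?thesis using True by (simp add: K_neg[OF t])
      qed (simp add: K_neg[OF t])
    qed simp
    then show ?thesis by (simp add: exp_moment_laguerre_mult split: if_splits)
  qed
  have mixed: "K (int k) t s * K (- int l - 1) t s = 0" for k l s
    by (auto simp: K_nonneg[OF t] K_neg[OF t] indicator_def)
  show ?thesis
  proof (cases n rule: int_cases_shift; cases m rule: int_cases_shift)
    fix k l assume n: "n = int k" and m: "m = - int l - 1"
    have "n \<noteq> m" using n m by simp
    then show ?thesis unfolding n m mixed by (simp add: has_bochner_integral_zero)
  next
    fix k l assume n: "n = - int k - 1" and m: "m = int l"
    have "n \<noteq> m" using n m by simp
    then show ?thesis unfolding n m mult.commute[of "K (- int k - 1) t _"] mixed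
      by (simp add: has_bochner_integral_zero)
  qed (use left right in auto)
qed

lemma square_integrable_K: "0 \<le> t \<Longrightarrow> square_integrable \<mu> (K n t)"
  using K_orthogonal[of t n n]
  by (cases "t = 0") (auto simp: square_integrable_def has_bochner_integral_iff power2_eq_square K_at_0[abs_def])

lemma integral_K_K: "0 \<le> t \<Longrightarrow> (\<integral>s. K n t s * K m t s \<partial>\<mu>) = (if n = m then V t else 0)"
  using K_orthogonal[of t n m]
  by (cases "t = 0") (auto simp: has_bochner_integral_iff K_at_0)

lemma integral_K_square: "0 \<le> t \<Longrightarrow> (\<integral>s. (K n t s)\<^sup>2 \<partial>\<mu>) = V t"
  using integral_K_K[of t n n] by (simp add: power2_eq_square)

text \<open>Links the open intervals of the kernels with the half-open ones of step
  functions.\<close>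

lemma K_0_eq_indicator_AE:
  assumes "0 \<le> a" "a \<le> b"
  shows "AE s in \<mu>. K 0 b s - K 0 a s = indicator {a<..b} s"
  using AE_qv_neq[of a] AE_qv_neq[of b] AE_space[of \<mu>] AE_qv_neq[of 0]
  by eventually_elim (use assms in \<open>auto simp: K_0 indicator_def\<close>)

lemma K_0_mult_K_0: "0 \<le> t \<Longrightarrow> 0 \<le> r \<Longrightarrow> K 0 t s * K 0 r s = K 0 (min t r) s * K 0 (min t r) s"
  by (auto simp: K_0 indicator_def)

lemma integral_K_0_K_0: "0 \<le> t \<Longrightarrow> 0 \<le> r \<Longrightarrow> (\<integral>s. K 0 t s * K 0 r s \<partial>\<mu>) = V (min t r)"
  by (simp only: K_0_mult_K_0) (simp add: integral_K_K)

text \<open>For \<open>t \<le> r\<close> the product lives on \<open>(r, \<infinity>)\<close>, where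
  \<open>K (-1) t\<close> is \<open>V t / V r\<close> times \<open>K (-1) r\<close>. These are the
  covariances of the inverse transformation.\<close>

lemma integral_K_minus_1:
  assumes "0 \<le> t" "0 \<le> r"
  shows "(\<integral>s. K (-1) t s * K (-1) r s \<partial>\<mu>) = V (min t r)"
proof -
  have *: "(\<integral>s. K (-1) t s * K (-1) r s \<partial>\<mu>) = V t" if "0 \<le> t" "t \<le> r" "r > 0" for t r
  proof -
    have "V r > 0" using that by (simp add: V_pos)
    have "(\<integral>s. K (-1) t s * K (-1) r s \<partial>\<mu>) = (\<integral>s. (V t / V r) * (K (-1) r s * K (-1) r s) \<partial>\<mu>)"
      using that \<open>V r > 0\<close> by (intro Bochner_Integration.integral_cong) (auto simp: K_minus_1 indicator_def)
    also have "\<dots> = V t" using that \<open>V r > 0\<close> by (simp add: integral_K_K)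
    finally show ?thesis .
  qed
  show ?thesis
  proof (cases "t \<le> r")
    case True
    then show ?thesis using *[of t r] assms by (cases "r = 0") (auto simp: K_at_0 min_def)
  next
    case False
    then show ?thesis using *[of r t] assms by (simp add: min_def mult.commute)
  qed
qed

text \<open>The supports meet in \<open>(r, t)\<close>, where in the variable \<open>v = V s\<close>
  the product is the derivative of \<open>V r\<close> times \<open>laguerre_prim n\<close> at
  \<open>ln (V t / v)\<close>; this vanishes at \<open>v = V t\<close>.\<close>

lemma has_bochner_integral_K_minus_1_K:
  assumes "0 < r" "r < t"
  shows "has_bochner_integral \<mu> (\<lambda>s. K (-1) r s * K (int n) t s)
    (- V r * poly (laguerre_prim n) (ln (V t / V r)))"
proof -
  have pos: "V r > 0" "V t > 0" using assms by (auto intro: V_pos)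
  let ?F = "\<lambda>v. V r * poly (laguerre_prim n) (ln (V t / v))"
  let ?f = "\<lambda>v. - (V r / v * poly (laguerre_poly n) (ln (V t / v)))"
  have "has_bochner_integral \<mu> (\<lambda>s. indicator {r<..<t} s * ?f (V s)) (?F (V t) - ?F (V r))"
  proof (rule has_bochner_integral_qv_FTC)
    fix v assume v: "V r \<le> v" "v \<le> V t"
    then have "v > 0" using pos by simp
    then have "((\<lambda>v. ln (V t / v)) has_real_derivative - 1 / v) (at v)"
      using pos by (auto intro!: derivative_eq_intros simp: field_simps)
    from DERIV_laguerre_prim[OF this]
    have "((\<lambda>v. poly (laguerre_prim n) (ln (V t / v))) has_real_derivative
        poly (laguerre_poly n) (ln (V t / v)) * (- 1 / v)) (at v)"
      .
    from DERIV_cmult[OF this, of "V r"] show "DERIV ?F v :> ?f v" by simp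
    show "isCont ?f v" using \<open>v > 0\<close> pos by (auto intro!: continuous_intros)
  qed (use assms in auto)
  moreover have "?F (V t) - ?F (V r) = - V r * poly (laguerre_prim n) (ln (V t / V r))"
    using pos by (simp add: laguerre_prim_0)
  ultimately show ?thesis
    by (simp only:, elim has_bochner_integral_eq_on_space)
       (use assms in \<open>auto simp: K_minus_1 K_nonneg indicator_def\<close>)
qed

text \<open>The transformation maps \<open>K n t\<close> to \<open>K (n + 1) t\<close>; here this is tested against
  \<open>K 0 r = 1_(0,r)\<close>, whose image under the adjoint is \<open>K (-1) r\<close>. In \<open>K_shift_neg\<close> below the inverse
  transformation takes over, with adjoint kernel \<open>K 1 r\<close>.\<close>

lemma K_shift_pos:
  assumes "0 \<le> r" "0 < t"
  shows "(\<integral>s. K (-1) r s * K (int n) t s \<partial>\<mu>) = (\<integral>s. K 0 r s * K (int n + 1) t s \<partial>\<mu>)"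
proof -
  consider "r = 0" | "r \<ge> t" | "0 < r" "r < t" using assms by linarith
  then show ?thesis
  proof cases
    case 1
    then show ?thesis by (simp add: K_at_0)
  next
    case 2
    have "(\<integral>s. K (-1) r s * K (int n) t s \<partial>\<mu>) = (\<integral>s. 0 \<partial>\<mu>)"
      using 2 assms by (intro Bochner_Integration.integral_cong) (auto simp: K_minus_1 K_nonneg indicator_def)
    moreover have "(\<integral>s. K 0 r s * K (int n + 1) t s \<partial>\<mu>) = (\<integral>s. K 0 t s * K (int n + 1) t s \<partial>\<mu>)"
      using 2 assms K_nonneg[of t "Suc n"]
      by (intro Bochner_Integration.integral_cong) (auto simp: K_0 indicator_def add.commute)
    ultimately show ?thesis using assms by (simp add: integral_K_K)
  next
    case 3
    have pos: "V r > 0" "V t > 0" using 3 by (auto intro: V_pos)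
    \<comment> \<open>The derivative of \<open>?F\<close> is
      \<open>laguerre_poly n - laguerre_prim n\<close> at \<open>ln (V t / v)\<close>, which the
      recursion identifies with \<open>?f\<close>.\<close>
    let ?F = "\<lambda>v. - v * poly (laguerre_prim n) (ln (V t / v))"
    let ?f = "\<lambda>v. poly (laguerre_poly (Suc n)) (ln (V t / v))"
    have F: "has_bochner_integral \<mu> (\<lambda>s. indicator {r<..<t} s * ?f (V s)) (?F (V t) - ?F (V r))"
    proof (rule has_bochner_integral_qv_FTC)
      fix v assume v: "V r \<le> v" "v \<le> V t"
      then have "v > 0" using pos by simp
      then have "((\<lambda>v. ln (V t / v)) has_real_derivative - 1 / v) (at v)"
        using pos by (auto intro!: derivative_eq_intros simp: field_simps)
      from DERIV_laguerre_prim[OF this]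
      have "((\<lambda>v. poly (laguerre_prim n) (ln (V t / v))) has_real_derivative
          poly (laguerre_poly n) (ln (V t / v)) * (- 1 / v)) (at v)"
        .
      from DERIV_mult[OF DERIV_minus[OF DERIV_ident] this] show "DERIV ?F v :> ?f v"
        using \<open>v > 0\<close> by (simp add: laguerre_poly_Suc)
      show "isCont ?f v" using \<open>v > 0\<close> pos by (auto intro!: continuous_intros)
    qed (use 3 in auto)
    \<comment> \<open>The antiderivative has a logarithmic singularity at \<open>v = 0\<close>. The
      integral over \<open>(0, r)\<close> is therefore obtained as the one over
      \<open>(0, t)\<close>, which is 0 by orthogonality, minus the one over
      \<open>(r, t)\<close>.\<close>
    have "has_bochner_integral \<mu> (\<lambda>s. K 0 t s * K (int (Suc n)) t s - indicator {r<..<t} s * ?f (V s))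
        ((if 0 = int (Suc n) then V t else 0) - (?F (V t) - ?F (V r)))"
      by (intro has_bochner_integral_diff K_orthogonal F assms)
    then have *: "(\<integral>s. K 0 t s * K (int (Suc n)) t s - indicator {r<..<t} s * ?f (V s) \<partial>\<mu>) =
        - V r * poly (laguerre_prim n) (ln (V t / V r))"
      using pos by (simp add: has_bochner_integral_iff laguerre_prim_0)
    have "(\<integral>s. K 0 r s * K (int (Suc n)) t s \<partial>\<mu>) =
        (\<integral>s. K 0 t s * K (int (Suc n)) t s - indicator {r<..<t} s * ?f (V s) \<partial>\<mu>)"
    proof (rule integral_cong_AE)
      show "AE s in \<mu>. K 0 r s * K (int (Suc n)) t s =
          K 0 t s * K (int (Suc n)) t s - indicator {r<..<t} s * ?f (V s)"
        using AE_qv_neq[of r]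
        by eventually_elim (use 3 in \<open>auto simp: K_0 K_nonneg indicator_def simp del: of_nat_Suc\<close>)
    qed (use assms in measurable)
    then show ?thesis
      using has_bochner_integral_K_minus_1_K[OF 3, of n] *
      by (simp add: has_bochner_integral_iff add.commute)
  qed
qed

lemma K_1: "0 < t \<Longrightarrow> K 1 t s = indicator {0<..<t} s * (1 - ln (V t / V s))"
proof -
  have "poly (laguerre_poly 1) x = 1 - x" for x
    by (simp add: laguerre_eq_poly[symmetric] laguerre_def)
  then show "0 < t \<Longrightarrow> K 1 t s = indicator {0<..<t} s * (1 - ln (V t / V s))"
    using K_nonneg[of t 1 s] by simp
qed

lemma K_shift_neg:
  assumes "0 \<le> r" "0 < t"
  shows "(\<integral>s. K 1 r s * K (- int n) t s \<partial>\<mu>) = (\<integral>s. K 0 r s * K (- int n - 1) t s \<partial>\<mu>)"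
proof (cases n)
  case 0
  \<comment> \<open>For \<open>n = 0\<close> this is \<open>K_shift_pos\<close> with the times
    \<open>r\<close> and \<open>t\<close> exchanged.\<close>
  show ?thesis
    using K_shift_pos[of t r 0] assms 0
    by (cases "r = 0") (simp_all add: K_at_0 mult.commute)
next
  case (Suc k)
  have n: "- int n = - int k - 1" using Suc by simp
  consider "r = 0" | "0 < r" "r \<le> t" | "0 < r" "t < r" using assms by linarith
  then show ?thesis
  proof cases
    case 1
    then show ?thesis by (simp add: K_at_0)
  next
    case 2
    have *: "K 1 r s * K (- int n) t s = 0" "K 0 r s * K (- int n - 1) t s = 0" for s
      using 2 assms K_neg[of t k s] K_neg[of t n s]
      by (auto simp: K_1 K_0 n[symmetric] indicator_def simp del: of_nat_Suc)
    show ?thesis by (simp only: *)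
  next
    case 3
    have pos: "V r > 0" "V t > 0" using 3 assms by (auto intro: V_pos)
    \<comment> \<open>\<open>?F\<close> vanishes at both ends, by \<open>laguerre_prim_0\<close> at
      \<open>V t\<close> and by \<open>ln 1 = 0\<close> at \<open>V r\<close>; its derivative
      \<open>?f\<close> is, up to sign, the difference of the two integrands on
      \<open>(t, r)\<close>.\<close>
    let ?F = "\<lambda>v. - V t * (poly (laguerre_prim k) (ln (v / V t)) * ln (V r / v))"
    let ?f = "\<lambda>v. V t / v * (poly (laguerre_prim k) (ln (v / V t)) - poly (laguerre_poly k) (ln (v / V t)) * ln (V r / v))"
    have F: "has_bochner_integral \<mu> (\<lambda>s. indicator {t<..<r} s * ?f (V s)) (?F (V r) - ?F (V t))"
    proof (rule has_bochner_integral_qv_FTC)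
      fix v assume v: "V t \<le> v" "v \<le> V r"
      then have "v > 0" using pos by simp
      then have "((\<lambda>v. ln (v / V t)) has_real_derivative 1 / v) (at v)"
        using pos by (auto intro!: derivative_eq_intros simp: field_simps)
      from DERIV_laguerre_prim[OF this]
      have 1: "((\<lambda>v. poly (laguerre_prim k) (ln (v / V t))) has_real_derivative
          poly (laguerre_poly k) (ln (v / V t)) * (1 / v)) (at v)"
        .
      have 2: "((\<lambda>v. ln (V r / v)) has_real_derivative - 1 / v) (at v)"
        using pos \<open>v > 0\<close> by (auto intro!: derivative_eq_intros simp: field_simps)
      from DERIV_cmult[OF DERIV_mult[OF 1 2], of "- V t"] show "DERIV ?F v :> ?f v"
        by (rule DERIV_cong) (use \<open>v > 0\<close> in \<open>simp add: field_simps\<close>)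
      show "isCont ?f v" using \<open>v > 0\<close> pos by (auto intro!: continuous_intros)
    qed (use 3 assms in auto)
    have "?F (V r) - ?F (V t) = 0" using pos by (simp add: laguerre_prim_0)
    then have *: "(\<integral>s. indicator {t<..<r} s * ?f (V s) \<partial>\<mu>) = 0"
      using F by (simp add: has_bochner_integral_iff)
    have int: "integrable \<mu> (\<lambda>s. K i r s * K j t s)" for i j
      using assms by (intro square_integrable_integrable_mult square_integrable_K) auto
    have "(\<integral>s. K 1 r s * K (- int n) t s \<partial>\<mu>) - (\<integral>s. K 0 r s * K (- int n - 1) t s \<partial>\<mu>) =
        (\<integral>s. K 1 r s * K (- int n) t s - K 0 r s * K (- int n - 1) t s \<partial>\<mu>)"
      by (simp add: int)
    also have "\<dots> = (\<integral>s. - (indicator {t<..<r} s * ?f (V s)) \<partial>\<mu>)"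
    proof (rule Bochner_Integration.integral_cong[OF refl])
      fix s
      show "K 1 r s * K (- int n) t s - K 0 r s * K (- int n - 1) t s = - (indicator {t<..<r} s * ?f (V s))"
      proof (cases "t < s \<and> s < r")
        case True
        then have eqs: "K 1 r s = 1 - ln (V r / V s)" "K 0 r s = 1"
          "K (- int n) t s = - (V t / V s * poly (laguerre_poly k) (ln (V s / V t)))"
          "K (- int n - 1) t s = - (V t / V s * poly (laguerre_poly (Suc k)) (ln (V s / V t)))"
          using 3 assms K_neg[of t k s] K_neg[of t n s] by (auto simp: K_1 K_0 n[symmetric] Suc[symmetric])
        have "(1 - l) * - (c * p) - 1 * - (c * (p - q)) = - (1 * (c * (q - p * l)))" for l c p q :: real
          by (simp add: algebra_simps)
        moreover have "indicator {t<..<r} s = (1::real)" using True by simp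
        ultimately show ?thesis unfolding eqs laguerre_poly_Suc poly_diff by metis
      next
        case False
        then show ?thesis
          using 3 assms K_neg[of t k s] K_neg[of t n s] by (auto simp: K_1 K_0 n[symmetric] indicator_def)
      qed
    qed
    also have "\<dots> = 0" using * by simp
    finally show ?thesis by simp
  qed
qed

text \<open>For \<open>0 < r < t\<close> this is \<open>has_bochner_integral_K_minus_1_K\<close> at
  \<open>n = 0\<close>, where the primitive is \<open>x\<close> itself. It is the covariance of
  \<open>M_r\<close> with the transformed process at time \<open>t\<close>, to be integrated once
  more in \<open>tau_cov_le\<close>.\<close>

lemma integral_K_minus_1_K_0:
  assumes "0 \<le> r" "r \<le> t"
  shows "(\<integral>s. K (-1) r s * K 0 t s \<partial>\<mu>) = - V r * ln (V t / V r)"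
proof -
  consider "r = 0" | "0 < r" "r = t" | "0 < r" "r < t" using assms by linarith
  then show ?thesis
  proof cases
    case 1
    then show ?thesis by (simp add: K_at_0)
  next
    case 2
    then show ?thesis using integral_K_K[of t "-1" 0] V_pos[of t] by simp
  next
    case 3
    have "poly (laguerre_prim 0) x = x" for x
      by (simp add: laguerre_prim_def laguerre_eq_poly[symmetric] laguerre_def)
    then show ?thesis
      using has_bochner_integral_K_minus_1_K[OF 3, of 0] by (simp add: has_bochner_integral_iff)
  qed
qed

end

section \<open>Closed subspaces and step functions\<close>

text \<open>Pythagoras with arbitrary coefficients \<open>a\<close>: Fourier coefficients turn it
  into the Parseval remainder, and \<open>h = 0\<close> gives the norm of a combination.\<close>

lemma integral_square_orthonormal:
  assumes e: "\<And>n. square_integrable N (e n)"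
    and orth: "\<And>n m. (\<integral>x. e n x * e m x \<partial>N) = (if n = m then 1 else 0)"
    and h: "square_integrable N h" and "finite J"
  shows "(\<integral>x. ((\<Sum>n\<in>J. a n * e n x) - h x)\<^sup>2 \<partial>N) =
    (\<integral>x. (h x)\<^sup>2 \<partial>N) - 2 * (\<Sum>n\<in>J. a n * (\<integral>x. h x * e n x \<partial>N)) + (\<Sum>n\<in>J. (a n)\<^sup>2)"
proof -
  have S: "square_integrable N (\<lambda>x. \<Sum>n\<in>I. a n * e n x)" for I
    by (intro square_integrable_sum square_integrable_cmult e)
  have ip: "(\<integral>x. (\<Sum>n\<in>I. a n * e n x) * g x \<partial>N) = (\<Sum>n\<in>I. a n * (\<integral>x. g x * e n x \<partial>N))"
    if g: "square_integrable N g" for g I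
    using square_integrable_integrable_mult[OF g e]
    by (simp add: sum_distrib_right mult.assoc mult.commute[of "e _ _"])
  have "(\<integral>x. (\<Sum>n\<in>J. a n * e n x) * e m x \<partial>N) = (if m \<in> J then a m else 0)" for m
    using \<open>finite J\<close> by (simp add: ip[OF e] orth sum.delta' mult_delta_right)
  then have "(\<integral>x. (\<Sum>n\<in>J. a n * e n x)\<^sup>2 \<partial>N) = (\<Sum>n\<in>J. (a n)\<^sup>2)"
    by (simp add: power2_eq_square ip[OF S])
  then show ?thesis
    using integral_square_diff[OF S h, of J] by (simp add: ip[OF h])
qed

text \<open>Fourier coefficients minimise the distance to \<open>h\<close>, so one good finite
  combination bounds the Parseval remainder at its index set. The sums of squares grow with the set
  and stay below the squared norm, hence the bound persists for every larger finite set.\<close>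

lemma tendsto_orthonormal_projection:
  assumes e: "\<And>n. square_integrable N (e n)"
    and orth: "\<And>n m. (\<integral>x. e n x * e m x \<partial>N) = (if n = m then 1 else 0)"
    and h: "square_integrable N h"
    and dense: "\<And>\<delta>. \<delta> > 0 \<Longrightarrow> \<exists>J a. finite J \<and> (\<integral>x. ((\<Sum>n\<in>J. a n * e n x) - h x)\<^sup>2 \<partial>N) < \<delta>"
  shows "((\<lambda>J. \<Sum>n\<in>J. (\<integral>x. h x * e n x \<partial>N)\<^sup>2) \<longlongrightarrow> (\<integral>x. (h x)\<^sup>2 \<partial>N)) (finite_subsets_at_top UNIV)"
proof -
  define c where "c n = (\<integral>x. h x * e n x \<partial>N)" for n
  note eq = integral_square_orthonormal[OF e orth h, folded c_def]
  have nonneg: "0 \<le> (\<integral>x. (h x)\<^sup>2 \<partial>N) - (\<Sum>n\<in>J. (c n)\<^sup>2)" if "finite J" for J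
  proof -
    have "0 \<le> (\<integral>x. ((\<Sum>n\<in>J. c n * e n x) - h x)\<^sup>2 \<partial>N)" by simp
    then show ?thesis unfolding eq[OF that] by (simp add: power2_eq_square)
  qed
  have "((\<lambda>J. \<Sum>n\<in>J. (c n)\<^sup>2) \<longlongrightarrow> (\<integral>x. (h x)\<^sup>2 \<partial>N)) (finite_subsets_at_top UNIV)"
  proof (rule tendstoI)
    fix \<delta> :: real assume "\<delta> > 0"
    then obtain J a where J: "finite J" "(\<integral>x. ((\<Sum>n\<in>J. a n * e n x) - h x)\<^sup>2 \<partial>N) < \<delta>"
      using dense by blast
    have "(\<integral>x. (h x)\<^sup>2 \<partial>N) - (\<Sum>n\<in>J. (c n)\<^sup>2) \<le> (\<integral>x. (h x)\<^sup>2 \<partial>N) - (\<Sum>n\<in>J. (c n)\<^sup>2) + (\<Sum>n\<in>J. (a n - c n)\<^sup>2)"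
      by (simp add: sum_nonneg)
    also have "\<dots> = (\<integral>x. ((\<Sum>n\<in>J. a n * e n x) - h x)\<^sup>2 \<partial>N)"
      unfolding eq[OF J(1)]
      by (simp add: power2_diff sum.distrib sum_subtractf sum_distrib_left mult.assoc)
    finally have J': "(\<integral>x. (h x)\<^sup>2 \<partial>N) - (\<Sum>n\<in>J. (c n)\<^sup>2) < \<delta>" using J(2) by simp
    have "dist (\<Sum>n\<in>J'. (c n)\<^sup>2) (\<integral>x. (h x)\<^sup>2 \<partial>N) < \<delta>" if "finite J'" "J \<subseteq> J'" for J'
    proof -
      have "(\<Sum>n\<in>J. (c n)\<^sup>2) \<le> (\<Sum>n\<in>J'. (c n)\<^sup>2)"
        using that by (intro sum_mono2) auto
      then show ?thesis using nonneg[OF that(1)] J' by (simp add: dist_real_def)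
    qed
    then show "\<forall>\<^sub>F J in finite_subsets_at_top UNIV. dist (\<Sum>n\<in>J. (c n)\<^sup>2) (\<integral>x. (h x)\<^sup>2 \<partial>N) < \<delta>"
      unfolding eventually_finite_subsets_at_top using J(1) by blast
  qed
  then show ?thesis by (simp only: c_def)
qed

text \<open>The closure consists of functions, not classes, and \<open>S\<close> may contain
  functions that are not square integrable; hence the explicit condition on the approximant.\<close>

definition L2_closure :: "'a measure \<Rightarrow> ('a \<Rightarrow> real) set \<Rightarrow> ('a \<Rightarrow> real) set" where
  "L2_closure N S = {h. square_integrable N h \<and>
     (\<forall>\<delta>>0. \<exists>g\<in>S. square_integrable N g \<and> (\<integral>x. (g x - h x)\<^sup>2 \<partial>N) < \<delta>)}"

lemma L2_closureD: "h \<in> L2_closure N S \<Longrightarrow> square_integrable N h"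
  by (simp add: L2_closure_def)

lemma L2_closure_superset: "g \<in> S \<Longrightarrow> square_integrable N g \<Longrightarrow> g \<in> L2_closure N S"
  unfolding L2_closure_def by (auto intro!: bexI[of _ g])

lemma L2_closure_closed:
  assumes h: "square_integrable N h"
    and ex: "\<And>\<delta>. \<delta> > 0 \<Longrightarrow> \<exists>g\<in>L2_closure N S. (\<integral>x. (g x - h x)\<^sup>2 \<partial>N) < \<delta>"
  shows "h \<in> L2_closure N S"
  unfolding L2_closure_def
proof (intro CollectI conjI allI impI h)
  fix \<delta> :: real assume \<delta>: "\<delta> > 0"
  \<comment> \<open>A quarter of \<open>\<delta>\<close> for each summand, as
    \<open>integral_square_sum_le\<close> doubles both.\<close>
  then obtain g where g: "g \<in> L2_closure N S" "(\<integral>x. (g x - h x)\<^sup>2 \<partial>N) < \<delta> / 4"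
    using ex[of "\<delta> / 4"] by auto
  obtain k where k: "k \<in> S" "square_integrable N k" "(\<integral>x. (k x - g x)\<^sup>2 \<partial>N) < \<delta> / 4"
    using g(1) \<delta> unfolding L2_closure_def by (auto dest: spec[of _ "\<delta> / 4"])
  have gs: "square_integrable N g" using g(1) by (rule L2_closureD)
  have "(\<integral>x. (k x - h x)\<^sup>2 \<partial>N) < \<delta>"
    using integral_square_sum_le[OF square_integrable_diff[OF k(2) gs] square_integrable_diff[OF gs h]] g(2) k(3)
    by simp
  with k show "\<exists>g\<in>S. square_integrable N g \<and> (\<integral>x. (g x - h x)\<^sup>2 \<partial>N) < \<delta>" by blast
qed

lemma L2_closure_tendsto:
  assumes "L2_tendsto N g h sequentially" "\<And>k. g k \<in> L2_closure N S"
  shows "h \<in> L2_closure N S"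
proof (rule L2_closure_closed)
  fix \<delta> :: real assume "\<delta> > 0"
  then have "\<forall>\<^sub>F k in sequentially. (\<integral>x. (g k x - h x)\<^sup>2 \<partial>N) < \<delta>"
    using L2_tendstoD(3)[OF assms(1)] by (intro order_tendstoD) auto
  then obtain k where "(\<integral>x. (g k x - h x)\<^sup>2 \<partial>N) < \<delta>"
    by (auto simp: eventually_sequentially)
  then show "\<exists>g\<in>L2_closure N S. (\<integral>x. (g x - h x)\<^sup>2 \<partial>N) < \<delta>"
    using assms(2) by blast
qed (rule L2_tendstoD(2)[OF assms(1)])

lemma L2_closure_AE:
  assumes "g \<in> L2_closure N S" "h \<in> borel_measurable N" "AE x in N. g x = h x"
  shows "h \<in> L2_closure N S"
proof (rule L2_closure_closed)
  have g: "square_integrable N g" using assms(1) by (rule L2_closureD)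
  show h: "square_integrable N h" by (rule square_integrable_cong_AE[OF g assms(2,3)])
  have "(\<integral>x. (g x - h x)\<^sup>2 \<partial>N) = (\<integral>x. 0 \<partial>N)"
    using assms(3) square_integrableD(1)[OF g] assms(2)
    by (intro integral_cong_AE) (auto elim!: eventually_mono)
  then show "\<exists>g\<in>L2_closure N S. (\<integral>x. (g x - h x)\<^sup>2 \<partial>N) < \<delta>" if "\<delta> > 0" for \<delta>
    using that assms(1) by (intro bexI[of _ g]) auto
qed

locale L2_subspace =
  fixes N :: "'a measure" and S :: "('a \<Rightarrow> real) set"
  assumes zero: "(\<lambda>x. 0) \<in> S"
    and add: "\<And>g g'. g \<in> S \<Longrightarrow> g' \<in> S \<Longrightarrow> (\<lambda>x. g x + g' x) \<in> S"
    and cmult: "\<And>g c. g \<in> S \<Longrightarrow> (\<lambda>x. c * g x) \<in> S"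
begin

lemma closure_obtain:
  assumes "h \<in> L2_closure N S"
  obtains g where "\<And>k. g k \<in> S" "L2_tendsto N g h sequentially"
proof -
  have "\<exists>g. (\<forall>k::nat. g k \<in> S) \<and> L2_tendsto N (\<lambda>k. g k) h sequentially"
    using assms by (intro L2_tendsto_sequentiallyI[where F = "\<lambda>g. g" and Q = "\<lambda>g. g \<in> S"]) (auto simp: L2_closure_def)
  then show thesis using that by blast
qed

lemma closure_add:
  assumes "h \<in> L2_closure N S" "h' \<in> L2_closure N S"
  shows "(\<lambda>x. h x + h' x) \<in> L2_closure N S"
proof -
  obtain g where g: "\<And>k. g k \<in> S" "L2_tendsto N g h sequentially" using closure_obtain[OF assms(1)] by blast
  obtain g' where g': "\<And>k. g' k \<in> S" "L2_tendsto N g' h' sequentially" using closure_obtain[OF assms(2)] by blast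
  show ?thesis
  proof (rule L2_closure_tendsto[OF L2_tendsto_add[OF g(2) g'(2)]])
    show "(\<lambda>x. g k x + g' k x) \<in> L2_closure N S" for k
      using L2_tendstoD(1)[OF g(2)] L2_tendstoD(1)[OF g'(2)]
      by (intro L2_closure_superset add g(1) g'(1) square_integrable_add)
  qed
qed

lemma closure_cmult:
  assumes "h \<in> L2_closure N S"
  shows "(\<lambda>x. c * h x) \<in> L2_closure N S"
proof -
  obtain g where g: "\<And>k. g k \<in> S" "L2_tendsto N g h sequentially" using closure_obtain[OF assms(1)] by blast
  show ?thesis
  proof (rule L2_closure_tendsto[OF L2_tendsto_cmult[OF g(2)]])
    show "(\<lambda>x. c * g k x) \<in> L2_closure N S" for k
      using L2_tendstoD(1)[OF g(2)]
      by (intro L2_closure_superset cmult g(1) square_integrable_cmult)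
  qed
qed

lemma closure_zero: "(\<lambda>x. 0) \<in> L2_closure N S"
  by (intro L2_closure_superset zero square_integrable_zero)

lemma closure_diff:
  assumes "h \<in> L2_closure N S" "h' \<in> L2_closure N S"
  shows "(\<lambda>x. h x - h' x) \<in> L2_closure N S"
  using closure_add[OF assms(1) closure_cmult[OF assms(2), of "-1"]] by simp

lemma closure_sum:
  assumes "\<And>i. i \<in> I \<Longrightarrow> h i \<in> L2_closure N S"
  shows "(\<lambda>x. \<Sum>i\<in>I. h i x) \<in> L2_closure N S"
  using assms
proof (induction I rule: infinite_finite_induct)
  case (insert i I)
  then show ?case by (simp add: closure_add)
qed (simp_all add: closure_zero)

end

section \<open>Step functions and their density in L2(dV)\<close>

definition step_list :: "(real \<times> real \<times> real) list \<Rightarrow> bool" where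
  "step_list xs \<longleftrightarrow> (\<forall>(c, a, b)\<in>set xs. 0 \<le> a \<and> a \<le> b)"

lemma step_list_simps[simp]:
  "step_list []" "step_list ((c, a, b) # xs) \<longleftrightarrow> 0 \<le> a \<and> a \<le> b \<and> step_list xs"
  "step_list (xs @ ys) \<longleftrightarrow> step_list xs \<and> step_list ys"
  by (simp_all add: step_list_def ball_Un conj_assoc)

lemma step_fun_simps[simp]:
  "step_fun [] s = 0" "step_fun ((c, a, b) # xs) s = c * indicator {a<..b} s + step_fun xs s"
  "step_fun (xs @ ys) s = step_fun xs s + step_fun ys s"
  by (auto simp: step_fun_def)

lemma step_integral_simps[simp]:
  "step_integral X [] \<omega> = 0" "step_integral X ((c, a, b) # xs) \<omega> = c * (X b \<omega> - X a \<omega>) + step_integral X xs \<omega>"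
  "step_integral X (xs @ ys) \<omega> = step_integral X xs \<omega> + step_integral X ys \<omega>"
  by (auto simp: step_integral_def)

definition step_scale :: "real \<Rightarrow> (real \<times> real \<times> real) list \<Rightarrow> (real \<times> real \<times> real) list" where
  "step_scale k xs = map (\<lambda>(c, a, b). (k * c, a, b)) xs"

lemma step_scale_simps[simp]:
  "step_list (step_scale k xs) \<longleftrightarrow> step_list xs"
  "step_fun (step_scale k xs) s = k * step_fun xs s"
  "step_integral X (step_scale k xs) \<omega> = k * step_integral X xs \<omega>"
  by (induction xs) (auto simp: step_scale_def algebra_simps)

context clock
begin

lemma step_fun_measurable[measurable]: "step_fun xs \<in> borel_measurable \<mu>"
  by (induction xs) (auto simp: step_fun_simps(1,2)[abs_def])

lemma square_integrable_indicator_Ioc: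
  assumes "0 \<le> a" "a \<le> b"
  shows "square_integrable \<mu> (indicator {a<..b})"
  using assms
  by (intro square_integrable_cong_AE[OF _ _ K_0_eq_indicator_AE] square_integrable_diff square_integrable_K) auto

lemma square_integrable_step_fun: "step_list xs \<Longrightarrow> square_integrable \<mu> (step_fun xs)"
  by (induction xs)
     (auto simp: step_fun_simps(1,2)[abs_def] square_integrable_zero
        intro!: square_integrable_add square_integrable_cmult square_integrable_indicator_Ioc)

definition steps :: "(real \<Rightarrow> real) set" where
  "steps = {step_fun xs | xs. step_list xs}"

sublocale steps: L2_subspace \<mu> steps
proof
  show "(\<lambda>x. 0) \<in> steps" unfolding steps_def by (auto intro!: exI[of _ "[]"])
  show "(\<lambda>x. g x + g' x) \<in> steps" if gg: "g \<in> steps" "g' \<in> steps" for g g'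
  proof -
    obtain xs ys where "g = step_fun xs" "step_list xs" "g' = step_fun ys" "step_list ys"
      using gg unfolding steps_def by blast
    then show ?thesis unfolding steps_def by (auto intro!: exI[of _ "xs @ ys"])
  qed
  show "(\<lambda>x. c * g x) \<in> steps" if gg: "g \<in> steps" for g c
  proof -
    obtain xs where "g = step_fun xs" "step_list xs" using gg unfolding steps_def by blast
    then show ?thesis unfolding steps_def by (auto intro!: exI[of _ "step_scale c xs"])
  qed
qed

lemma indicator_Ioc_in_steps_closure:
  assumes "0 \<le> a" "a \<le> b"
  shows "indicator {a<..b} \<in> L2_closure \<mu> steps"
  using assms
  by (intro L2_closure_superset square_integrable_indicator_Ioc) (auto simp: steps_def intro!: exI[of _ "[(1, a, b)]"])

text \<open>A Dynkin argument over the half-open intervals. Cutting down to \<open>(0, n]\<close>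
  keeps everything in L2: complements become differences from \<open>(0, n]\<close>, and disjoint
  unions are dominated limits of their partial sums.\<close>

lemma indicator_in_steps_closure:
  assumes "A \<in> sets borel" "n \<ge> 0"
  shows "indicator (A \<inter> {0<..n}) \<in> L2_closure \<mu> steps"
proof -
  let ?G = "range (\<lambda>(a, b). {a<..b::real})"
  have "A \<in> sigma_sets UNIV ?G" using assms(1) by (subst (asm) borel_sigma_sets_Ioc) simp
  have "Int_stable ?G"
  proof (rule Int_stableI)
    fix B C assume "B \<in> ?G" "C \<in> ?G"
    then obtain a b c d where "B = {a<..b}" "C = {c<..d}" by auto
    then have "B \<inter> C = {max a c<..min b d}" by auto
    then show "B \<inter> C \<in> ?G" by auto
  qed
  moreover have "?G \<subseteq> Pow UNIV" by auto
  ultimately show ?thesis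
    using \<open>A \<in> sigma_sets UNIV ?G\<close>
  proof (induction rule: sigma_sets_induct_disjoint)
    case (basic A)
    then obtain a b where A: "A = {a<..b}" by auto
    show ?case
    proof (cases "max a 0 \<le> min b n")
      case True
      have "A \<inter> {0<..n} = {max a 0<..min b n}" using A by auto
      then show ?thesis using True by (simp add: indicator_Ioc_in_steps_closure)
    next
      case False
      then have "A \<inter> {0<..n} = {}" using A assms(2) by auto
      then show ?thesis using steps.closure_zero by (simp add: indicator_def[abs_def])
    qed
  next
    case empty
    then show ?case using steps.closure_zero by (simp add: indicator_def[abs_def])
  next
    case (compl A)
    have "indicator ((UNIV - A) \<inter> {0<..n}) = (\<lambda>x. indicator {0<..n} x - indicator (A \<inter> {0<..n}) x :: real)"
      by (auto simp: indicator_def fun_eq_iff)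
    then show ?case
      using steps.closure_diff[OF indicator_Ioc_in_steps_closure[of 0 n] compl.IH] assms(2) by simp
  next
    case (union A)
    have [measurable]: "A i \<in> sets borel" for i
      using union(2) by (subst borel_sigma_sets_Ioc) auto
    show ?case
    proof (rule L2_closure_tendsto)
      show "(\<lambda>x. \<Sum>i<k. indicator (A i \<inter> {0<..n}) x :: real) \<in> L2_closure \<mu> steps" for k
        by (intro steps.closure_sum union.IH)
      have part: "(\<Sum>i<k. indicator (A i \<inter> {0<..n}) x :: real) = indicator ((\<Union>i<k. A i) \<inter> {0<..n}) x" for k x
      proof -
        have "indicator (\<Union>i<k. A i \<inter> {0<..n}) x = (\<Sum>i<k. indicator (A i \<inter> {0<..n}) x :: real)"
          using union(1) by (intro indicator_UN_disjoint) (auto simp: disjoint_family_on_def)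
        then show ?thesis by simp
      qed
      show "L2_tendsto \<mu> (\<lambda>k x. \<Sum>i<k. indicator (A i \<inter> {0<..n}) x :: real) (indicator (\<Union> (range A) \<inter> {0<..n})) sequentially"
        unfolding part
      proof (rule L2_tendsto_dominated)
        show "square_integrable \<mu> (indicator {0<..n})"
          using assms(2) by (intro square_integrable_indicator_Ioc) auto
        show "AE x in \<mu>. (\<lambda>k. indicator ((\<Union>i<k. A i) \<inter> {0<..n}) x) \<longlonglongrightarrow> (indicator (\<Union> (range A) \<inter> {0<..n}) x :: real)"
        proof (rule AE_I2)
          fix x
          show "(\<lambda>k. indicator ((\<Union>i<k. A i) \<inter> {0<..n}) x) \<longlonglongrightarrow> (indicator (\<Union> (range A) \<inter> {0<..n}) x :: real)"
          proof (cases "x \<in> \<Union> (range A) \<inter> {0<..n}")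
            case True
            then obtain i where "x \<in> A i" by auto
            then have "\<forall>\<^sub>F k in sequentially. indicator ((\<Union>i<k. A i) \<inter> {0<..n}) x = (indicator (\<Union> (range A) \<inter> {0<..n}) x :: real)"
              using True by (intro eventually_sequentiallyI[of "Suc i"]) (auto simp: indicator_def)
            then show ?thesis by (rule tendsto_eventually)
          qed (auto simp: indicator_def)
        qed
      qed (auto simp: indicator_def)
    qed
  qed
qed

text \<open>Simple functions approximating \<open>h\<close>, cut off to \<open>(0, i]\<close>, are
  finite combinations of the indicators in \<open>indicator_in_steps_closure\<close>. Dominated
  convergence applies with \<open>2 * \<bar>h x\<bar>\<close>, the factor 2 coming from the bound
  that accompanies the approximating sequence.\<close>

lemma steps_dense:
  assumes h: "square_integrable \<mu> h"
  shows "h \<in> L2_closure \<mu> steps"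
proof -
  note [measurable] = square_integrableD(1)[OF h]
  from borel_measurable_implies_sequence_metric[OF square_integrableD(1)[OF h], of 0]
  obtain F where F0: "\<forall>i. simple_function \<mu> (F i)" "\<forall>x\<in>space \<mu>. (\<lambda>i. F i x) \<longlonglongrightarrow> h x"
      "\<forall>i. \<forall>x\<in>space \<mu>. dist (F i x) 0 \<le> 2 * dist (h x) 0"
    by blast
  have F: "simple_function \<mu> (F i)" "x \<in> space \<mu> \<Longrightarrow> (\<lambda>i. F i x) \<longlonglongrightarrow> h x"
      "x \<in> space \<mu> \<Longrightarrow> dist (F i x) 0 \<le> 2 * dist (h x) 0" for i x
    using F0 by blast+
  note [measurable] = borel_measurable_simple_function[OF F(1)]
  let ?G = "\<lambda>i x. F i x * indicator {0<..real i} x"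
  have A: "?G i \<in> L2_closure \<mu> steps" for i
  proof -
    let ?A = "\<lambda>y. F i -` {y} \<inter> space \<mu>"
    have "?A y \<in> sets \<mu>" for y by measurable
    then have A: "?A y \<in> sets borel" for y
      unfolding sets_qv by (simp add: sets_restrict_space_iff)
    have 1: "(\<lambda>x. \<Sum>y\<in>F i ` space \<mu>. y * indicator (?A y \<inter> {0<..real i}) x) \<in> L2_closure \<mu> steps"
      by (intro steps.closure_sum steps.closure_cmult indicator_in_steps_closure A) simp
    have *: "(\<Sum>y\<in>F i ` space \<mu>. y * indicator (?A y \<inter> {0<..real i}) x) = ?G i x" if x: "x \<in> space \<mu>" for x
    proof -
      have "(\<Sum>y\<in>F i ` space \<mu>. y * indicator (?A y \<inter> {0<..real i}) x) =
          (\<Sum>y\<in>F i ` space \<mu>. if y = F i x then ?G i x else 0)"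
        using x by (intro sum.cong) (auto simp: indicator_def)
      then show ?thesis using x simple_functionD(1)[OF F(1), of i] by simp
    qed
    show ?thesis
    proof (rule L2_closure_AE[OF 1 _ AE_I2[OF *]])
      show "?G i \<in> borel_measurable \<mu>" by measurable
    qed
  qed
  have B: "L2_tendsto \<mu> ?G h sequentially"
  proof (rule L2_tendsto_dominated)
    show "square_integrable \<mu> (\<lambda>x. 2 * \<bar>h x\<bar>)"
      using h by (intro square_integrable_cmult) (simp add: square_integrable_def)
    show "AE x in \<mu>. \<bar>?G k x\<bar> \<le> 2 * \<bar>h x\<bar>" for k
      using F(3)[of _ k] by (intro AE_I2) (auto simp: indicator_def)
    show "AE x in \<mu>. (\<lambda>k. ?G k x) \<longlonglongrightarrow> h x"
      \<comment> \<open>The point 0 lies in no \<open>(0, k]\<close>, but it is null.\<close>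
      using AE_qv_neq[of 0] AE_space[of \<mu>]
    proof eventually_elim
      case (elim x)
      obtain N where N: "x \<le> real N" using real_arch_simple by blast
      have "\<forall>\<^sub>F k in sequentially. F k x = ?G k x"
        using elim N by (intro eventually_sequentiallyI[of N]) (auto simp: indicator_def)
      then show ?case using F(2)[OF elim(2)] by (rule Lim_transform_eventually[rotated])
    qed
  qed measurable
  show ?thesis by (rule L2_closure_tendsto[OF B A])
qed

end

section \<open>Completeness of the Laguerre functions\<close>

text \<open>Parseval along an injective selection \<open>\<phi>\<close> of indices is enough, so the
  nonnegative and the negative indices can be used separately.\<close>

lemma approx_by_orthonormal:
  assumes e: "\<And>n. square_integrable N (e n)"
    and orth: "\<And>n m. (\<integral>x. e n x * e m x \<partial>N) = (if n = m then 1 else 0)"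
    and h: "square_integrable N h"
    and inj: "inj (\<phi> :: nat \<Rightarrow> 'i)"
    and parseval: "(\<lambda>k. (\<integral>x. h x * e (\<phi> k) x \<partial>N)\<^sup>2) sums (\<integral>x. (h x)\<^sup>2 \<partial>N)"
    and "\<delta> > 0"
  shows "\<exists>J a. finite J \<and> (\<integral>x. ((\<Sum>n\<in>J. a n * e n x) - h x)\<^sup>2 \<partial>N) < \<delta>"
proof -
  define c where "c n = (\<integral>x. h x * e n x \<partial>N)" for n
  have "(\<lambda>M. \<Sum>k<M. (c (\<phi> k))\<^sup>2) \<longlonglongrightarrow> (\<integral>x. (h x)\<^sup>2 \<partial>N)"
    using parseval by (simp add: sums_def c_def)
  then have "\<forall>\<^sub>F M in sequentially. (\<integral>x. (h x)\<^sup>2 \<partial>N) - \<delta> < (\<Sum>k<M. (c (\<phi> k))\<^sup>2)"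
    using \<open>\<delta> > 0\<close> by (intro order_tendstoD) auto
  then obtain M where M: "(\<integral>x. (h x)\<^sup>2 \<partial>N) - \<delta> < (\<Sum>k<M. (c (\<phi> k))\<^sup>2)"
    by (auto simp: eventually_sequentially)
  have "(\<Sum>k<M. (c (\<phi> k))\<^sup>2) = (\<Sum>n\<in>\<phi> ` {..<M}. (c n)\<^sup>2)"
    using inj by (subst sum.reindex) (auto intro: inj_on_subset)
  then have "(\<integral>x. ((\<Sum>n\<in>\<phi> ` {..<M}. c n * e n x) - h x)\<^sup>2 \<partial>N) < \<delta>"
    using M by (subst integral_square_orthonormal[OF e orth h])
      (auto simp: c_def[symmetric] power2_eq_square)
  then show ?thesis by (intro exI[of _ "\<phi> ` {..<M}"] exI[of _ c]) auto
qed

context clock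
begin

abbreviation "ell \<equiv> laguerre_fun V"

lemma ell_eq_K: "0 < T \<Longrightarrow> ell T n s = K n T s / sqrt (V T)"
  using V_pos[of T] by (simp add: K_def)

lemma square_integrable_ell:
  assumes "0 < T"
  shows "square_integrable \<mu> (ell T n)"
proof -
  have "ell T n = (\<lambda>s. 1 / sqrt (V T) * K n T s)" using assms by (simp add: ell_eq_K fun_eq_iff)
  then show ?thesis using assms by (simp only: square_integrable_cmult square_integrable_K less_imp_le)
qed

lemma ell_orthonormal: "0 < T \<Longrightarrow> (\<integral>s. ell T n s * ell T m s \<partial>\<mu>) = (if n = m then 1 else 0)"
  using integral_K_K[of T n m] V_pos[of T] by (simp add: ell_eq_K)

definition ell_span :: "real \<Rightarrow> (real \<Rightarrow> real) set" where
  "ell_span T = {\<lambda>s. \<Sum>n\<in>J. a n * ell T n s | J a. finite J}"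

lemma L2_subspace_ell_span: "L2_subspace (ell_span T)"
proof
  show "(\<lambda>x. 0) \<in> ell_span T"
    unfolding ell_span_def by (intro CollectI exI[of _ "{}"]) auto
  show "(\<lambda>x. g x + g' x) \<in> ell_span T" if gg: "g \<in> ell_span T" "g' \<in> ell_span T" for g g'
  proof -
    obtain J a where g: "finite J" "g = (\<lambda>s. \<Sum>n\<in>J. a n * ell T n s)"
      using gg(1) unfolding ell_span_def by blast
    obtain J' a' where g': "finite J'" "g' = (\<lambda>s. \<Sum>n\<in>J'. a' n * ell T n s)"
      using gg(2) unfolding ell_span_def by blast
    let ?b = "\<lambda>n. (if n \<in> J then a n else 0) + (if n \<in> J' then a' n else 0)"
    have "g s + g' s = (\<Sum>n\<in>J \<union> J'. ?b n * ell T n s)" for s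
    proof -
      have "g s = (\<Sum>n\<in>J \<union> J'. (if n \<in> J then a n else 0) * ell T n s)"
        unfolding g(2) using g(1) g'(1) by (intro sum.mono_neutral_cong_left) auto
      moreover have "g' s = (\<Sum>n\<in>J \<union> J'. (if n \<in> J' then a' n else 0) * ell T n s)"
        unfolding g'(2) using g(1) g'(1) by (intro sum.mono_neutral_cong_left) auto
      ultimately show ?thesis by (simp only: distrib_right sum.distrib)
    qed
    then show ?thesis unfolding ell_span_def using g(1) g'(1)
      by (intro CollectI exI[of _ "J \<union> J'"] exI[of _ ?b] conjI) auto
  qed
  show "(\<lambda>x. c * g x) \<in> ell_span T" if gg: "g \<in> ell_span T" for g c
  proof -
    obtain J a where g: "finite J" "g = (\<lambda>s. \<Sum>n\<in>J. a n * ell T n s)"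
      using gg unfolding ell_span_def by blast
    show ?thesis unfolding ell_span_def using g
      by (intro CollectI exI[of _ J] exI[of _ "\<lambda>n. c * a n"] conjI) (auto simp: sum_distrib_left mult.assoc)
  qed
qed

abbreviation "ell_closure T \<equiv> L2_closure \<mu> (ell_span T)"

lemma in_ell_closureI:
  assumes "T > 0" and h: "square_integrable \<mu> h" and inj: "inj (\<phi> :: nat \<Rightarrow> int)"
    and "(\<lambda>k. (\<integral>x. h x * ell T (\<phi> k) x \<partial>\<mu>)\<^sup>2) sums (\<integral>x. (h x)\<^sup>2 \<partial>\<mu>)"
  shows "h \<in> ell_closure T"
  unfolding L2_closure_def
proof (intro CollectI conjI allI impI h)
  fix \<delta> :: real assume "\<delta> > 0"
  then obtain J a where J: "finite J" "(\<integral>x. ((\<Sum>n\<in>J. a n * ell T n x) - h x)\<^sup>2 \<partial>\<mu>) < \<delta>"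
    using approx_by_orthonormal[OF square_integrable_ell[OF assms(1)] ell_orthonormal[OF assms(1)] h inj assms(4)]
    by blast
  then show "\<exists>g\<in>ell_span T. square_integrable \<mu> g \<and> (\<integral>x. (g x - h x)\<^sup>2 \<partial>\<mu>) < \<delta>"
    using assms(1)
    by (intro bexI[of _ "\<lambda>x. \<Sum>n\<in>J. a n * ell T n x"])
       (auto simp: ell_span_def intro!: square_integrable_sum square_integrable_cmult square_integrable_ell)
qed

text \<open>The squared norm of \<open>u^m\<close> in \<open>L\<^sup>2(0,1)\<close> as the sum of its squared Laguerre coefficients.\<close>

lemma sums_laguerre_coefficients:
  "(\<lambda>k. (sqrt v * ((1 - 1 / real (Suc m)) ^ k / real (Suc m)))\<^sup>2) sums (v / real (2 * m + 1))" if "v \<ge> 0"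
proof -
  let ?q = "(1 - 1 / real (Suc m))\<^sup>2"
  have "\<bar>1 - 1 / real (Suc m)\<bar> < 1" by (simp add: abs_if field_simps)
  then have "norm ?q < 1" by (simp only: real_norm_def abs_power2 abs_square_less_1)
  from sums_mult[OF geometric_sums[OF this], of "v / (real (Suc m))\<^sup>2"]
  have "(\<lambda>k. v / (real (Suc m))\<^sup>2 * ?q ^ k) sums (v / (real (Suc m))\<^sup>2 * (1 / (1 - ?q)))" .
  moreover have "v / (real (Suc m))\<^sup>2 * ?q ^ k = (sqrt v * ((1 - 1 / real (Suc m)) ^ k / real (Suc m)))\<^sup>2" for k
    using that by (simp add: power_mult_distrib power_divide power_mult[symmetric] mult.commute)
  moreover have "(real (Suc m))\<^sup>2 * (1 - ?q) = real (2 * m + 1)"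
  proof -
    have "(real (Suc m))\<^sup>2 * (1 - ?q) = (real (Suc m))\<^sup>2 - (real (Suc m) * (1 - 1 / real (Suc m)))\<^sup>2"
      by (simp only: right_diff_distrib[of "(real (Suc m))\<^sup>2"] power_mult_distrib[of "real (Suc m)"] mult_1_right)
    also have "real (Suc m) * (1 - 1 / real (Suc m)) = real m"
      by (simp add: right_diff_distrib)
    finally show ?thesis by (simp add: power2_eq_square algebra_simps)
  qed
  ultimately show ?thesis by (simp only: times_divide_times_eq mult_1_right)
qed

lemma exp_ln_power:
  assumes "x > (0::real)"
  shows "exp (- real m * ln (1 / x)) = x ^ m"
  using assms by (simp add: ln_div exp_of_nat_mult[symmetric] powr_def[symmetric] powr_realpow exp_of_nat_mult)

text \<open>With \<open>x = ln (V T / V s)\<close> the function is \<open>exp (- m x)\<close> on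
  \<open>(0, T)\<close>. Up to factors from \<open>V T\<close>, its coefficients are the Laplace
  transforms of \<open>L_k\<close> at \<open>m + 1\<close>, and its squared norm is a moment at
  \<open>2 * m + 1\<close>. The indices \<open>k \<ge> 0\<close> exhaust the norm.\<close>

lemma power_left_in_closure:
  assumes T: "T > 0"
  shows "(\<lambda>s. K 0 T s * (V s / V T) ^ m) \<in> ell_closure T"
proof -
  have VT: "V T > 0" using T by (rule V_pos)
  let ?h = "\<lambda>s. K 0 T s * (V s / V T) ^ m"
  have pw: "(V s / V T) ^ j = exp (- real j * ln (V T / V s))" if "0 < s" for s j
    using exp_ln_power[of "V s / V T" j] V_pos[OF that] VT by simp
  have [measurable]: "?h \<in> borel_measurable \<mu>" by measurable
  have sq: "has_bochner_integral \<mu> (\<lambda>s. (?h s)\<^sup>2) (V T / real (2 * m + 1))"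
  proof -
    have "has_bochner_integral \<mu> (\<lambda>s. (?h s)\<^sup>2) (V T * exp_moment (real (2 * m + 1)) 1)"
    proof (rule has_bochner_integral_eq_on_space[OF has_bochner_integral_qv_moment_left[OF T]])
      fix s
      show "indicator {0<..<T} s * (poly 1 (ln (V T / V s)) * exp ((1 - real (2 * m + 1)) * ln (V T / V s))) = (?h s)\<^sup>2"
        using T pw[of s "2 * m"] by (auto simp: K_0 indicator_def power_mult[symmetric] mult.commute[of m])
    qed simp
    then show ?thesis by (simp add: exp_moment_def)
  qed
  have coef: "(\<integral>s. ?h s * ell T (int k) s \<partial>\<mu>) = sqrt (V T) * ((1 - 1 / real (Suc m)) ^ k / real (Suc m))" for k
  proof -
    have "has_bochner_integral \<mu> (\<lambda>s. ?h s * K (int k) T s) (V T * exp_moment (real (Suc m)) (laguerre_poly k))"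
    proof (rule has_bochner_integral_eq_on_space[OF has_bochner_integral_qv_moment_left[OF T]])
      fix s
      show "indicator {0<..<T} s * (poly (laguerre_poly k) (ln (V T / V s)) * exp ((1 - real (Suc m)) * ln (V T / V s)))
          = ?h s * K (int k) T s"
        using T pw[of s m] by (auto simp: K_0 K_nonneg indicator_def)
    qed simp
    then have "(\<integral>s. ?h s * K (int k) T s \<partial>\<mu>) = V T * ((1 - 1 / real (Suc m)) ^ k / real (Suc m))"
      by (simp add: has_bochner_integral_iff exp_moment_laguerre_general)
    moreover have "V T * x / sqrt (V T) = sqrt (V T) * x" for x
      using real_div_sqrt[of "V T"] VT by (metis less_imp_le times_divide_eq_left)
    moreover have "(\<integral>s. ?h s * ell T (int k) s \<partial>\<mu>) = (\<integral>s. ?h s * K (int k) T s \<partial>\<mu>) / sqrt (V T)"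
      using T by (simp add: ell_eq_K)
    ultimately show ?thesis by (simp only:)
  qed
  show ?thesis
  proof (rule in_ell_closureI[OF T _ inj_of_nat])
    show "square_integrable \<mu> ?h" using sq by (simp add: square_integrable_def has_bochner_integral_iff)
    show "(\<lambda>k. (\<integral>x. ?h x * ell T (int k) x \<partial>\<mu>)\<^sup>2) sums (\<integral>x. (?h x)\<^sup>2 \<partial>\<mu>)"
      unfolding coef using sums_laguerre_coefficients[of "V T" m] VT sq by (simp add: has_bochner_integral_iff)
  qed
qed

text \<open>The weight \<open>K (-1) T\<close> contributes one factor \<open>V T / V s\<close> up to
  sign, so the squared norm involves the power \<open>2 * m + 2\<close> and the coefficients the
  power \<open>m + 2\<close>. This is the exponent \<open>1 + a\<close> for the same values
  \<open>a = 2 * m + 1\<close> and \<open>a = m + 1\<close> as below \<open>T\<close>.\<close>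

lemma power_right_in_closure:
  assumes T: "T > 0"
  shows "(\<lambda>s. K (-1) T s * (V T / V s) ^ m) \<in> ell_closure T"
proof -
  have VT: "V T > 0" using T by (rule V_pos)
  let ?h = "\<lambda>s. K (-1) T s * (V T / V s) ^ m"
  have pw: "(V T / V s) ^ j = exp (- real j * ln (V s / V T))" if "T < s" for s j
    using exp_ln_power[of "V T / V s" j] V_pos[of s] that T VT by simp
  have [measurable]: "?h \<in> borel_measurable \<mu>" by measurable
  have sq: "has_bochner_integral \<mu> (\<lambda>s. (?h s)\<^sup>2) (V T / real (2 * m + 1))"
  proof -
    have "has_bochner_integral \<mu> (\<lambda>s. (?h s)\<^sup>2) (V T * exp_moment (real (2 * m + 1)) 1)"
    proof (rule has_bochner_integral_eq_on_space[OF has_bochner_integral_qv_moment_right[OF T]])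
      fix s
      show "indicator {T<..} s * (poly 1 (ln (V s / V T)) * exp (- (1 + real (2 * m + 1)) * ln (V s / V T))) = (?h s)\<^sup>2"
      proof (cases "T < s")
        case True
        have "exp (- (1 + real (2 * m + 1)) * ln (V s / V T)) = (V T / V s) ^ (2 * m + 2)"
          using pw[OF True, of "2 * m + 2"] by (simp add: algebra_simps)
        also have "\<dots> = (V T / V s * (V T / V s) ^ m)\<^sup>2"
          by (simp only: power_Suc[symmetric] power_mult[symmetric]) (simp add: mult.commute)
        finally show ?thesis using True T by (simp add: K_minus_1)
      qed (use T in \<open>simp add: K_minus_1\<close>)
    qed simp
    then show ?thesis by (simp add: exp_moment_def)
  qed
  have coef: "(\<integral>s. ?h s * ell T (- int k - 1) s \<partial>\<mu>) = sqrt (V T) * ((1 - 1 / real (Suc m)) ^ k / real (Suc m))" for k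
  proof -
    have "has_bochner_integral \<mu> (\<lambda>s. ?h s * K (- int k - 1) T s) (V T * exp_moment (real (Suc m)) (laguerre_poly k))"
    proof (rule has_bochner_integral_eq_on_space[OF has_bochner_integral_qv_moment_right[OF T]])
      fix s
      show "indicator {T<..} s * (poly (laguerre_poly k) (ln (V s / V T)) * exp (- (1 + real (Suc m)) * ln (V s / V T)))
          = ?h s * K (- int k - 1) T s"
      proof (cases "T < s")
        case True
        have "exp (- (1 + real (Suc m)) * ln (V s / V T)) = (V T / V s) ^ (m + 2)"
          using pw[OF True, of "m + 2"] by (simp add: algebra_simps)
        then show ?thesis using True T by (simp add: K_minus_1 K_neg power_add power2_eq_square)
      qed (use T in \<open>simp add: K_minus_1\<close>)
    qed simp
    then have "(\<integral>s. ?h s * K (- int k - 1) T s \<partial>\<mu>) = V T * ((1 - 1 / real (Suc m)) ^ k / real (Suc m))"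
      by (simp add: has_bochner_integral_iff exp_moment_laguerre_general)
    moreover have "V T * x / sqrt (V T) = sqrt (V T) * x" for x
      using real_div_sqrt[of "V T"] VT by (metis less_imp_le times_divide_eq_left)
    moreover have "(\<integral>s. ?h s * ell T (- int k - 1) s \<partial>\<mu>) = (\<integral>s. ?h s * K (- int k - 1) T s \<partial>\<mu>) / sqrt (V T)"
      using T by (simp add: ell_eq_K)
    ultimately show ?thesis by (simp only:)
  qed
  show ?thesis
  proof (rule in_ell_closureI[OF T])
    show "inj (\<lambda>k. - int k - 1)" by (auto simp: inj_def)
    show "square_integrable \<mu> ?h" using sq by (simp add: square_integrable_def has_bochner_integral_iff)
    show "(\<lambda>k. (\<integral>x. ?h x * ell T (- int k - 1) x \<partial>\<mu>)\<^sup>2) sums (\<integral>x. (?h x)\<^sup>2 \<partial>\<mu>)"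
      unfolding coef using sums_laguerre_coefficients[of "V T" m] VT sq by (simp add: has_bochner_integral_iff)
  qed
qed

end

text \<open>Weierstrass approximation on \<open>[0, 1]\<close>; where \<open>u\<close> leaves this
  interval the weight vanishes. The errors are at most 1, which gives the dominating function
  \<open>(B + 1) * \<bar>w x\<bar>\<close>.\<close>

lemma (in L2_subspace) continuous_weight_in_closure:
  assumes w: "square_integrable N w" and u[measurable]: "u \<in> borel_measurable N"
    and u01: "\<And>x. x \<in> space N \<Longrightarrow> w x \<noteq> 0 \<Longrightarrow> 0 \<le> u x \<and> u x \<le> 1"
    and pow: "\<And>m. (\<lambda>x. w x * u x ^ m) \<in> L2_closure N S"
    and \<phi>: "continuous_on UNIV (\<phi> :: real \<Rightarrow> real)"
  shows "(\<lambda>x. w x * \<phi> (u x)) \<in> L2_closure N S"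
proof -
  note [measurable] = square_integrableD(1)[OF w] borel_measurable_continuous_onI[OF \<phi>]
  have "\<exists>p. (\<lambda>x. w x * p (u x)) \<in> L2_closure N S \<and>
      continuous_on UNIV p \<and> (\<forall>y\<in>{0..1}. \<bar>\<phi> y - p y\<bar> < \<epsilon>)" if eps: "\<epsilon> > 0" for \<epsilon>
  proof -
    obtain g where g: "real_polynomial_function g" "\<And>y. y \<in> {0..1} \<Longrightarrow> \<bar>\<phi> y - g y\<bar> < \<epsilon>"
      by (rule Stone_Weierstrass_real_polynomial_function[OF compact_Icc continuous_on_subset[OF \<phi> subset_UNIV] eps]) blast
    obtain a n where an: "g = (\<lambda>x. \<Sum>i\<le>n. a i * x ^ i)"
      using g(1) unfolding real_polynomial_function_iff_sum by blast
    have "(\<lambda>x. \<Sum>i\<le>n. a i * (w x * u x ^ i)) \<in> L2_closure N S"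
      by (intro closure_sum closure_cmult pow)
    moreover have "(\<Sum>i\<le>n. a i * (w x * u x ^ i)) = w x * g (u x)" for x
      by (simp add: an sum_distrib_left mult_ac)
    ultimately show ?thesis
      using g(2) by (intro exI[of _ g]) (auto simp: an intro!: continuous_intros)
  qed
  then have "\<forall>k. \<exists>p. (\<lambda>x. w x * p (u x)) \<in> L2_closure N S \<and>
      continuous_on UNIV p \<and> (\<forall>y\<in>{0..1}. \<bar>\<phi> y - p y\<bar> < inverse (real (Suc k)))"
    by (metis inverse_positive_iff_positive of_nat_0_less_iff zero_less_Suc)
  then obtain p where p: "\<And>k. (\<lambda>x. w x * p k (u x)) \<in> L2_closure N S"
      "\<And>k y. y \<in> {0..1} \<Longrightarrow> \<bar>\<phi> y - p k y\<bar> < inverse (real (Suc k))"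
    by metis
  have "bounded (\<phi> ` {0..1})"
    by (intro compact_imp_bounded compact_continuous_image continuous_on_subset[OF \<phi>]) auto
  then obtain B where B: "\<And>y. y \<in> {0..1} \<Longrightarrow> \<bar>\<phi> y\<bar> \<le> B"
    unfolding bounded_iff by (metis imageI real_norm_def)
  show ?thesis
  proof (rule L2_closure_tendsto[OF L2_tendsto_dominated p(1)])
    show "(\<lambda>x. w x * p k (u x)) \<in> borel_measurable N" for k
      using L2_closureD[OF p(1)] by (rule square_integrableD(1))
    show "square_integrable N (\<lambda>x. (B + 1) * \<bar>w x\<bar>)"
      using w by (intro square_integrable_cmult) (simp add: square_integrable_def)
    show "AE x in N. \<bar>w x * p k (u x)\<bar> \<le> (B + 1) * \<bar>w x\<bar>" for k
    proof (rule AE_I2)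
      fix x assume x: "x \<in> space N"
      show "\<bar>w x * p k (u x)\<bar> \<le> (B + 1) * \<bar>w x\<bar>"
      proof (cases "w x = 0")
        case False
        then have "u x \<in> {0..1}" using u01[OF x] by simp
        from B[OF this] p(2)[OF this, of k] have "\<bar>p k (u x)\<bar> \<le> B + inverse (real (Suc k))" by linarith
        also have "inverse (real (Suc k)) \<le> 1" by (simp add: field_simps)
        finally show ?thesis by (simp add: abs_mult mult.commute[of "B + 1"] mult_left_mono)
      qed simp
    qed
    show "AE x in N. (\<lambda>k. w x * p k (u x)) \<longlonglongrightarrow> w x * \<phi> (u x)"
    proof (rule AE_I2)
      fix x assume x: "x \<in> space N"
      show "(\<lambda>k. w x * p k (u x)) \<longlonglongrightarrow> w x * \<phi> (u x)"
      proof (cases "w x = 0")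
        case False
        then have "u x \<in> {0..1}" using u01[OF x] by simp
        from p(2)[OF this] have "(\<lambda>k. p k (u x) - \<phi> (u x)) \<longlonglongrightarrow> 0"
          by (intro Lim_null_comparison[OF _ LIMSEQ_inverse_real_of_nat])
             (auto intro!: always_eventually less_imp_le simp: abs_minus_commute)
        then have "(\<lambda>k. p k (u x)) \<longlonglongrightarrow> \<phi> (u x)" by (rule Lim_null[THEN iffD2])
        then show ?thesis by (rule tendsto_mult_left)
      qed simp
    qed
  qed measurable
qed

text \<open>Passes from continuous functions of \<open>u\<close> to bounded pointwise limits of
  them, which include the discontinuous cut-offs.\<close>

lemma (in L2_subspace) limit_weight_in_closure:
  assumes w: "square_integrable N w" and u[measurable]: "u \<in> borel_measurable N"
    and u01: "\<And>x. x \<in> space N \<Longrightarrow> w x \<noteq> 0 \<Longrightarrow> 0 \<le> u x \<and> u x \<le> 1"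
    and pow: "\<And>m. (\<lambda>x. w x * u x ^ m) \<in> L2_closure N S"
    and \<phi>: "\<And>k::nat. continuous_on UNIV (\<phi> k :: real \<Rightarrow> real)" "\<And>k y. \<bar>\<phi> k y\<bar> \<le> B"
    and lim: "\<And>y. (\<lambda>k. \<phi> k y) \<longlonglongrightarrow> \<psi> y"
  shows "(\<lambda>x. w x * \<psi> (u x)) \<in> L2_closure N S"
proof (rule L2_closure_tendsto[OF L2_tendsto_dominated continuous_weight_in_closure[OF w u u01 pow \<phi>(1)]])
  note [measurable] = square_integrableD(1)[OF w] borel_measurable_continuous_onI[OF \<phi>(1)]
  have "\<psi> \<in> borel_measurable borel"
    by (rule borel_measurable_LIMSEQ_real[OF lim]) measurable
  note [measurable] = this
  show "(\<lambda>x. w x * \<phi> k (u x)) \<in> borel_measurable N" for k by measurable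
  show "(\<lambda>x. w x * \<psi> (u x)) \<in> borel_measurable N" by measurable
  show "square_integrable N (\<lambda>x. B * \<bar>w x\<bar>)"
    using w by (intro square_integrable_cmult) (simp add: square_integrable_def)
  show "AE x in N. \<bar>w x * \<phi> k (u x)\<bar> \<le> B * \<bar>w x\<bar>" for k
    by (intro AE_I2) (simp add: abs_mult mult.commute[of B] mult_left_mono \<phi>(2))
  show "AE x in N. (\<lambda>k. w x * \<phi> k (u x)) \<longlonglongrightarrow> w x * \<psi> (u x)"
    by (intro AE_I2 tendsto_mult_left lim)
qed

text \<open>Approximates the indicator of \<open>[0, \<infinity>)\<close> from above; for
  \<open>k > 0\<close> it rises linearly on \<open>[- 1 / k, 0]\<close>.\<close>

definition ramp :: "nat \<Rightarrow> real \<Rightarrow> real" where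
  "ramp k x = max 0 (min 1 (1 + real k * x))"

lemma ramp_continuous: "continuous_on S (ramp k)"
  unfolding ramp_def by (intro continuous_intros)

lemma ramp_bounds: "0 \<le> ramp k x" "ramp k x \<le> 1"
  by (auto simp: ramp_def)

lemma ramp_tendsto: "(\<lambda>k. ramp k x) \<longlonglongrightarrow> (if 0 \<le> x then 1 else 0)"
proof (cases "0 \<le> x")
  case True
  then show ?thesis by (simp add: ramp_def)
next
  case False
  then have "- x > 0" by simp
  then obtain N where N: "real N * (- x) > 1" using reals_Archimedean3 by blast
  have "ramp k x = 0" if "k \<ge> N" for k
  proof -
    have "real N * (- x) \<le> real k * (- x)" using that False by (intro mult_right_mono) auto
    then show ?thesis using N by (simp add: ramp_def)
  qed
  then have "\<forall>\<^sub>F k in sequentially. ramp k x = (if 0 \<le> x then 1 else 0)"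
    using False by (intro eventually_sequentiallyI[of N]) auto
  then show ?thesis by (rule tendsto_eventually)
qed

context clock
begin

text \<open>For \<open>t \<le> T\<close> the indicator is \<open>K 0 T\<close> times a cut-off in
  \<open>u = V s / V T\<close>. For \<open>t > T\<close> the piece on \<open>(T, t)\<close> is
  added, as \<open>K (-1) T\<close> times a function of \<open>u = V T / V s\<close>.\<close>

lemma K_0_in_ell_closure:
  assumes T: "T > 0" and "t \<ge> 0"
  shows "K 0 t \<in> ell_closure T"
proof -
  interpret span: L2_subspace \<mu> "ell_span T" by (rule L2_subspace_ell_span)
  have VT: "V T > 0" using T by (rule V_pos)
  have le: "K 0 t \<in> ell_closure T" if t: "0 < t" "t \<le> T" for t
  proof -
    let ?\<psi> = "\<lambda>y. if 0 \<le> V t / V T - y then 1 else 0 :: real"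
    have "(\<lambda>s. K 0 T s * ?\<psi> (V s / V T)) \<in> ell_closure T"
    proof (rule span.limit_weight_in_closure[where w = "K 0 T" and u = "\<lambda>s. V s / V T" and \<psi> = ?\<psi>
          and \<phi> = "\<lambda>k y. ramp k (V t / V T - y)" and B = 1])
      show "0 \<le> V s / V T \<and> V s / V T \<le> 1" if "s \<in> space \<mu>" "K 0 T s \<noteq> 0" for s
        using that T VT by (auto simp: K_0 indicator_def V_nonneg V_le_iff split: if_splits)
      show "continuous_on UNIV (\<lambda>y. ramp k (V t / V T - y))" for k
        by (intro continuous_on_compose2[OF ramp_continuous[of UNIV]] continuous_intros) auto
      show "\<bar>ramp k (V t / V T - y)\<bar> \<le> 1" for k y
        using ramp_bounds[of k "V t / V T - y"] by simp
      show "square_integrable \<mu> (K 0 T)" using T by (intro square_integrable_K) simp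
      show "(\<lambda>k. ramp k (V t / V T - y)) \<longlonglongrightarrow> ?\<psi> y" for y by (rule ramp_tendsto)
      show "(\<lambda>s. K 0 T s * (V s / V T) ^ m) \<in> ell_closure T" for m
        using T by (rule power_left_in_closure)
    qed measurable
    then show ?thesis
    proof (rule L2_closure_AE)
      show "AE s in \<mu>. K 0 T s * ?\<psi> (V s / V T) = K 0 t s"
        using AE_qv_neq[of t] AE_qv_neq[of T] AE_space[of \<mu>]
        by eventually_elim (use t T VT in \<open>auto simp: K_0 indicator_def divide_right_mono V_le_iff field_simps\<close>)
    qed measurable
  qed
  have gt: "K 0 t \<in> ell_closure T" if t: "T < t" for t
  proof -
    have Vt: "V t > 0" using t T by (intro V_pos) auto
    define c where "c = V T / V t"
    have c: "c > 0" using Vt VT by (simp add: c_def)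
    \<comment> \<open>Beyond \<open>T\<close> the weight \<open>K (-1) T\<close> equals
      \<open>- u\<close>, so dividing by \<open>u\<close> gives \<open>- 1\<close> where
      \<open>u \<ge> c\<close>, that is, for \<open>s \<le> t\<close>; \<open>max y c\<close> keeps
      the divisor away from 0.\<close>
    let ?\<psi> = "\<lambda>y. (if 0 \<le> y - c then 1 else 0) / max y c :: real"
    have "(\<lambda>s. K (-1) T s * ?\<psi> (V T / V s)) \<in> ell_closure T"
    proof (rule span.limit_weight_in_closure[where w = "K (-1) T" and u = "\<lambda>s. V T / V s" and \<psi> = ?\<psi>
          and \<phi> = "\<lambda>k y. ramp k (y - c) / max y c" and B = "1 / c"])
      show "0 \<le> V T / V s \<and> V T / V s \<le> 1" if "s \<in> space \<mu>" "K (-1) T s \<noteq> 0" for s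
        using that T VT V_le_iff[of T s] by (auto simp: K_minus_1 indicator_def V_nonneg split: if_splits)
      show "continuous_on UNIV (\<lambda>y. ramp k (y - c) / max y c)" for k
        using c by (intro continuous_intros continuous_on_compose2[OF ramp_continuous[of UNIV]]) (auto simp: max_def)
      show "\<bar>ramp k (y - c) / max y c\<bar> \<le> 1 / c" for k y
        using c ramp_bounds[of k "y - c"] by (simp add: abs_divide frac_le)
      show "(\<lambda>k. ramp k (y - c) / max y c) \<longlonglongrightarrow> ?\<psi> y" for y
        using c by (intro tendsto_divide ramp_tendsto tendsto_const) auto
      show "square_integrable \<mu> (K (-1) T)" using T by (intro square_integrable_K) simp
      show "(\<lambda>s. K (-1) T s * (V T / V s) ^ m) \<in> ell_closure T" for m
        using T by (rule power_right_in_closure)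
    qed measurable
    from span.closure_diff[OF le[of T] this]
    have "(\<lambda>s. K 0 T s - K (-1) T s * ?\<psi> (V T / V s)) \<in> ell_closure T" using T by simp
    then show ?thesis
    proof (rule L2_closure_AE)
      show "AE s in \<mu>. K 0 T s - K (-1) T s * ?\<psi> (V T / V s) = K 0 t s"
        using AE_qv_neq[of t] AE_qv_neq[of T] AE_qv_neq[of 0] AE_space[of \<mu>]
      proof eventually_elim
        case (elim s)
        then have s: "s > 0" "V s > 0" by (auto intro: V_pos)
        consider "s < T" | "T < s" "s < t" | "t < s" using elim by fastforce
        then show ?case
        proof cases
          case 2
          then have "c \<le> V T / V s"
            using VT s Vt V_le_iff[of s t] by (simp add: c_def frac_le)
          then show ?thesis using 2 T VT s by (simp add: K_0 K_minus_1 max_def)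
        next
          case 3
          then have "\<not> c \<le> V T / V s"
            using VT s Vt V_less_iff[of t s] T t by (simp add: c_def field_simps)
          then show ?thesis using 3 T t by (simp add: K_0 K_minus_1)
        qed (use T t s in \<open>simp_all add: K_0 K_minus_1\<close>)
      qed
    qed measurable
  qed
  consider "t = 0" | "0 < t" "t \<le> T" | "T < t" using assms by linarith
  then show ?thesis
    using le gt span.closure_zero by cases (auto simp: K_at_0[abs_def])
qed

lemma ell_complete:
  assumes T: "T > 0" and h: "square_integrable \<mu> h"
  shows "h \<in> ell_closure T"
proof -
  interpret span: L2_subspace \<mu> "ell_span T" by (rule L2_subspace_ell_span)
  have Ioc: "indicator {a<..b} \<in> ell_closure T" if "0 \<le> a" "a \<le> b" for a b
    using that T
    by (intro L2_closure_AE[OF span.closure_diff[OF K_0_in_ell_closure K_0_in_ell_closure] _ K_0_eq_indicator_AE]) auto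
  have step: "step_fun xs \<in> ell_closure T" if "step_list xs" for xs
    using that
    by (induction xs) (auto simp: step_fun_simps(1,2)[abs_def] span.closure_zero
        intro!: span.closure_add span.closure_cmult Ioc)
  obtain g where g: "\<And>k. g k \<in> steps" "L2_tendsto \<mu> g h sequentially"
    using steps.closure_obtain[OF steps_dense[OF h]] by blast
  show ?thesis
  proof (rule L2_closure_tendsto[OF g(2)])
    fix k
    obtain xs where "g k = step_fun xs" "step_list xs" using g(1)[of k] unfolding steps_def by blast
    then show "g k \<in> ell_closure T" using step by simp
  qed
qed

theorem laguerre_parseval:
  assumes T: "T > 0" and h: "square_integrable \<mu> h"
  shows "((\<lambda>J. \<Sum>n\<in>J. (\<integral>s. h s * laguerre_fun V T n s \<partial>\<mu>)\<^sup>2) \<longlongrightarrow> (\<integral>s. (h s)\<^sup>2 \<partial>\<mu>)) (finite_subsets_at_top UNIV)"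
proof (rule tendsto_orthonormal_projection[OF square_integrable_ell[OF T] ell_orthonormal[OF T] h])
  fix \<delta> :: real assume "\<delta> > 0"
  then obtain g where "g \<in> ell_span T" "(\<integral>s. (g s - h s)\<^sup>2 \<partial>\<mu>) < \<delta>"
    using ell_complete[OF T h] unfolding L2_closure_def by blast
  then show "\<exists>J a. finite J \<and> (\<integral>s. ((\<Sum>n\<in>J. a n * ell T n s) - h s)\<^sup>2 \<partial>\<mu>) < \<delta>"
    unfolding ell_span_def by blast
qed

end

section \<open>Wiener integrals\<close>

lemma norm_iexp_diff_le: "norm (iexp x - iexp y) \<le> \<bar>x - y\<bar>"
proof -
  have "iexp x - iexp y = iexp y * (iexp (x - y) - 1)"
    by (simp add: right_diff_distrib exp_add[symmetric])
  then have "norm (iexp x - iexp y) = norm (iexp (x - y) - 1)"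
    by (simp only: norm_mult) simp
  also have "\<dots> \<le> \<bar>x - y\<bar>" using iexp_approx1[of "x - y" 0] by simp
  finally show ?thesis .
qed

text \<open>Both alternatives of \<open>gaussian_rv\<close> lead to the same formula. In the
  nondegenerate one, \<open>S / \<sigma>\<close> is standard normal and its characteristic function
  is taken at \<open>\<sigma>\<close>.\<close>

lemma (in prob_space) gaussian_rv_char:
  assumes g: "gaussian_rv M S" and S: "square_integrable M S" and mean: "expectation S = 0"
  shows "(CLINT x|M. iexp (S x)) = exp (- expectation (\<lambda>x. (S x)\<^sup>2) / 2)"
proof -
  note [measurable] = square_integrableD(1)[OF S]
  consider m where "AE x in M. S x = m" | m \<sigma> where "\<sigma> > 0" "distributed M lborel S (normal_density m \<sigma>)"
    using g unfolding gaussian_rv_def by blast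
  then show ?thesis
  proof cases
    case (1 m)
    have "expectation S = expectation (\<lambda>_. m)"
      using 1 by (intro integral_cong_AE) auto
    then have "m = 0" using mean by (simp add: prob_space)
    then have AE: "AE x in M. S x = 0" using 1 by simp
    then have "expectation (\<lambda>x. (S x)\<^sup>2) = expectation (\<lambda>_. 0)"
      by (intro integral_cong_AE) auto
    moreover from AE have "(CLINT x|M. iexp (S x)) = (CLINT x|M. 1)"
      by (intro integral_cong_AE) auto
    ultimately show ?thesis by (simp add: prob_space)
  next
    case (2 m \<sigma>)
    have m: "m = 0" using normal_distributed_expectation[OF 2] mean by simp
    have var: "expectation (\<lambda>x. (S x)\<^sup>2) = \<sigma>\<^sup>2"
      using normal_distributed_variance[OF 2] mean by simp
    have "distributed M lborel (\<lambda>x. S x / \<sigma>) std_normal_density"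
      using 2 m normal_standard_normal_convert[OF 2(1), of S m] by simp
    then have "distr M lborel (\<lambda>x. S x / \<sigma>) = std_normal_distribution"
      by (rule distributed_distr_eq_density)
    then have "char (distr M lborel (\<lambda>x. S x / \<sigma>)) \<sigma> = exp (- (\<sigma>\<^sup>2) / 2)"
      by (simp add: char_std_normal_distribution)
    moreover have "char (distr M lborel (\<lambda>x. S x / \<sigma>)) \<sigma> = (CLINT x|M. iexp (S x))"
      using 2(1) unfolding char_def by (subst integral_distr) auto
    ultimately show ?thesis by (simp add: var)
  qed
qed

text \<open>\<open>iexp\<close> is 1-Lipschitz, and the mean absolute difference is bounded by
  Cauchy-Schwarz against the constant 1.\<close>

lemma (in prob_space) L2_tendsto_char:
  assumes "L2_tendsto M Y Z sequentially"
  shows "(\<lambda>k. CLINT x|M. iexp (Y k x)) \<longlonglongrightarrow> (CLINT x|M. iexp (Z x))"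
proof -
  note L = L2_tendstoD[OF assms]
  note [measurable] = square_integrableD(1)[OF L(1)] square_integrableD(1)[OF L(2)]
  have one: "square_integrable M (\<lambda>_. 1)" by (simp add: square_integrable_def)
  have int: "complex_integrable M (\<lambda>x. iexp (f x))" if [measurable]: "f \<in> borel_measurable M" for f :: "'a \<Rightarrow> real"
    by (rule integrable_const_bound[of _ 1]) auto
  have bound: "norm ((CLINT x|M. iexp (Y k x)) - (CLINT x|M. iexp (Z x))) \<le> sqrt (expectation (\<lambda>x. (Y k x - Z x)\<^sup>2))" for k
  proof -
    have sq: "square_integrable M (\<lambda>x. \<bar>Y k x - Z x\<bar>)"
      using square_integrable_diff[OF L(1)[of k] L(2)] by (simp add: square_integrable_def)
    have i: "integrable M (\<lambda>x. \<bar>Y k x - Z x\<bar>)"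
      using square_integrable_integrable_mult[OF sq one] by simp
    have "(CLINT x|M. iexp (Y k x)) - (CLINT x|M. iexp (Z x)) = (CLINT x|M. iexp (Y k x) - iexp (Z x))"
      by (intro Bochner_Integration.integral_diff[symmetric] int) measurable
    then have "norm ((CLINT x|M. iexp (Y k x)) - (CLINT x|M. iexp (Z x))) \<le> expectation (\<lambda>x. norm (iexp (Y k x) - iexp (Z x)))"
      by (simp only: integral_norm_bound)
    also have "\<dots> \<le> expectation (\<lambda>x. \<bar>Y k x - Z x\<bar>)"
      using i by (intro integral_mono norm_iexp_diff_le integrable_norm Bochner_Integration.integrable_diff int) auto
    also have "\<dots> \<le> sqrt (expectation (\<lambda>x. (Y k x - Z x)\<^sup>2))"
      using Cauchy_Schwarz_integral[OF sq one] by (intro real_le_rsqrt) (simp add: prob_space)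
    finally show ?thesis .
  qed
  have "(\<lambda>k. sqrt (expectation (\<lambda>x. (Y k x - Z x)\<^sup>2))) \<longlonglongrightarrow> sqrt 0"
    by (intro tendsto_real_sqrt L(3))
  then have lim: "(\<lambda>k. sqrt (expectation (\<lambda>x. (Y k x - Z x)\<^sup>2))) \<longlonglongrightarrow> 0" by simp
  have "(\<lambda>k. (CLINT x|M. iexp (Y k x)) - (CLINT x|M. iexp (Z x))) \<longlonglongrightarrow> 0"
    by (rule Lim_null_comparison[OF _ lim]) (intro always_eventually allI bound)
  then show ?thesis by (rule Lim_null[THEN iffD2])
qed

section \<open>Measure-preserving maps and the Wiener integral on path space\<close>

lemma measure_preserving_integral:
  fixes g :: "'a \<Rightarrow> real"
  assumes "\<theta> \<in> measurable P P" "distr P P \<theta> = P" "g \<in> borel_measurable P"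
  shows "(\<integral>\<omega>. g (\<theta> \<omega>) \<partial>P) = (\<integral>\<omega>. g \<omega> \<partial>P)"
  using integral_distr[of \<theta> P P g] assms by simp

lemma measure_preserving_square_integrable:
  assumes [measurable]: "\<theta> \<in> measurable P P" and "distr P P \<theta> = P" and g: "square_integrable P g"
  shows "square_integrable P (\<lambda>\<omega>. g (\<theta> \<omega>))"
proof -
  note [measurable] = square_integrableD(1)[OF g]
  show ?thesis
    using g integrable_distr_eq[of \<theta> P P "\<lambda>\<omega>. (g \<omega>)\<^sup>2"] assms(2) by (simp add: square_integrable_def)
qed

text \<open>The martingale property and the bracket are condensed into mean 0 and covariance
  \<open>V (min s t)\<close>; \<open>gaussian_pathsI\<close> makes the reduction.\<close>

locale gaussian_paths = clock V + prob_space P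
  for V :: "real \<Rightarrow> real" and P :: "(real \<Rightarrow> real) measure" +
  assumes sets_P: "sets P = sets path_space"
    and gaussian: "gaussian_process P coord"
    and sq: "\<And>t. 0 \<le> t \<Longrightarrow> square_integrable P (coord t)"
    and mean: "\<And>t. 0 \<le> t \<Longrightarrow> expectation (coord t) = 0"
    and cov: "\<And>s t. 0 \<le> s \<Longrightarrow> 0 \<le> t \<Longrightarrow> expectation (\<lambda>\<omega>. coord s \<omega> * coord t \<omega>) = V (min s t)"
begin

lemma coord_measurable[measurable]: "0 \<le> t \<Longrightarrow> coord t \<in> borel_measurable P"
  using sq by (rule square_integrableD(1))

lemma sq_step_integral:
  assumes "\<And>t. 0 \<le> t \<Longrightarrow> square_integrable P (X t)" "step_list xs"
  shows "square_integrable P (step_integral X xs)"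
  using assms(2)
  by (induction xs)
     (auto simp: step_integral_simps(1,2)[abs_def] square_integrable_zero
       intro!: square_integrable_add square_integrable_cmult square_integrable_diff assms(1))

text \<open>Stated for a general process \<open>X\<close>, so that it serves both
  \<open>coord\<close> and \<open>coord\<close> after a measure-preserving map. The kernel
  \<open>k\<close> represents \<open>Y\<close> through its pairings at single times, and linearity
  carries this over to step functions.\<close>

lemma step_integral_pairing:
  assumes Y: "square_integrable P Y" and X: "\<And>t. 0 \<le> t \<Longrightarrow> square_integrable P (X t)"
    and k: "square_integrable \<mu> k"
    and eq: "\<And>t. 0 \<le> t \<Longrightarrow> expectation (\<lambda>\<omega>. Y \<omega> * X t \<omega>) = (\<integral>s. k s * K 0 t s \<partial>\<mu>)"
    and "step_list xs"
  shows "expectation (\<lambda>\<omega>. Y \<omega> * step_integral X xs \<omega>) = (\<integral>s. k s * step_fun xs s \<partial>\<mu>)"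
  using \<open>step_list xs\<close>
proof (induction xs)
  case Nil
  then show ?case by simp
next
  case (Cons x xs)
  obtain c a b where x: "x = (c, a, b)" by (cases x)
  have ab: "0 \<le> a" "a \<le> b" "0 \<le> b" "step_list xs" using Cons.prems x by auto
  have "expectation (\<lambda>\<omega>. Y \<omega> * step_integral X (x # xs) \<omega>) =
      expectation (\<lambda>\<omega>. c * (Y \<omega> * X b \<omega>) - c * (Y \<omega> * X a \<omega>) + Y \<omega> * step_integral X xs \<omega>)"
    by (intro Bochner_Integration.integral_cong) (auto simp: x algebra_simps)
  also have "\<dots> = c * expectation (\<lambda>\<omega>. Y \<omega> * X b \<omega>) - c * expectation (\<lambda>\<omega>. Y \<omega> * X a \<omega>)
      + expectation (\<lambda>\<omega>. Y \<omega> * step_integral X xs \<omega>)"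
    using square_integrable_integrable_mult[OF Y X[OF ab(1)]] square_integrable_integrable_mult[OF Y X[OF ab(3)]]
      square_integrable_integrable_mult[OF Y sq_step_integral[OF X ab(4)]]
    by simp
  also have "\<dots> = c * (\<integral>s. k s * K 0 b s \<partial>\<mu>) - c * (\<integral>s. k s * K 0 a s \<partial>\<mu>) + (\<integral>s. k s * step_fun xs s \<partial>\<mu>)"
    using ab by (simp add: eq Cons.IH)
  also have "\<dots> = (\<integral>s. c * (k s * K 0 b s) - c * (k s * K 0 a s) + k s * step_fun xs s \<partial>\<mu>)"
    using square_integrable_integrable_mult[OF k square_integrable_K[OF ab(1), of 0]]
      square_integrable_integrable_mult[OF k square_integrable_K[OF ab(3), of 0]]
      square_integrable_integrable_mult[OF k square_integrable_step_fun[OF ab(4)]]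
    by simp
  also have "\<dots> = (\<integral>s. k s * step_fun (x # xs) s \<partial>\<mu>)"
  proof (rule integral_cong_AE)
    note [measurable] = square_integrableD(1)[OF k]
    show "(\<lambda>s. c * (k s * K 0 b s) - c * (k s * K 0 a s) + k s * step_fun xs s) \<in> borel_measurable \<mu>"
      by measurable
    show "(\<lambda>s. k s * step_fun (x # xs) s) \<in> borel_measurable \<mu>" by measurable
    show "AE s in \<mu>. c * (k s * K 0 b s) - c * (k s * K 0 a s) + k s * step_fun xs s = k s * step_fun (x # xs) s"
      using K_0_eq_indicator_AE[OF ab(1,2)]
    proof eventually_elim
      case (elim s)
      have "c * (k s * K 0 b s) - c * (k s * K 0 a s) = k s * (c * (K 0 b s - K 0 a s))"
        by (simp add: algebra_simps)
      then show ?case unfolding elim by (simp add: x distrib_left)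
    qed
  qed
  finally show ?case .
qed

text \<open>\<open>step_integral_pairing\<close> is applied once in each factor, starting from the
  covariance of two coordinates as the pairing of two kernels \<open>K 0\<close>.\<close>

lemma step_isometry:
  assumes "step_list xs" "step_list ys"
  shows "expectation (\<lambda>\<omega>. step_integral coord xs \<omega> * step_integral coord ys \<omega>) = (\<integral>s. step_fun xs s * step_fun ys s \<partial>\<mu>)"
proof (rule step_integral_pairing[OF sq_step_integral[OF sq assms(1)] sq square_integrable_step_fun[OF assms(1)] _ assms(2)])
  fix t :: real assume t: "0 \<le> t"
  have "expectation (\<lambda>\<omega>. coord t \<omega> * step_integral coord xs \<omega>) = (\<integral>s. K 0 t s * step_fun xs s \<partial>\<mu>)"
    using t by (intro step_integral_pairing sq square_integrable_K assms) (simp_all add: cov integral_K_0_K_0)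
  then show "expectation (\<lambda>\<omega>. step_integral coord xs \<omega> * coord t \<omega>) = (\<integral>s. step_fun xs s * K 0 t s \<partial>\<mu>)"
    by (simp only: mult.commute)
qed

abbreviation "W h Y \<equiv> wiener_integral P coord V h Y"

lemma W_obtain:
  assumes "W h Y"
  obtains xs where "\<And>k. step_list (xs k)" "L2_tendsto \<mu> (\<lambda>k. step_fun (xs k)) h sequentially"
    "L2_tendsto P (\<lambda>k. step_integral coord (xs k)) Y sequentially"
  using assms unfolding wiener_integral_def step_list_def by blast

lemma W_intro:
  assumes "\<And>k. step_list (xs k)" "L2_tendsto \<mu> (\<lambda>k. step_fun (xs k)) h sequentially"
    "L2_tendsto P (\<lambda>k. step_integral coord (xs k)) Y sequentially"
  shows "W h Y"
  using assms unfolding wiener_integral_def step_list_def by blast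

lemma W_square_integrable:
  assumes "W h Y"
  shows "square_integrable \<mu> h" "square_integrable P Y"
  using W_obtain[OF assms] L2_tendstoD(2) by metis+

lemma W_norm:
  assumes "W h Y"
  shows "expectation (\<lambda>\<omega>. (Y \<omega>)\<^sup>2) = (\<integral>s. (h s)\<^sup>2 \<partial>\<mu>)"
proof -
  obtain xs where xs: "\<And>k. step_list (xs k)" "L2_tendsto \<mu> (\<lambda>k. step_fun (xs k)) h sequentially"
    "L2_tendsto P (\<lambda>k. step_integral coord (xs k)) Y sequentially"
    using W_obtain[OF assms] by blast
  have "(\<lambda>k. expectation (\<lambda>\<omega>. (step_integral coord (xs k) \<omega>)\<^sup>2)) = (\<lambda>k. \<integral>s. (step_fun (xs k) s)\<^sup>2 \<partial>\<mu>)"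
    using step_isometry[OF xs(1) xs(1)] by (simp add: power2_eq_square)
  then show ?thesis
    using LIMSEQ_unique[OF L2_tendsto_norm[OF xs(3)]] L2_tendsto_norm[OF xs(2)] by simp
qed

lemma W_add:
  assumes "W h Y" "W h' Y'"
  shows "W (\<lambda>s. h s + h' s) (\<lambda>\<omega>. Y \<omega> + Y' \<omega>)"
proof -
  obtain xs where xs: "\<And>k. step_list (xs k)" "L2_tendsto \<mu> (\<lambda>k. step_fun (xs k)) h sequentially"
    "L2_tendsto P (\<lambda>k. step_integral coord (xs k)) Y sequentially"
    using W_obtain[OF assms(1)] by blast
  obtain ys where ys: "\<And>k. step_list (ys k)" "L2_tendsto \<mu> (\<lambda>k. step_fun (ys k)) h' sequentially"
    "L2_tendsto P (\<lambda>k. step_integral coord (ys k)) Y' sequentially"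
    using W_obtain[OF assms(2)] by blast
  show ?thesis
  proof (rule W_intro[of "\<lambda>k. xs k @ ys k"])
    show "L2_tendsto \<mu> (\<lambda>k. step_fun (xs k @ ys k)) (\<lambda>s. h s + h' s) sequentially"
      using L2_tendsto_add[OF xs(2) ys(2)] by (simp add: step_fun_simps(3)[abs_def])
    show "L2_tendsto P (\<lambda>k. step_integral coord (xs k @ ys k)) (\<lambda>\<omega>. Y \<omega> + Y' \<omega>) sequentially"
      using L2_tendsto_add[OF xs(3) ys(3)] by (simp add: step_integral_simps(3)[abs_def])
  qed (simp add: xs ys)
qed

lemma W_cmult:
  assumes "W h Y"
  shows "W (\<lambda>s. c * h s) (\<lambda>\<omega>. c * Y \<omega>)"
proof -
  obtain xs where xs: "\<And>k. step_list (xs k)" "L2_tendsto \<mu> (\<lambda>k. step_fun (xs k)) h sequentially"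
    "L2_tendsto P (\<lambda>k. step_integral coord (xs k)) Y sequentially"
    using W_obtain[OF assms] by blast
  show ?thesis
  proof (rule W_intro[of "\<lambda>k. step_scale c (xs k)"])
    show "L2_tendsto \<mu> (\<lambda>k. step_fun (step_scale c (xs k))) (\<lambda>s. c * h s) sequentially"
      using L2_tendsto_cmult[OF xs(2)] by (simp add: step_scale_simps(2)[abs_def])
    show "L2_tendsto P (\<lambda>k. step_integral coord (step_scale c (xs k))) (\<lambda>\<omega>. c * Y \<omega>) sequentially"
      using L2_tendsto_cmult[OF xs(3)] by (simp add: step_scale_simps(3)[abs_def])
  qed (simp add: xs)
qed

lemma W_zero: "W (\<lambda>s. 0) (\<lambda>\<omega>. 0)"
  by (rule W_intro[of "\<lambda>k. []"])
     (auto simp: step_fun_simps(1)[abs_def] step_integral_simps(1)[abs_def] intro!: L2_tendsto_const square_integrable_zero)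

lemma W_sum:
  assumes "\<And>i. i \<in> I \<Longrightarrow> W (h i) (Y i)"
  shows "W (\<lambda>s. \<Sum>i\<in>I. h i s) (\<lambda>\<omega>. \<Sum>i\<in>I. Y i \<omega>)"
  using assms
proof (induction I rule: infinite_finite_induct)
  case (insert i I)
  then show ?case by (simp add: W_add)
qed (simp_all add: W_zero)

text \<open>Step integrals are finite combinations of coordinates, hence Gaussian, and
  characteristic functions pass to L2 limits. The later identifications of laws go through this
  formula.\<close>

lemma W_char:
  assumes "W h Y"
  shows "(CLINT \<omega>|P. iexp (Y \<omega>)) = exp (- (\<integral>s. (h s)\<^sup>2 \<partial>\<mu>) / 2)"
proof -
  have lin: "\<exists>I c. finite I \<and> I \<subseteq> {0..} \<and> (\<forall>\<omega>. step_integral coord xs \<omega> = (\<Sum>t\<in>I. c t * coord t \<omega>))"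
    if "step_list xs" for xs
    using that
  proof (induction xs)
    case Nil
    then show ?case by (intro exI[of _ "{}"]) auto
  next
    case (Cons x xs)
    obtain c a b where x: "x = (c, a, b)" by (cases x)
    have ab: "0 \<le> a" "0 \<le> b" "step_list xs" using Cons.prems x by auto
    obtain I d where I: "finite I" "I \<subseteq> {0..}" "\<And>\<omega>. step_integral coord xs \<omega> = (\<Sum>t\<in>I. d t * coord t \<omega>)"
      using Cons.IH[OF ab(3)] by blast
    let ?J = "I \<union> {a, b}"
    \<comment> \<open>The endpoints may coincide or already belong to \<open>I\<close>, so
      coefficients are added pointwise.\<close>
    let ?e = "\<lambda>t. (if t = b then c else 0) - (if t = a then c else 0) + (if t \<in> I then d t else 0)"
    have "step_integral coord (x # xs) \<omega> = (\<Sum>t\<in>?J. ?e t * coord t \<omega>)" for \<omega>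
    proof -
      have 1: "(\<Sum>t\<in>?J. (if t \<in> I then d t else 0) * coord t \<omega>) = (\<Sum>t\<in>I. d t * coord t \<omega>)"
        using I(1) by (intro sum.mono_neutral_cong_right) auto
      have 2: "(\<Sum>t\<in>?J. (if t = r then c else 0) * coord t \<omega>) = c * coord r \<omega>" if "r \<in> {a, b}" for r
      proof -
        have "(\<Sum>t\<in>?J. (if t = r then c else 0) * coord t \<omega>) = (\<Sum>t\<in>?J. if t = r then c * coord r \<omega> else 0)"
          by (intro sum.cong) auto
        then show ?thesis using I(1) that by (auto simp: sum.delta)
      qed
      show ?thesis
        unfolding distrib_right left_diff_distrib sum.distrib sum_subtractf 1
        using 2[of a] 2[of b] by (simp add: x I(3) right_diff_distrib)
    qed
    then show ?case using I ab by (intro exI[of _ ?J] exI[of _ ?e]) auto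
  qed
  have step: "(CLINT \<omega>|P. iexp (step_integral coord xs \<omega>)) = exp (- (\<integral>s. (step_fun xs s)\<^sup>2 \<partial>\<mu>) / 2)"
    if xs: "step_list xs" for xs
  proof -
    obtain I d where I: "finite I" "I \<subseteq> {0..}" "\<And>\<omega>. step_integral coord xs \<omega> = (\<Sum>t\<in>I. d t * coord t \<omega>)"
      using lin[OF xs] by blast
    have eq: "step_integral coord xs = (\<lambda>\<omega>. \<Sum>t\<in>I. d t * coord t \<omega>)" using I(3) by (rule ext)
    have g: "gaussian_rv P (step_integral coord xs)"
      unfolding eq using gaussian I(1,2) unfolding gaussian_process_def by blast
    have one: "square_integrable P (\<lambda>_. 1)" by (simp add: square_integrable_def)
    have "integrable P (coord t)" if "t \<in> I" for t
      using square_integrable_integrable_mult[OF sq one, of t] that I(2) by auto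
    then have "expectation (step_integral coord xs) = (\<Sum>t\<in>I. d t * expectation (coord t))"
      unfolding eq by simp
    also have "\<dots> = 0" using I(2) by (intro sum.neutral) (auto simp: mean)
    finally show ?thesis
      using gaussian_rv_char[OF g sq_step_integral[OF sq xs]] step_isometry[OF xs xs]
      by (simp add: power2_eq_square)
  qed
  obtain xs where xs: "\<And>k. step_list (xs k)" "L2_tendsto \<mu> (\<lambda>k. step_fun (xs k)) h sequentially"
    "L2_tendsto P (\<lambda>k. step_integral coord (xs k)) Y sequentially"
    using W_obtain[OF assms] by blast
  have "(\<lambda>k. exp (- (\<integral>s. (step_fun (xs k) s)\<^sup>2 \<partial>\<mu>) / 2)) \<longlonglongrightarrow> exp (- (\<integral>s. (h s)\<^sup>2 \<partial>\<mu>) / 2)"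
    by (intro tendsto_exp tendsto_divide tendsto_minus tendsto_const L2_tendsto_norm[OF xs(2)]) simp
  then have "(\<lambda>k. complex_of_real (exp (- (\<integral>s. (step_fun (xs k) s)\<^sup>2 \<partial>\<mu>) / 2)))
      \<longlonglongrightarrow> complex_of_real (exp (- (\<integral>s. (h s)\<^sup>2 \<partial>\<mu>) / 2))"
    by (rule tendsto_of_real)
  with L2_tendsto_char[OF xs(3)] show ?thesis
    unfolding step[OF xs(1)] by (rule LIMSEQ_unique)
qed

text \<open>By invariance, composition with \<open>\<theta>\<close> preserves L2 distances, so step
  approximations of \<open>Y\<close> become approximations of \<open>Y (\<theta> \<omega>)\<close>.
  Thus \<open>k\<close>, given by pairings at single times, represents \<open>X\<close> against
  every Wiener integral composed with \<open>\<theta>\<close>.\<close>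

lemma W_pairing:
  assumes \<theta>: "\<theta> \<in> measurable P P" and mp: "distr P P \<theta> = P"
    and X: "square_integrable P X" and k: "square_integrable \<mu> k"
    and eq: "\<And>t. 0 \<le> t \<Longrightarrow> expectation (\<lambda>\<omega>. X \<omega> * coord t (\<theta> \<omega>)) = (\<integral>s. k s * K 0 t s \<partial>\<mu>)"
    and W: "W h Y"
  shows "expectation (\<lambda>\<omega>. X \<omega> * Y (\<theta> \<omega>)) = (\<integral>s. k s * h s \<partial>\<mu>)"
proof -
  obtain xs where xs: "\<And>k. step_list (xs k)" "L2_tendsto \<mu> (\<lambda>k. step_fun (xs k)) h sequentially"
    "L2_tendsto P (\<lambda>k. step_integral coord (xs k)) Y sequentially"
    using W_obtain[OF W] by blast
  note inv_sq = measure_preserving_square_integrable[OF \<theta> mp]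
  note L = L2_tendstoD[OF xs(3)]
  have inv2: "expectation (\<lambda>\<omega>. (step_integral coord (xs j) (\<theta> \<omega>) - Y (\<theta> \<omega>))\<^sup>2) =
      expectation (\<lambda>\<omega>. (step_integral coord (xs j) \<omega> - Y \<omega>)\<^sup>2)" for j
    using square_integrableD(1)[OF square_integrable_diff[OF L(1,2)]]
    by (intro measure_preserving_integral[OF \<theta> mp, where g = "\<lambda>\<omega>. (step_integral coord (xs j) \<omega> - Y \<omega>)\<^sup>2"]) simp
  have "L2_tendsto P (\<lambda>j \<omega>. step_integral coord (xs j) (\<theta> \<omega>)) (\<lambda>\<omega>. Y (\<theta> \<omega>)) sequentially"
    unfolding L2_tendsto_def inv2 using L(3) inv_sq[OF L(1)] inv_sq[OF L(2)] by blast
  then have "(\<lambda>j. expectation (\<lambda>\<omega>. step_integral coord (xs j) (\<theta> \<omega>) * X \<omega>)) \<longlonglongrightarrow> expectation (\<lambda>\<omega>. Y (\<theta> \<omega>) * X \<omega>)"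
    by (rule L2_tendsto_inner[OF _ X])
  moreover have "expectation (\<lambda>\<omega>. step_integral coord (xs j) (\<theta> \<omega>) * X \<omega>) = (\<integral>s. step_fun (xs j) s * k s \<partial>\<mu>)" for j
  proof -
    have "expectation (\<lambda>\<omega>. X \<omega> * step_integral (\<lambda>t \<omega>. coord t (\<theta> \<omega>)) (xs j) \<omega>) = (\<integral>s. k s * step_fun (xs j) s \<partial>\<mu>)"
      by (intro step_integral_pairing X k eq xs inv_sq sq)
    then show ?thesis by (simp add: step_integral_def mult.commute)
  qed
  moreover have "(\<lambda>j. \<integral>s. step_fun (xs j) s * k s \<partial>\<mu>) \<longlonglongrightarrow> (\<integral>s. h s * k s \<partial>\<mu>)"
    by (rule L2_tendsto_inner[OF xs(2) k])
  ultimately have "expectation (\<lambda>\<omega>. Y (\<theta> \<omega>) * X \<omega>) = (\<integral>s. h s * k s \<partial>\<mu>)"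
    by (simp only:) (rule LIMSEQ_unique)
  then show ?thesis by (simp only: mult.commute)
qed

lemma W_pairing_id:
  assumes "square_integrable P X" "square_integrable \<mu> k"
    and "\<And>t. 0 \<le> t \<Longrightarrow> expectation (\<lambda>\<omega>. X \<omega> * coord t \<omega>) = (\<integral>s. k s * K 0 t s \<partial>\<mu>)" and "W h Y"
  shows "expectation (\<lambda>\<omega>. X \<omega> * Y \<omega>) = (\<integral>s. k s * h s \<partial>\<mu>)"
proof -
  have "(\<lambda>\<omega>. \<omega>) \<in> measurable P P" "distr P P (\<lambda>\<omega>. \<omega>) = P"
    using measurable_ident[of P] distr_id[of P] by (simp_all add: id_def)
  then show ?thesis by (rule W_pairing[OF _ _ assms])
qed

lemma W_coord_inner:
  assumes "0 \<le> t" "W h Y"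
  shows "expectation (\<lambda>\<omega>. coord t \<omega> * Y \<omega>) = (\<integral>s. K 0 t s * h s \<partial>\<mu>)"
  by (rule W_pairing_id[OF sq[OF assms(1)] square_integrable_K[OF assms(1)] _ assms(2)])
     (simp add: assms(1) cov integral_K_0_K_0)

lemma W_inner:
  assumes "W h Y" "W h' Y'"
  shows "expectation (\<lambda>\<omega>. Y \<omega> * Y' \<omega>) = (\<integral>s. h s * h' s \<partial>\<mu>)"
proof (rule W_pairing_id[OF W_square_integrable(2)[OF assms(1)] W_square_integrable(1)[OF assms(1)] _ assms(2)])
  show "expectation (\<lambda>\<omega>. Y \<omega> * coord t \<omega>) = (\<integral>s. h s * K 0 t s \<partial>\<mu>)" if "0 \<le> t" for t
    using W_coord_inner[OF that assms(1)] by (simp only: mult.commute)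
qed

lemma W_cong_AE:
  assumes "W h Y" "Y' \<in> borel_measurable P" "AE \<omega> in P. Y \<omega> = Y' \<omega>"
  shows "W h Y'"
proof -
  obtain xs where xs: "\<And>k. step_list (xs k)" "L2_tendsto \<mu> (\<lambda>k. step_fun (xs k)) h sequentially"
    "L2_tendsto P (\<lambda>k. step_integral coord (xs k)) Y sequentially"
    using W_obtain[OF assms(1)] by blast
  note L = L2_tendstoD[OF xs(3)]
  note [measurable] = assms(2) square_integrableD(1)[OF L(1)] square_integrableD(1)[OF L(2)]
  have "expectation (\<lambda>\<omega>. (step_integral coord (xs k) \<omega> - Y' \<omega>)\<^sup>2) = expectation (\<lambda>\<omega>. (step_integral coord (xs k) \<omega> - Y \<omega>)\<^sup>2)" for k
    using assms(3) by (intro integral_cong_AE) (auto elim!: eventually_mono)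
  then have "L2_tendsto P (\<lambda>k. step_integral coord (xs k)) Y' sequentially"
    using L square_integrable_cong_AE[OF L(2) assms(2,3)] by (simp add: L2_tendsto_def)
  then show ?thesis by (rule W_intro[OF xs(1,2)])
qed

text \<open>A variable with the covariances of a Wiener integral and the right variance is that Wiener
  integral: the distance to a step approximation is the same on both sides.\<close>

lemma W_characterization:
  assumes h: "square_integrable \<mu> h" and X: "square_integrable P X"
    and eq: "\<And>t. 0 \<le> t \<Longrightarrow> expectation (\<lambda>\<omega>. X \<omega> * coord t \<omega>) = (\<integral>s. h s * K 0 t s \<partial>\<mu>)"
    and norm: "expectation (\<lambda>\<omega>. (X \<omega>)\<^sup>2) = (\<integral>s. (h s)\<^sup>2 \<partial>\<mu>)"
  shows "W h X"
proof -
  obtain g where g: "\<And>k. g k \<in> steps" "L2_tendsto \<mu> g h sequentially"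
    using steps.closure_obtain[OF steps_dense[OF h]] by blast
  have "\<forall>k. \<exists>xs. g k = step_fun xs \<and> step_list xs" using g(1) unfolding steps_def by blast
  then obtain xs where xs: "\<And>k. g k = step_fun (xs k)" "\<And>k. step_list (xs k)" by metis
  have g': "L2_tendsto \<mu> (\<lambda>k. step_fun (xs k)) h sequentially" using g(2) unfolding xs(1) .
  show ?thesis
  proof (rule W_intro[OF xs(2) g'])
    have "expectation (\<lambda>\<omega>. (step_integral coord (xs k) \<omega> - X \<omega>)\<^sup>2) = (\<integral>s. (step_fun (xs k) s - h s)\<^sup>2 \<partial>\<mu>)" for k
    proof -
      have "expectation (\<lambda>\<omega>. X \<omega> * step_integral coord (xs k) \<omega>) = (\<integral>s. h s * step_fun (xs k) s \<partial>\<mu>)"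
        by (intro step_integral_pairing X h sq eq xs)
      then have "expectation (\<lambda>\<omega>. step_integral coord (xs k) \<omega> * X \<omega>) = (\<integral>s. step_fun (xs k) s * h s \<partial>\<mu>)"
        by (simp only: mult.commute)
      moreover have "expectation (\<lambda>\<omega>. (step_integral coord (xs k) \<omega>)\<^sup>2) = (\<integral>s. (step_fun (xs k) s)\<^sup>2 \<partial>\<mu>)"
        using step_isometry[OF xs(2) xs(2), of k k] by (simp add: power2_eq_square)
      moreover have "expectation (\<lambda>\<omega>. (step_integral coord (xs k) \<omega> - X \<omega>)\<^sup>2) =
          expectation (\<lambda>\<omega>. (step_integral coord (xs k) \<omega>)\<^sup>2)
          - 2 * expectation (\<lambda>\<omega>. step_integral coord (xs k) \<omega> * X \<omega>) + expectation (\<lambda>\<omega>. (X \<omega>)\<^sup>2)"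
        by (intro integral_square_diff sq_step_integral sq xs X)
      ultimately show ?thesis
        unfolding integral_square_diff[OF square_integrable_step_fun[OF xs(2)] h] by (simp only: norm)
    qed
    then show "L2_tendsto P (\<lambda>k. step_integral coord (xs k)) X sequentially"
      using L2_tendstoD(3)[OF g'] sq_step_integral[OF sq xs(2)] X by (simp add: L2_tendsto_def)
  qed
qed

lemma W_coord: "0 \<le> t \<Longrightarrow> W (K 0 t) (coord t)"
  using cov[of t t]
  by (intro W_characterization square_integrable_K sq)
     (simp_all add: cov integral_K_0_K_0 integral_K_square power2_eq_square)

end

section \<open>Measure preservation and the drift\<close>

context gaussian_paths
begin

lemma space_P: "space P = {\<omega> \<in> extensional {0..}. continuous_on {0..} \<omega>}"
  using sets_eq_imp_space_eq[OF sets_P]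
  by (auto simp: path_space_def space_restrict_space space_PiM PiE_def)

lemma sets_P_restrict: "sets P = sets (restrict_space (PiM {0..} (\<lambda>_. borel)) (space P))"
proof -
  have "space P = {\<omega>. continuous_on {0..} \<omega>} \<inter> space (PiM {0..} (\<lambda>_. borel :: real measure))"
    using sets_eq_imp_space_eq[OF sets_P] by (simp add: path_space_def space_restrict_space)
  then have "{\<omega>. continuous_on {0..} \<omega>} \<inter> B = space P \<inter> B"
    if "B \<in> sets (PiM {0..} (\<lambda>_. borel :: real measure))" for B
    using sets.sets_into_space[OF that] by auto
  then show ?thesis
    unfolding sets_P path_space_def sets_restrict_space by (intro image_cong refl)
qed

lemma ident_measurable_PiM: "(\<lambda>\<omega>. \<omega>) \<in> measurable P (PiM {0..} (\<lambda>_. borel))"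
  unfolding measurable_cong_sets[OF sets_P_restrict refl]
  by (rule measurable_restrict_space1) simp

text \<open>The kernels \<open>h t\<close> make the coordinates after \<open>\<theta>\<close>
  jointly Gaussian, and the covariances then fix the characteristic function of every linear
  combination. This settles cylinder sets of the product sigma-algebra, whose trace on the paths is
  \<open>sets P\<close>.\<close>

lemma measure_preservingI:
  assumes \<theta>: "\<theta> \<in> measurable P P"
    and W: "\<And>t. 0 \<le> t \<Longrightarrow> W (h t) (\<lambda>\<omega>. coord t (\<theta> \<omega>))"
    and cov': "\<And>s t. 0 \<le> s \<Longrightarrow> 0 \<le> t \<Longrightarrow>
      expectation (\<lambda>\<omega>. coord s (\<theta> \<omega>) * coord t (\<theta> \<omega>)) = V (min s t)"
  shows "distr P P \<theta> = P"
proof (rule measure_eqI)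
  let ?N = "PiM {0..} (\<lambda>_. borel) :: (real \<Rightarrow> real) measure"
  note [measurable] = \<theta> ident_measurable_PiM
  have \<theta>N[measurable]: "\<theta> \<in> measurable P ?N"
    using measurable_compose[OF \<theta> ident_measurable_PiM] .
  have "distr P ?N \<theta> = distr P ?N (\<lambda>\<omega>. \<omega>)"
  proof (rule measure_eqI_PiM_infinite)
    show "finite_measure (distr P ?N \<theta>)"
      by (intro finite_measure_distr) measurable
    fix A :: "real \<Rightarrow> real set" and J :: "real set"
    assume J: "finite J" "J \<subseteq> {0..}" and A: "\<And>i. i \<in> J \<Longrightarrow> A i \<in> sets borel"
    let ?B = "prod_emb {0..} (\<lambda>_. borel) J (Pi\<^sub>E J A) :: (real \<Rightarrow> real) set"
    have B[measurable]: "?B \<in> sets ?N"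
      using J A by (intro sets_PiM_I) auto
    have emb: "\<omega> \<in> ?B \<longleftrightarrow> (\<forall>j\<in>J. coord j \<omega> \<in> A j)" if "\<omega> \<in> space P" for \<omega>
      using that J by (auto simp: prod_emb_iff restrict_PiE_iff coord_def space_P)
    have "measure P {\<omega> \<in> space P. \<forall>j\<in>J. coord j (\<theta> \<omega>) \<in> A j} = measure P {\<omega> \<in> space P. \<forall>j\<in>J. coord j \<omega> \<in> A j}"
    proof (rule joint_law_unique[OF _ _ J(1)])
      show "(\<lambda>\<omega>. coord j (\<theta> \<omega>)) \<in> borel_measurable P" if "j \<in> J" for j
        using that J by (intro measurable_compose[OF \<theta>] coord_measurable) auto
      show "coord j \<in> borel_measurable P" if "j \<in> J" for j
        using that J by (intro coord_measurable) auto
      fix c :: "real \<Rightarrow> real"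
      have var: "expectation (\<lambda>\<omega>. (\<Sum>j\<in>J. c j * X j \<omega>)\<^sup>2) = (\<Sum>i\<in>J. \<Sum>j\<in>J. c i * c j * V (min i j))"
        if W: "\<And>t. 0 \<le> t \<Longrightarrow> square_integrable P (X t)"
          and cov: "\<And>s t. 0 \<le> s \<Longrightarrow> 0 \<le> t \<Longrightarrow> expectation (\<lambda>\<omega>. X s \<omega> * X t \<omega>) = V (min s t)" for X
      proof -
        have "(\<Sum>j\<in>J. c j * X j \<omega>)\<^sup>2 = (\<Sum>i\<in>J. \<Sum>j\<in>J. c i * c j * (X i \<omega> * X j \<omega>))" for \<omega>
          by (simp add: power2_eq_square sum_product mult_ac)
        moreover have "integrable P (\<lambda>\<omega>. X i \<omega> * X j \<omega>)" if "i \<in> J" "j \<in> J" for i j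
          using that J by (intro square_integrable_integrable_mult W) auto
        ultimately have "expectation (\<lambda>\<omega>. (\<Sum>j\<in>J. c j * X j \<omega>)\<^sup>2) =
            (\<Sum>i\<in>J. \<Sum>j\<in>J. c i * c j * expectation (\<lambda>\<omega>. X i \<omega> * X j \<omega>))"
          by simp
        also have "\<dots> = (\<Sum>i\<in>J. \<Sum>j\<in>J. c i * c j * V (min i j))"
          using J by (intro sum.cong refl) (simp add: cov subset_iff)
        finally show ?thesis .
      qed
      have 1: "W (\<lambda>s. \<Sum>j\<in>J. c j * h j s) (\<lambda>\<omega>. \<Sum>j\<in>J. c j * coord j (\<theta> \<omega>))"
        using J by (intro W_sum W_cmult W) auto
      have 2: "W (\<lambda>s. \<Sum>j\<in>J. c j * K 0 j s) (\<lambda>\<omega>. \<Sum>j\<in>J. c j * coord j \<omega>)"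
        using J by (intro W_sum W_cmult W_coord) auto
      show "(CLINT \<omega>|P. iexp (\<Sum>j\<in>J. c j * coord j (\<theta> \<omega>))) = (CLINT \<omega>|P. iexp (\<Sum>j\<in>J. c j * coord j \<omega>))"
        unfolding W_char[OF 1] W_char[OF 2] W_norm[OF 1, symmetric] W_norm[OF 2, symmetric]
        using var[of "\<lambda>t \<omega>. coord t (\<theta> \<omega>)"] var[of coord] W_square_integrable(2)[OF W] cov' sq cov by simp
    qed (use A in \<open>auto intro: prob_space_axioms\<close>)
    moreover have "\<theta> -` ?B \<inter> space P = {\<omega> \<in> space P. \<forall>j\<in>J. coord j (\<theta> \<omega>) \<in> A j}"
      using emb measurable_space[OF \<theta>] by blast
    moreover have "(\<lambda>\<omega>. \<omega>) -` ?B \<inter> space P = {\<omega> \<in> space P. \<forall>j\<in>J. coord j \<omega> \<in> A j}"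
      using emb by blast
    ultimately show "emeasure (distr P ?N \<theta>) ?B = emeasure (distr P ?N (\<lambda>\<omega>. \<omega>)) ?B"
      by (simp add: emeasure_distr emeasure_eq_measure)
  qed simp_all
  then have eq: "emeasure (distr P ?N \<theta>) B = emeasure (distr P ?N (\<lambda>\<omega>. \<omega>)) B" for B by simp
  fix A assume "A \<in> sets (distr P P \<theta>)"
  then have A: "A \<in> sets P" by simp
  then obtain B where B: "B \<in> sets ?N" "A = space P \<inter> B"
    unfolding sets_P_restrict sets_restrict_space by auto
  have "\<theta> -` A \<inter> space P = \<theta> -` B \<inter> space P"
    using B measurable_space[OF \<theta>] by auto
  then show "emeasure (distr P P \<theta>) A = emeasure P A"
    using eq[of B] A B by (simp add: emeasure_distr Int_commute)
qed simp

text \<open>A continuous path is the limit of its values at the grid points \<open>d n s\<close>,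
  the first multiple of \<open>1 / (n + 1)\<close> beyond \<open>s\<close>. There are countably many
  such points for each \<open>n\<close>, so each approximation is jointly measurable.\<close>

lemma coord_jointly_measurable: "(\<lambda>(s, \<omega>). coord s \<omega>) \<in> borel_measurable (\<mu> \<Otimes>\<^sub>M P)"
proof -
  define d where "d n s = (real (nat \<lfloor>real (Suc n) * s\<rfloor>) + 1) / real (Suc n)" for n s
  have meas: "(\<lambda>p. coord (d n (fst p)) (snd p)) \<in> borel_measurable (\<mu> \<Otimes>\<^sub>M P)" for n
  proof -
    have "(\<lambda>p. coord ((real i + 1) / real (Suc n)) (snd p)) \<in> borel_measurable (\<mu> \<Otimes>\<^sub>M P)" for i :: nat
      by (rule measurable_compose[OF measurable_snd]) (intro coord_measurable, simp)
    then show ?thesis unfolding d_def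
      by (rule measurable_compose_countable[where f = "\<lambda>i p. coord ((real i + 1) / real (Suc n)) (snd p)"]) measurable
  qed
  have lim: "(\<lambda>n. coord (d n (fst p)) (snd p)) \<longlonglongrightarrow> coord (fst p) (snd p)" if "p \<in> space (\<mu> \<Otimes>\<^sub>M P)" for p
  proof -
    obtain s \<omega> where p: "p = (s, \<omega>)" by (cases p)
    have s: "0 \<le> s" and \<omega>: "continuous_on {0..} \<omega>" using that p by (auto simp: space_pair_measure space_P)
    have d: "\<bar>d n s - s\<bar> \<le> inverse (real (Suc n))" "0 \<le> d n s" for n
    proof -
      have fl: "real (nat \<lfloor>real (Suc n) * s\<rfloor>) = real_of_int \<lfloor>real (Suc n) * s\<rfloor>" using s by simp
      have "d n s - s = (real_of_int \<lfloor>real (Suc n) * s\<rfloor> + 1 - real (Suc n) * s) / real (Suc n)"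
        unfolding d_def fl by (simp add: field_simps)
      moreover have "0 \<le> real_of_int \<lfloor>real (Suc n) * s\<rfloor> + 1 - real (Suc n) * s"
        "real_of_int \<lfloor>real (Suc n) * s\<rfloor> + 1 - real (Suc n) * s \<le> 1" by linarith+
      ultimately show "\<bar>d n s - s\<bar> \<le> inverse (real (Suc n))"
        by (simp add: abs_divide inverse_eq_divide divide_right_mono)
      show "0 \<le> d n s" by (simp add: d_def)
    qed
    have "(\<lambda>n. d n s - s) \<longlonglongrightarrow> 0"
      by (rule Lim_null_comparison[OF _ LIMSEQ_inverse_real_of_nat]) (use d(1) in simp)
    then have "(\<lambda>n. d n s) \<longlonglongrightarrow> s" by (rule Lim_null[THEN iffD2])
    then have "(\<lambda>n. \<omega> (d n s)) \<longlonglongrightarrow> \<omega> s"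
      by (rule continuous_on_tendsto_compose[OF \<omega>]) (use s d(2) in auto)
    then show ?thesis by (simp add: p coord_def)
  qed
  have "(\<lambda>p. coord (fst p) (snd p)) \<in> borel_measurable (\<mu> \<Otimes>\<^sub>M P)"
    by (rule borel_measurable_LIMSEQ_real[OF lim meas])
  then show ?thesis by (simp add: case_prod_unfold)
qed

definition drift :: "real \<Rightarrow> (real \<Rightarrow> real) \<Rightarrow> real" where
  "drift t \<omega> = (LINT s:{0..t}|\<mu>. coord s \<omega> / V s)"

lemma drift_eq:
  assumes "\<omega> \<in> space P"
  shows "drift t \<omega> = (\<integral>s. indicator {0<..<t} s * (coord s \<omega> / V s) \<partial>\<mu>)"
  unfolding drift_def set_lebesgue_integral_def
proof (rule integral_cong_AE)
  have [measurable]: "(\<lambda>s. coord s \<omega>) \<in> borel_measurable \<mu>"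
    using measurable_compose[OF measurable_Pair2'[OF assms, of \<mu>] coord_jointly_measurable] by simp
  show "(\<lambda>s. indicator {0..t} s *\<^sub>R (coord s \<omega> / V s)) \<in> borel_measurable \<mu>" by measurable
  show "(\<lambda>s. indicator {0<..<t} s * (coord s \<omega> / V s)) \<in> borel_measurable \<mu>" by measurable
  show "AE s in \<mu>. indicator {0..t} s *\<^sub>R (coord s \<omega> / V s) = indicator {0<..<t} s * (coord s \<omega> / V s)"
    using AE_qv_neq[of 0] AE_qv_neq[of t] by eventually_elim (auto simp: indicator_def)
qed

text \<open>Splitting \<open>M_s / V s\<close> as \<open>(V t / V s)^(1/4)\<close> times the rest makes both factors square
  integrable on the product space, which gives Fubini and the second moment of the drift at once.\<close>

lemma drift_moments:
  assumes t: "0 < t"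
  shows "square_integrable P (drift t)"
    and "square_integrable P Y \<Longrightarrow> expectation (\<lambda>\<omega>. Y \<omega> * drift t \<omega>) =
      (\<integral>s. indicator {0<..<t} s * (expectation (\<lambda>\<omega>. Y \<omega> * coord s \<omega>) / V s) \<partial>\<mu>)"
proof -
  interpret mu: sigma_finite_measure \<mu> by (rule sigma_finite_qv)
  interpret pair_sigma_finite \<mu> P ..
  note [measurable] = coord_jointly_measurable
  have Vt: "V t > 0" using t by (rule V_pos)
  \<comment> \<open>The exponent \<open>1 / 4\<close> balances the factors: on \<open>(0, t)\<close>
    both \<open>(a s)^2\<close> and the second moment of \<open>b s\<close> are constant multiples
    of \<open>(V t / V s)^(1/2)\<close>, which is integrable at 0.\<close>
  define a where "a s = indicator {0<..<t} s * exp (ln (V t / V s) / 4)" for s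
  define b where "b s \<omega> = indicator {0<..<t} s * (coord s \<omega> / V s * exp (- ln (V t / V s) / 4))" for s \<omega>
  have [measurable]: "a \<in> borel_measurable \<mu>" unfolding a_def[abs_def] by measurable
  have bm[measurable]: "(\<lambda>(s, \<omega>). b s \<omega>) \<in> borel_measurable (\<mu> \<Otimes>\<^sub>M P)" unfolding b_def[abs_def] by measurable
  have ab: "a s * b s \<omega> = indicator {0<..<t} s * (coord s \<omega> / V s)" for s \<omega>
  proof -
    have "exp (ln (V t / V s) / 4) * exp (- ln (V t / V s) / 4) = 1"
      by (simp add: exp_add[symmetric])
    then show ?thesis by (cases "s \<in> {0<..<t}") (simp_all add: a_def b_def mult_ac)
  qed
  have int_half: "integrable \<mu> (\<lambda>s. indicator {0<..<t} s * exp (ln (V t / V s) / 2))"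
    using has_bochner_integral_qv_moment_left[OF t, of "1/2" 1] by (simp add: has_bochner_integral_iff)
  have a2: "(a s)\<^sup>2 = indicator {0<..<t} s * exp (ln (V t / V s) / 2)" for s
    by (simp add: a_def power_mult_distrib exp_double[symmetric] indicator_def)
  have sq_a: "square_integrable \<mu> a" using int_half by (simp add: square_integrable_def a2)
  have Eb2: "expectation (\<lambda>\<omega>. (b s \<omega>)\<^sup>2) = indicator {0<..<t} s * exp (ln (V t / V s) / 2) / V t"
    and ib2: "integrable P (\<lambda>\<omega>. (b s \<omega>)\<^sup>2)" if "s \<in> space \<mu>" for s
  proof -
    have s: "0 \<le> s" using that by simp
    have b2: "(b s \<omega>)\<^sup>2 = (indicator {0<..<t} s * exp (- ln (V t / V s) / 4) / V s)\<^sup>2 * (coord s \<omega> * coord s \<omega>)" for \<omega>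
      by (simp add: b_def power2_eq_square)
    show "integrable P (\<lambda>\<omega>. (b s \<omega>)\<^sup>2)"
      unfolding b2 using square_integrable_integrable_mult[OF sq[OF s] sq[OF s]] by simp
    have "expectation (\<lambda>\<omega>. (b s \<omega>)\<^sup>2) = (indicator {0<..<t} s * exp (- ln (V t / V s) / 4) / V s)\<^sup>2 * V s"
      unfolding b2 using cov[OF s s] by simp
    also have "\<dots> = indicator {0<..<t} s * exp (ln (V t / V s) / 2) / V t"
    proof (cases "0 < s \<and> s < t")
      case True
      then have Vs: "V s > 0" by (intro V_pos) simp
      have "(exp (- ln (V t / V s) / 4))\<^sup>2 = exp (ln (V t / V s) / 2 - ln (V t / V s))"
        by (simp add: exp_double[symmetric])
      also have "\<dots> = exp (ln (V t / V s) / 2) / (V t / V s)"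
        using Vs Vt by (subst exp_diff) simp
      finally show ?thesis using True Vs Vt by (simp add: power_divide power2_eq_square)
    qed auto
    finally show "expectation (\<lambda>\<omega>. (b s \<omega>)\<^sup>2) = indicator {0<..<t} s * exp (ln (V t / V s) / 2) / V t" .
  qed
  have b0: "integrable (\<mu> \<Otimes>\<^sub>M P) (\<lambda>(s, \<omega>). (b s \<omega>)\<^sup>2)"
  proof (rule Fubini_integrable)
    show "(\<lambda>(s, \<omega>). (b s \<omega>)\<^sup>2) \<in> borel_measurable (\<mu> \<Otimes>\<^sub>M P)" using bm by measurable
    have "integrable \<mu> (\<lambda>s. expectation (\<lambda>\<omega>. (b s \<omega>)\<^sup>2)) \<longleftrightarrow>
        integrable \<mu> (\<lambda>s. indicator {0<..<t} s * exp (ln (V t / V s) / 2) / V t)"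
      by (rule Bochner_Integration.integrable_cong) (auto simp: Eb2)
    then show "integrable \<mu> (\<lambda>s. \<integral>\<omega>. norm (case (s, \<omega>) of (s, \<omega>) \<Rightarrow> (b s \<omega>)\<^sup>2) \<partial>P)"
      using int_half by simp
    show "AE s in \<mu>. integrable P (\<lambda>\<omega>. case (s, \<omega>) of (s, \<omega>) \<Rightarrow> (b s \<omega>)\<^sup>2)"
      using ib2 by (intro AE_I2) simp
  qed
  then have b2: "integrable (\<mu> \<Otimes>\<^sub>M P) (\<lambda>p. (b (fst p) (snd p))\<^sup>2)" by (simp add: case_prod_unfold)
  then have sq_b: "square_integrable (\<mu> \<Otimes>\<^sub>M P) (\<lambda>p. b (fst p) (snd p))"
    using bm by (simp add: square_integrable_def case_prod_unfold)
  have int_b: "integrable P (\<lambda>\<omega>. \<integral>s. (b s \<omega>)\<^sup>2 \<partial>\<mu>)" and AE_b: "AE \<omega> in P. integrable \<mu> (\<lambda>s. (b s \<omega>)\<^sup>2)"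
    using integrable_snd[OF b0] AE_integrable_snd[OF b0] by simp_all
  have dr: "drift t \<omega> = (\<integral>s. a s * b s \<omega> \<partial>\<mu>)" if "\<omega> \<in> space P" for \<omega>
    using drift_eq[OF that] by (simp add: ab)
  have [measurable]: "drift t \<in> borel_measurable P"
  proof -
    have "(\<lambda>\<omega>. \<integral>s. a s * b s \<omega> \<partial>\<mu>) \<in> borel_measurable P"
      using bm by (intro mu.borel_measurable_lebesgue_integral) (simp add: ab, measurable)
    then show ?thesis by (subst measurable_cong[OF dr])
  qed
  show sq_drift: "square_integrable P (drift t)"
    unfolding square_integrable_def
  proof
    show "integrable P (\<lambda>\<omega>. (drift t \<omega>)\<^sup>2)"
    proof (rule Bochner_Integration.integrable_bound[of _ "\<lambda>\<omega>. (\<integral>s. (a s)\<^sup>2 \<partial>\<mu>) * (\<integral>s. (b s \<omega>)\<^sup>2 \<partial>\<mu>)"])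
      show "integrable P (\<lambda>\<omega>. (\<integral>s. (a s)\<^sup>2 \<partial>\<mu>) * (\<integral>s. (b s \<omega>)\<^sup>2 \<partial>\<mu>))" using int_b by simp
      show "AE \<omega> in P. norm ((drift t \<omega>)\<^sup>2) \<le> norm ((\<integral>s. (a s)\<^sup>2 \<partial>\<mu>) * (\<integral>s. (b s \<omega>)\<^sup>2 \<partial>\<mu>))"
        using AE_b AE_space
      proof eventually_elim
        case (elim \<omega>)
        have "(\<lambda>s. b s \<omega>) \<in> borel_measurable \<mu>"
          using measurable_compose[OF measurable_Pair2'[OF elim(2), of \<mu>] bm] by simp
        then have "square_integrable \<mu> (\<lambda>s. b s \<omega>)" using elim(1) by (simp add: square_integrable_def)
        from Cauchy_Schwarz_integral[OF sq_a this] show ?case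
          by (simp add: dr[OF elim(2)] abs_mult)
      qed
    qed measurable
  qed measurable
  show "expectation (\<lambda>\<omega>. Y \<omega> * drift t \<omega>) =
      (\<integral>s. indicator {0<..<t} s * (expectation (\<lambda>\<omega>. Y \<omega> * coord s \<omega>) / V s) \<partial>\<mu>)"
    if Y: "square_integrable P Y"
  proof -
    note [measurable] = square_integrableD(1)[OF Y]
    have "integrable (\<mu> \<Otimes>\<^sub>M P) (\<lambda>(s, \<omega>). (a s * Y \<omega>)\<^sup>2)"
    proof (rule Fubini_integrable)
      show "integrable \<mu> (\<lambda>s. \<integral>\<omega>. norm (case (s, \<omega>) of (s, \<omega>) \<Rightarrow> (a s * Y \<omega>)\<^sup>2) \<partial>P)"
        using square_integrableD(2)[OF sq_a] by (simp add: power_mult_distrib)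
      show "AE s in \<mu>. integrable P (\<lambda>\<omega>. case (s, \<omega>) of (s, \<omega>) \<Rightarrow> (a s * Y \<omega>)\<^sup>2)"
        using square_integrableD(2)[OF Y] by (intro AE_I2) (simp add: power_mult_distrib)
    qed measurable
    then have sq_aY: "square_integrable (\<mu> \<Otimes>\<^sub>M P) (\<lambda>p. a (fst p) * Y (snd p))"
      by (simp add: square_integrable_def case_prod_unfold)
    have int: "integrable (\<mu> \<Otimes>\<^sub>M P) (\<lambda>(s, \<omega>). (a s * Y \<omega>) * b s \<omega>)"
      using square_integrable_integrable_mult[OF sq_aY sq_b] by (simp add: case_prod_unfold)
    have "expectation (\<lambda>\<omega>. Y \<omega> * drift t \<omega>) = expectation (\<lambda>\<omega>. \<integral>s. (a s * Y \<omega>) * b s \<omega> \<partial>\<mu>)"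
    proof (rule Bochner_Integration.integral_cong[OF refl])
      fix \<omega> assume "\<omega> \<in> space P"
      have "(\<integral>s. (a s * Y \<omega>) * b s \<omega> \<partial>\<mu>) = (\<integral>s. Y \<omega> * (a s * b s \<omega>) \<partial>\<mu>)"
        by (simp add: mult_ac)
      then show "Y \<omega> * drift t \<omega> = (\<integral>s. (a s * Y \<omega>) * b s \<omega> \<partial>\<mu>)"
        by (simp add: dr[OF \<open>\<omega> \<in> space P\<close>])
    qed
    also have "\<dots> = (\<integral>s. expectation (\<lambda>\<omega>. (a s * Y \<omega>) * b s \<omega>) \<partial>\<mu>)"
      by (rule Fubini_integral[OF int])
    also have "\<dots> = (\<integral>s. indicator {0<..<t} s * (expectation (\<lambda>\<omega>. Y \<omega> * coord s \<omega>) / V s) \<partial>\<mu>)"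
    proof (rule Bochner_Integration.integral_cong[OF refl])
      fix s
      have "(a s * Y \<omega>) * b s \<omega> = (indicator {0<..<t} s / V s) * (Y \<omega> * coord s \<omega>)" for \<omega>
        using ab[of s \<omega>] by (simp add: mult_ac)
      then show "expectation (\<lambda>\<omega>. (a s * Y \<omega>) * b s \<omega>) =
          indicator {0<..<t} s * (expectation (\<lambda>\<omega>. Y \<omega> * coord s \<omega>) / V s)"
        by simp
    qed
    finally show ?thesis .
  qed
qed

end

section \<open>The iterated transformation\<close>

text \<open>Martingales have constant expectation, which gives mean 0 and second moment
  \<open>V t\<close>. Conditioning on the natural filtration at \<open>s\<close> reduces the
  covariance to the second moment at \<open>s\<close>.\<close>

lemma gaussian_pathsI:
  fixes P :: "(real \<Rightarrow> real) measure"
  assumes "prob_space P"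
    and sets: "sets P = sets path_space"
    and gauss: "gaussian_process P coord"
    and mart: "martingale P (natural_filtration P coord) coord"
    and zero: "AE \<omega> in P. coord 0 \<omega> = 0"
    and qv: "quadratic_variation P (natural_filtration P coord) coord (\<lambda>t \<omega>. V t)"
    and mono: "strict_mono_on {0..} V"
    and top: "filterlim V at_top at_top"
  shows "gaussian_paths V P"
proof -
  interpret prob_space P by fact
  let ?F = "natural_filtration P coord"
  have [measurable]: "coord t \<in> borel_measurable P" if "0 \<le> t" for t
  proof -
    have "gaussian_rv P (coord t)"
      using gauss[unfolded gaussian_process_def, rule_format, of "{t}" "\<lambda>_. 1"] that by simp
    then show ?thesis by (simp add: gaussian_rv_def)
  qed
  have sub: "subalgebra P (?F s)" for s
  proof -
    have gen: "{coord u -` A \<inter> space P |u A. u \<in> {0..s} \<and> A \<in> sets borel} \<subseteq> sets P" by auto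
    then have "{coord u -` A \<inter> space P |u A. u \<in> {0..s} \<and> A \<in> sets borel} \<subseteq> Pow (space P)"
      using sets.space_closed by blast
    then show ?thesis
      using sets.sigma_sets_subset[OF gen] by (simp add: subalgebra_def natural_filtration_def)
  qed
  \<comment> \<open>A deterministic statement that holds almost surely under a probability measure
    is true.\<close>
  have "AE \<omega> in P. V 0 = 0 \<and> continuous_on {0..} V \<and> mono_on {0..} V"
    using qv unfolding quadratic_variation_def by blast
  then have V: "V 0 = 0" "continuous_on {0..} V" by auto
  have mean_const: "expectation (X t) = expectation (X 0)" if X: "martingale P ?F X" and t: "0 \<le> t" for X t
  proof -
    interpret finite_measure_subalgebra P "?F 0"
      by unfold_locales (rule sub)
    have i: "integrable P (X t)" "integrable P (X 0)" and ae: "AE \<omega> in P. real_cond_exp P (?F 0) (X t) \<omega> = X 0 \<omega>"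
      using X t unfolding martingale_def by auto
    have "expectation (X t) = expectation (real_cond_exp P (?F 0) (X t))"
      using real_cond_exp_int(2)[OF i(1)] by simp
    also have "\<dots> = expectation (X 0)"
      using ae borel_measurable_integrable[OF i(2)] by (intro integral_cong_AE) auto
    finally show ?thesis .
  qed
  have mart2: "martingale P ?F (\<lambda>t \<omega>. (coord t \<omega>)\<^sup>2 - V t)"
    using qv unfolding quadratic_variation_def by blast
  have int2: "integrable P (\<lambda>\<omega>. (coord t \<omega>)\<^sup>2)" if "0 \<le> t" for t
  proof -
    have "integrable P (\<lambda>\<omega>. (coord t \<omega>)\<^sup>2 - V t)" using mart2 that unfolding martingale_def by blast
    then have "integrable P (\<lambda>\<omega>. ((coord t \<omega>)\<^sup>2 - V t) + V t)" by (intro Bochner_Integration.integrable_add) auto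
    then show ?thesis by simp
  qed
  have sq: "square_integrable P (coord t)" if "0 \<le> t" for t
    using int2[OF that] that by (simp add: square_integrable_def)
  have sec: "expectation (\<lambda>\<omega>. (coord t \<omega>)\<^sup>2) = V t" if "0 \<le> t" for t
  proof -
    have "expectation (\<lambda>\<omega>. (coord t \<omega>)\<^sup>2 - V t) = expectation (\<lambda>\<omega>. (coord 0 \<omega>)\<^sup>2 - V 0)"
      by (rule mean_const[OF mart2 that])
    moreover have "expectation (\<lambda>\<omega>. (coord 0 \<omega>)\<^sup>2 - V 0) = expectation (\<lambda>\<omega>. 0)"
      using zero V(1) by (intro integral_cong_AE) auto
    ultimately show ?thesis using int2[OF that] by (simp add: prob_space)
  qed
  have cov: "expectation (\<lambda>\<omega>. coord s \<omega> * coord t \<omega>) = V s" if st: "0 \<le> s" "s \<le> t" for s t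
  proof -
    interpret finite_measure_subalgebra P "?F s"
      by unfold_locales (rule sub)
    have t: "0 \<le> t" using st by simp
    have ms: "coord s \<in> borel_measurable (?F s)" and ae: "AE \<omega> in P. real_cond_exp P (?F s) (coord t) \<omega> = coord s \<omega>"
      using mart st t unfolding martingale_def by auto
    have "expectation (\<lambda>\<omega>. coord s \<omega> * coord t \<omega>) = expectation (\<lambda>\<omega>. coord s \<omega> * real_cond_exp P (?F s) (coord t) \<omega>)"
      using t by (intro real_cond_exp_intg(2)[symmetric] square_integrable_integrable_mult sq st ms) auto
    also have "\<dots> = expectation (\<lambda>\<omega>. (coord s \<omega>)\<^sup>2)"
      using ae st by (intro integral_cong_AE) (auto simp: power2_eq_square)
    finally show ?thesis using sec st by simp
  qed
  show ?thesis
  proof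
    show "expectation (coord t) = 0" if "0 \<le> t" for t
    proof -
      have "expectation (coord 0) = expectation (\<lambda>_. 0)"
        using zero by (intro integral_cong_AE) auto
      then show ?thesis using mean_const[OF mart that] by simp
    qed
    show "expectation (\<lambda>\<omega>. coord s \<omega> * coord t \<omega>) = V (min s t)" if "0 \<le> s" "0 \<le> t" for s t
      using that cov[of s t] cov[of t s] by (cases "s \<le> t") (auto simp: min_def mult.commute)
  qed (fact sets gauss sq mono top V)+
qed

section \<open>Covariances, invariance and iteration of the transformation\<close>

locale path_transformation = gaussian_paths V P
  for V :: "real \<Rightarrow> real" and P :: "(real \<Rightarrow> real) measure" +
  fixes \<tau> \<tau>' :: "(real \<Rightarrow> real) \<Rightarrow> (real \<Rightarrow> real)"
  assumes tau: "transformation P V \<tau>" and tau': "inverse_transformation P V \<tau>'"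
begin

lemma tau_measurable[measurable]: "\<tau> \<in> measurable P P"
  using tau by (simp add: transformation_def)

lemma tau'_measurable[measurable]: "\<tau>' \<in> measurable P P"
  using tau' by (simp add: inverse_transformation_def)

lemma coord_compose_measurable[measurable]:
  "\<theta> \<in> measurable P P \<Longrightarrow> 0 \<le> t \<Longrightarrow> (\<lambda>\<omega>. coord t (\<theta> \<omega>)) \<in> borel_measurable P"
  by (rule measurable_compose[OF _ coord_measurable])

lemma tau_AE: "0 \<le> t \<Longrightarrow> AE \<omega> in P. coord t \<omega> - drift t \<omega> = coord t (\<tau> \<omega>)"
  using tau unfolding transformation_def drift_def by (auto elim!: allE[of _ t] eventually_mono)

lemma coord_0_AE: "AE \<omega> in P. coord 0 \<omega> = 0"
  using cov[of 0 0] by (intro square_integrable_AE_eq sq square_integrable_zero) (auto simp: power2_eq_square)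

lemma tau_0_AE: "AE \<omega> in P. 0 = coord 0 (\<tau> \<omega>)"
  using tau_AE[OF order_refl] coord_0_AE AE_space
  by eventually_elim (simp add: drift_eq)

lemma tau_square_integrable: "0 < t \<Longrightarrow> square_integrable P (\<lambda>\<omega>. coord t (\<tau> \<omega>))"
  by (rule square_integrable_cong_AE[OF square_integrable_diff[OF sq drift_moments(1)] _ tau_AE]) auto

lemma tau_expectation:
  assumes "0 < t" and Y: "square_integrable P Y"
  shows "expectation (\<lambda>\<omega>. Y \<omega> * coord t (\<tau> \<omega>)) = expectation (\<lambda>\<omega>. Y \<omega> * coord t \<omega>) -
    (\<integral>s. indicator {0<..<t} s * (expectation (\<lambda>\<omega>. Y \<omega> * coord s \<omega>) / V s) \<partial>\<mu>)"
proof -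
  have t: "0 \<le> t" using assms by simp
  note [measurable] = square_integrableD(1)[OF Y] square_integrableD(1)[OF drift_moments(1)[OF assms(1)]]
  have "expectation (\<lambda>\<omega>. Y \<omega> * coord t (\<tau> \<omega>)) = expectation (\<lambda>\<omega>. Y \<omega> * coord t \<omega> - Y \<omega> * drift t \<omega>)"
    using tau_AE[OF t] t
    by (intro integral_cong_AE) (auto elim!: eventually_mono simp: right_diff_distrib[symmetric])
  also have "\<dots> = expectation (\<lambda>\<omega>. Y \<omega> * coord t \<omega>) - expectation (\<lambda>\<omega>. Y \<omega> * drift t \<omega>)"
    using square_integrable_integrable_mult[OF Y sq[OF t]] square_integrable_integrable_mult[OF Y drift_moments(1)[OF assms(1)]]
    by simp
  finally show ?thesis using drift_moments(2)[OF assms] by simp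
qed

text \<open>By Fubini the drift contributes the integral of \<open>min (V r) (V s) / V s\<close>
  over \<open>(0, t)\<close>, where this integrand is almost everywhere
  \<open>K 0 r s - K (-1) r s\<close>. Subtraction from \<open>V (min r t)\<close> leaves
  \<open>K (-1) r\<close>, the adjoint image of \<open>1_(0,r)\<close>.\<close>

lemma tau_coord_cov:
  assumes "0 \<le> r" "0 \<le> t"
  shows "expectation (\<lambda>\<omega>. coord r \<omega> * coord t (\<tau> \<omega>)) = (\<integral>s. K (-1) r s * K 0 t s \<partial>\<mu>)"
proof (cases "t = 0")
  case True
  have "expectation (\<lambda>\<omega>. coord r \<omega> * coord 0 (\<tau> \<omega>)) = expectation (\<lambda>\<omega>. 0)"
    using tau_0_AE assms by (intro integral_cong_AE) (auto elim!: eventually_mono)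
  then show ?thesis using True by (simp add: K_at_0)
next
  case False
  then have t: "0 < t" using assms by simp
  have "(\<integral>s. indicator {0<..<t} s * (expectation (\<lambda>\<omega>. coord r \<omega> * coord s \<omega>) / V s) \<partial>\<mu>) =
      (\<integral>s. K 0 t s * K 0 r s - K (-1) r s * K 0 t s \<partial>\<mu>)"
  proof (rule integral_cong_AE)
    have "(\<lambda>s. indicator {0<..<t} s * (min (V r) (V s) / V s)) \<in> borel_measurable \<mu>" by measurable
    then show "(\<lambda>s. indicator {0<..<t} s * (expectation (\<lambda>\<omega>. coord r \<omega> * coord s \<omega>) / V s)) \<in> borel_measurable \<mu>"
      by (subst measurable_cong[where g = "\<lambda>s. indicator {0<..<t} s * (min (V r) (V s) / V s)"])
         (use assms in \<open>auto simp: cov V_min\<close>)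
    show "AE s in \<mu>. indicator {0<..<t} s * (expectation (\<lambda>\<omega>. coord r \<omega> * coord s \<omega>) / V s) =
        K 0 t s * K 0 r s - K (-1) r s * K 0 t s"
      using AE_qv_neq[of r] AE_space
    proof eventually_elim
      case (elim s)
      show ?case
      proof (cases "0 < s \<and> s < t")
        case True
        then show ?thesis using elim assms V_pos[of s] by (auto simp: cov K_0 K_minus_1 min_def indicator_def)
      qed (use assms in \<open>auto simp: K_0\<close>)
    qed
  qed measurable
  also have "\<dots> = V (min t r) - (\<integral>s. K (-1) r s * K 0 t s \<partial>\<mu>)"
    using assms by (subst Bochner_Integration.integral_diff)
      (auto intro!: square_integrable_integrable_mult square_integrable_K simp: integral_K_0_K_0)
  finally show ?thesis
    using tau_expectation[OF t sq[OF assms(1)]] assms by (simp add: cov min.commute)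
qed

text \<open>The drift formula for the factor at time \<open>r\<close>, the other factor being
  already transformed. What remains is to integrate \<open>ln (V t / V s)\<close> over
  \<open>(0, r)\<close>, which gives \<open>V r * (ln (V t / V r) + 1)\<close>; the logarithm
  cancels.\<close>

lemma tau_cov_le:
  assumes "0 < r" "r \<le> t"
  shows "expectation (\<lambda>\<omega>. coord t (\<tau> \<omega>) * coord r (\<tau> \<omega>)) = V r"
proof -
  have t: "0 < t" using assms by simp
  have pos: "V r > 0" "V t > 0" using assms t by (auto intro: V_pos)
  have E: "expectation (\<lambda>\<omega>. coord t (\<tau> \<omega>) * coord s \<omega>) = - V s * ln (V t / V s)" if "0 \<le> s" "s \<le> t" for s
  proof -
    have "expectation (\<lambda>\<omega>. coord t (\<tau> \<omega>) * coord s \<omega>) = (\<integral>x. K (-1) s x * K 0 t x \<partial>\<mu>)"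
      using tau_coord_cov[OF that(1), of t] t by (simp add: mult.commute)
    then show ?thesis by (simp only: integral_K_minus_1_K_0[OF that])
  qed
  \<comment> \<open>This is \<open>ln (V t / V s)\<close> as a polynomial in
    \<open>x = ln (V r / V s)\<close>.\<close>
  let ?p = "[:ln (V t / V r), 1:]"
  have "(\<integral>s. indicator {0<..<r} s * (expectation (\<lambda>\<omega>. coord t (\<tau> \<omega>) * coord s \<omega>) / V s) \<partial>\<mu>) =
      (\<integral>s. - (indicator {0<..<r} s * (poly ?p (ln (V r / V s)) * exp ((1 - 1) * ln (V r / V s)))) \<partial>\<mu>)"
  proof (rule Bochner_Integration.integral_cong[OF refl])
    fix s
    show "indicator {0<..<r} s * (expectation (\<lambda>\<omega>. coord t (\<tau> \<omega>) * coord s \<omega>) / V s) =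
       - (indicator {0<..<r} s * (poly ?p (ln (V r / V s)) * exp ((1 - 1) * ln (V r / V s))))"
    proof (cases "0 < s \<and> s < r")
      case True
      then have Vs: "V s > 0" by (intro V_pos) simp
      have "ln (V t / V s) = ln (V t / V r) + ln (V r / V s)"
        using pos Vs by (simp add: ln_div)
      then show ?thesis using True assms Vs by (simp add: E)
    qed auto
  qed
  also have "\<dots> = - (V r * exp_moment 1 ?p)"
    using has_bochner_integral_qv_moment_left[OF assms(1), of 1 ?p] by (simp add: has_bochner_integral_iff)
  also have "exp_moment 1 ?p = ln (V t / V r) + 1"
    by (simp add: exp_moment_def)
  finally show ?thesis
    using tau_expectation[OF assms(1) tau_square_integrable[OF t]] E[of r] assms by (simp add: algebra_simps)
qed

lemma tau_cov:
  assumes "0 \<le> s" "0 \<le> t"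
  shows "expectation (\<lambda>\<omega>. coord s (\<tau> \<omega>) * coord t (\<tau> \<omega>)) = V (min s t)"
proof -
  consider "s = 0 \<or> t = 0" | "0 < s" "s \<le> t" | "0 < t" "t \<le> s" using assms by linarith
  then show ?thesis
  proof cases
    case 1
    have "expectation (\<lambda>\<omega>. coord s (\<tau> \<omega>) * coord t (\<tau> \<omega>)) = expectation (\<lambda>\<omega>. 0)"
      using tau_0_AE assms 1 by (intro integral_cong_AE) (auto elim!: eventually_mono)
    then show ?thesis using 1 assms by (auto simp: min_def)
  next
    case 2
    then show ?thesis using tau_cov_le[of s t] by (simp add: mult.commute min_def)
  next
    case 3
    then show ?thesis using tau_cov_le[of t s] by (simp add: min_def)
  qed
qed

lemma W_K_at_0: "Y \<in> borel_measurable P \<Longrightarrow> AE \<omega> in P. 0 = Y \<omega> \<Longrightarrow> W (K n 0) Y"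
  using W_cong_AE[OF W_zero, of Y] by (simp add: K_at_0[abs_def])

text \<open>\<open>tau_coord_cov\<close> puts the kernel on the side of \<open>r\<close>; the case
  \<open>n = 0\<close> of \<open>K_shift_pos\<close> moves it to the side of \<open>t\<close>, where
  it becomes \<open>K 1 t\<close>.\<close>

lemma W_tau:
  assumes "0 \<le> t"
  shows "W (K 1 t) (\<lambda>\<omega>. coord t (\<tau> \<omega>))"
proof (cases "t = 0")
  case True
  then show ?thesis using tau_0_AE by (simp add: W_K_at_0)
next
  case False
  then have t: "0 < t" using assms by simp
  show ?thesis
  proof (rule W_characterization[OF square_integrable_K[OF assms] tau_square_integrable[OF t]])
    show "expectation (\<lambda>\<omega>. coord t (\<tau> \<omega>) * coord r \<omega>) = (\<integral>s. K 1 t s * K 0 r s \<partial>\<mu>)" if "0 \<le> r" for r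
      using tau_coord_cov[OF that assms] K_shift_pos[OF that t, of 0] by (simp add: mult.commute)
    show "expectation (\<lambda>\<omega>. (coord t (\<tau> \<omega>))\<^sup>2) = (\<integral>s. (K 1 t s)\<^sup>2 \<partial>\<mu>)"
      using tau_cov[OF assms assms] assms by (simp add: power2_eq_square[of "coord _ _"] integral_K_square)
  qed
qed

lemma tau_measure_preserving: "distr P P \<tau> = P"
  using tau_measurable W_tau tau_cov by (rule measure_preservingI)

lemma W_tau':
  assumes "0 \<le> t"
  shows "W (K (-1) t) (\<lambda>\<omega>. coord t (\<tau>' \<omega>))"
proof (cases "t = 0")
  case True
  have "AE \<omega> in P. 0 = coord 0 (\<tau>' \<omega>)"
    using tau' by (auto simp: inverse_transformation_def elim!: eventually_mono)
  then show ?thesis using True by (simp add: W_K_at_0)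
next
  case False
  then have t: "0 < t" using assms by simp
  then obtain Y where Y: "W (\<lambda>s. indicator {t<..} s * (1 / V s)) Y" "AE \<omega> in P. coord t (\<tau>' \<omega>) = - V t * Y \<omega>"
    using tau' unfolding inverse_transformation_def by blast
  have "(\<lambda>s. - V t * (indicator {t<..} s * (1 / V s))) = K (-1) t"
    using assms by (auto simp: K_minus_1)
  then have "W (K (-1) t) (\<lambda>\<omega>. - V t * Y \<omega>)" using W_cmult[OF Y(1), of "- V t"] by simp
  then show ?thesis
    by (rule W_cong_AE) (use Y(2) assms in \<open>auto elim!: eventually_mono\<close>)
qed

lemma tau'_measure_preserving: "distr P P \<tau>' = P"
  using tau'_measurable W_tau'
proof (rule measure_preservingI)
  show "expectation (\<lambda>\<omega>. coord s (\<tau>' \<omega>) * coord t (\<tau>' \<omega>)) = V (min s t)" if "0 \<le> s" "0 \<le> t" for s t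
    using W_inner[OF W_tau'[OF that(1)] W_tau'[OF that(2)]] that by (simp add: integral_K_minus_1)
qed

text \<open>\<open>k r\<close> is the image of \<open>1_(0,r)\<close> under the adjoint of the operator on \<open>L\<^sup>2(dV)\<close> induced by
  \<open>\<theta>\<close>, and \<open>m\<close> is the index following \<open>n\<close> under that operator.\<close>

lemma W_shift:
  assumes \<theta>: "\<theta> \<in> measurable P P" "distr P P \<theta> = P" and T: "0 < T" and Y: "W (K n T) Y"
    and k: "\<And>r. 0 \<le> r \<Longrightarrow> square_integrable \<mu> (k r)"
    and adj: "\<And>r t. 0 \<le> r \<Longrightarrow> 0 \<le> t \<Longrightarrow> expectation (\<lambda>\<omega>. coord r \<omega> * coord t (\<theta> \<omega>)) = (\<integral>s. k r s * K 0 t s \<partial>\<mu>)"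
    and shift: "\<And>r. 0 \<le> r \<Longrightarrow> (\<integral>s. k r s * K n T s \<partial>\<mu>) = (\<integral>s. K 0 r s * K m T s \<partial>\<mu>)"
  shows "W (K m T) (\<lambda>\<omega>. Y (\<theta> \<omega>))"
proof (rule W_characterization)
  note sqY = W_square_integrable(2)[OF Y]
  show "square_integrable \<mu> (K m T)" using T by (intro square_integrable_K) simp
  show "square_integrable P (\<lambda>\<omega>. Y (\<theta> \<omega>))" by (rule measure_preserving_square_integrable[OF \<theta> sqY])
  show "expectation (\<lambda>\<omega>. Y (\<theta> \<omega>) * coord r \<omega>) = (\<integral>s. K m T s * K 0 r s \<partial>\<mu>)" if r: "0 \<le> r" for r
    using W_pairing[OF \<theta> sq[OF r] k[OF r] adj[OF r] Y] shift[OF r] by (simp add: mult.commute)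
  have "expectation (\<lambda>\<omega>. (Y (\<theta> \<omega>))\<^sup>2) = expectation (\<lambda>\<omega>. (Y \<omega>)\<^sup>2)"
    by (rule measure_preserving_integral[OF \<theta>, where g = "\<lambda>\<omega>. (Y \<omega>)\<^sup>2"])
       (use square_integrableD(1)[OF sqY] in measurable)
  then show "expectation (\<lambda>\<omega>. (Y (\<theta> \<omega>))\<^sup>2) = (\<integral>s. (K m T s)\<^sup>2 \<partial>\<mu>)"
    using W_norm[OF Y] T by (simp add: integral_K_square)
qed

lemma W_iterate_tau: "0 < T \<Longrightarrow> W (K (int n) T) (\<lambda>\<omega>. coord T ((\<tau> ^^ n) \<omega>))"
proof (induction n)
  case 0
  then show ?case using W_coord[of T] by simp
next
  case (Suc n)
  \<comment> \<open>The additional \<open>\<tau>\<close> acts first, so the induction hypothesis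
    supplies \<open>Y\<close> and \<open>W_shift\<close> composes it with
    \<open>\<tau>\<close>.\<close>
  have "W (K (int n + 1) T) (\<lambda>\<omega>. coord T ((\<tau> ^^ n) (\<tau> \<omega>)))"
    by (rule W_shift[OF tau_measurable tau_measure_preserving Suc.prems Suc.IH[OF Suc.prems]
          square_integrable_K tau_coord_cov K_shift_pos[OF _ Suc.prems]])
  then show ?case by (simp add: funpow_swap1 add.commute)
qed

lemma W_iterate_tau': "0 < T \<Longrightarrow> W (K (- int n) T) (\<lambda>\<omega>. coord T ((\<tau>' ^^ n) \<omega>))"
proof (induction n)
  case 0
  then show ?case using W_coord[of T] by simp
next
  case (Suc n)
  have "W (K (- int n - 1) T) (\<lambda>\<omega>. coord T ((\<tau>' ^^ n) (\<tau>' \<omega>)))"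
  proof (rule W_shift[OF tau'_measurable tau'_measure_preserving Suc.prems Suc.IH[OF Suc.prems] square_integrable_K])
    show "(\<integral>s. K 1 r s * K (- int n) T s \<partial>\<mu>) = (\<integral>s. K 0 r s * K (- int n - 1) T s \<partial>\<mu>)" if "0 \<le> r" for r
      by (rule K_shift_neg[OF that Suc.prems])
    \<comment> \<open>\<open>W_tau'\<close> gives the pairing of \<open>1_(0,r)\<close> with
      \<open>K (-1) t\<close>; \<open>K_shift_pos\<close> with \<open>r\<close> and \<open>t\<close>
      exchanged rewrites it as that of \<open>K 1 r\<close> with \<open>1_(0,t)\<close>. At
      \<open>r = 0\<close> both sides vanish.\<close>
    show "expectation (\<lambda>\<omega>. coord r \<omega> * coord t (\<tau>' \<omega>)) = (\<integral>s. K 1 r s * K 0 t s \<partial>\<mu>)" if "0 \<le> r" "0 \<le> t" for r t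
      using W_coord_inner[OF that(1) W_tau'[OF that(2)]] K_shift_pos[of t r 0] that
      by (cases "r = 0") (simp_all add: K_at_0 mult.commute)
  qed
  moreover have "- int (Suc n) = - int n - 1" by simp
  ultimately show ?case by (simp only: funpow_Suc_right o_apply)
qed

section \<open>The joint law of the \<open>eps\<close> variables and the expansion\<close>

lemma W_eps:
  assumes T: "0 < T"
  shows "W (laguerre_fun V T n) (eps V \<tau> \<tau>' T n)"
proof -
  have "W (K n T) (\<lambda>\<omega>. coord T (iterate \<tau> \<tau>' n \<omega>))"
  proof (cases "n \<ge> 0")
    case True
    then show ?thesis using W_iterate_tau[OF T, of "nat n"] by (simp add: iterate_def)
  next
    case False
    then show ?thesis using W_iterate_tau'[OF T, of "nat (- n)"] by (simp add: iterate_def)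
  qed
  from W_cmult[OF this, of "1 / sqrt (V T)"] show ?thesis
    using V_pos[OF T] by (simp add: K_def[abs_def] eps_def[abs_def])
qed

text \<open>The combination is the Wiener integral of the same combination of orthonormal kernels,
  whose squared norm is the sum of the squared coefficients.\<close>

lemma eps_sum_char:
  assumes T: "0 < T" and J: "finite J"
  shows "(CLINT \<omega>|P. iexp (\<Sum>n\<in>J. c n * eps V \<tau> \<tau>' T n \<omega>)) = exp (- (\<Sum>n\<in>J. (c n)\<^sup>2) / 2)"
proof -
  have W: "W (\<lambda>s. \<Sum>n\<in>J. c n * laguerre_fun V T n s) (\<lambda>\<omega>. \<Sum>n\<in>J. c n * eps V \<tau> \<tau>' T n \<omega>)"
    by (intro W_sum W_cmult W_eps T)
  have "(\<integral>s. (\<Sum>n\<in>J. c n * laguerre_fun V T n s)\<^sup>2 \<partial>\<mu>) = (\<Sum>n\<in>J. (c n)\<^sup>2)"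
    using integral_square_orthonormal[OF W_square_integrable(1)[OF W_eps[OF T]] ell_orthonormal[OF T]
      square_integrable_zero J, of c] by simp
  then show ?thesis by (simp only: W_char[OF W])
qed

lemma eps_measurable[measurable]: "0 < T \<Longrightarrow> eps V \<tau> \<tau>' T n \<in> borel_measurable P"
  using W_square_integrable(2)[OF W_eps] by (rule square_integrableD(1))

lemma distr_eps:
  assumes T: "0 < T"
  shows "distr P borel (eps V \<tau> \<tau>' T n) = std_normal_distribution"
proof (rule Levy_uniqueness)
  show "real_distribution (distr P borel (eps V \<tau> \<tau>' T n))"
    by (rule real_distribution_distr) (use T in measurable)
  show "real_distribution std_normal_distribution" by (rule real_dist_normal_dist)
  show "char (distr P borel (eps V \<tau> \<tau>' T n)) = char std_normal_distribution"
  proof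
    fix t
    have "char (distr P borel (eps V \<tau> \<tau>' T n)) t = (CLINT \<omega>|P. iexp (\<Sum>k\<in>{n}. t * eps V \<tau> \<tau>' T k \<omega>))"
      unfolding char_def using T by (subst integral_distr) auto
    then show "char (distr P borel (eps V \<tau> \<tau>' T n)) t = char std_normal_distribution t"
      by (simp only: eps_sum_char[OF T finite.insertI[OF finite.emptyI], of "\<lambda>_. t"] char_std_normal_distribution) simp
  qed
qed

text \<open>Finite combinations have the characteristic functions of combinations of independent
  standard normals. The joint law is therefore compared with the coordinates under a finite product
  of \<open>std_normal_distribution\<close>, where product events factor.\<close>

lemma eps_indep:
  assumes T: "0 < T"
  shows "indep_vars (\<lambda>_. borel) (eps V \<tau> \<tau>' T) UNIV"
  unfolding indep_vars_def2
proof (intro conjI ballI)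
  show "random_variable borel (eps V \<tau> \<tau>' T n)" for n using T by measurable
  show "indep_sets (\<lambda>n. {eps V \<tau> \<tau>' T n -` A \<inter> space P |A. A \<in> sets borel}) UNIV"
    unfolding indep_sets_def
  proof (intro conjI ballI allI impI)
    show "{eps V \<tau> \<tau>' T n -` A \<inter> space P |A. A \<in> sets borel} \<subseteq> events" for n
      using eps_measurable[OF T] by auto
    fix J :: "int set" and E
    assume J: "J \<noteq> {}" "finite J" and E: "E \<in> Pi J (\<lambda>n. {eps V \<tau> \<tau>' T n -` A \<inter> space P |A. A \<in> sets borel})"
    then have "\<forall>n\<in>J. \<exists>A. A \<in> sets borel \<and> E n = eps V \<tau> \<tau>' T n -` A \<inter> space P" by (auto simp: Pi_iff)
    then obtain A where A: "\<And>n. n \<in> J \<Longrightarrow> A n \<in> sets borel"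
        "\<And>n. n \<in> J \<Longrightarrow> E n = eps V \<tau> \<tau>' T n -` A n \<inter> space P" by metis
    interpret N: prob_space std_normal_distribution
      by (rule real_distribution.axioms(1)[OF real_dist_normal_dist])
    interpret Q: finite_product_prob_space "\<lambda>_::int. std_normal_distribution" J
      by unfold_locales (rule J(2))
    let ?Q = "PiM J (\<lambda>_::int. std_normal_distribution)"
    have "prob {\<omega> \<in> space P. \<forall>n\<in>J. eps V \<tau> \<tau>' T n \<omega> \<in> A n} = measure ?Q {y \<in> space ?Q. \<forall>n\<in>J. y n \<in> A n}"
    proof (rule joint_law_unique[where Y = "\<lambda>n y. y n", OF prob_space_axioms Q.prob_space_axioms J(2)])
      show "eps V \<tau> \<tau>' T n \<in> borel_measurable P" for n using T by measurable
      show "(\<lambda>y. y n) \<in> borel_measurable ?Q" if "n \<in> J" for n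
        using measurable_component_singleton[OF that, of "\<lambda>_. std_normal_distribution"] by simp
      fix c :: "int \<Rightarrow> real"
      have "(CLINT y|?Q. iexp (\<Sum>n\<in>J. c n * y n)) = (CLINT y|?Q. (\<Prod>n\<in>J. iexp (c n * y n)))"
        using J(2) by (simp add: exp_sum sum_distrib_left)
      also have "\<dots> = (\<Prod>n\<in>J. CLINT x|std_normal_distribution. iexp (c n * x))"
        by (rule Q.product_integral_prod[OF J(2)])
           (auto intro!: N.integrable_const_bound[of _ 1])
      also have "\<dots> = (\<Prod>n\<in>J. char std_normal_distribution (c n))" by (simp add: char_def)
      also have "\<dots> = exp (- (\<Sum>n\<in>J. (c n)\<^sup>2) / 2)"
        using J(2) by (simp add: char_std_normal_distribution exp_sum[symmetric] of_real_prod[symmetric]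
            sum_negf sum_divide_distrib del: of_real_exp of_real_prod)
      finally show "(CLINT \<omega>|P. iexp (\<Sum>n\<in>J. c n * eps V \<tau> \<tau>' T n \<omega>)) = (CLINT y|?Q. iexp (\<Sum>n\<in>J. c n * y n))"
        using eps_sum_char[OF T J(2)] by simp
    qed (rule A(1))
    moreover have "{y \<in> space ?Q. \<forall>n\<in>J. y n \<in> A n} = Pi\<^sub>E J A"
      by (auto simp: space_PiM PiE_iff extensional_def)
    moreover have "measure ?Q (Pi\<^sub>E J A) = (\<Prod>n\<in>J. measure std_normal_distribution (A n))"
      using A(1) by (intro Q.prob_times) simp
    moreover have "measure std_normal_distribution (A n) = prob (E n)" if "n \<in> J" for n
      using T A[OF that] by (simp add: distr_eps[OF T, of n, symmetric] measure_distr)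
    moreover have "(\<Inter>n\<in>J. E n) = {\<omega> \<in> space P. \<forall>n\<in>J. eps V \<tau> \<tau>' T n \<omega> \<in> A n}"
      using A(2) J(1) by auto
    ultimately show "prob (\<Inter>n\<in>J. E n) = (\<Prod>n\<in>J. prob (E n))" by simp
  qed
qed

text \<open>Inner products in L2(P) agree with those in L2(dV), so Pythagoras gives the error of a
  finite partial sum as the Parseval remainder of \<open>f\<close>.\<close>

lemma has_L2_sum_eps:
  assumes T: "0 < T" and Z: "W f Z"
  shows "has_L2_sum P (\<lambda>n \<omega>. (\<integral>s. f s * laguerre_fun V T n s \<partial>\<mu>) * eps V \<tau> \<tau>' T n \<omega>) Z"
  unfolding has_L2_sum_def L2_tendsto_def
proof (intro conjI allI)
  let ?c = "\<lambda>n. \<integral>s. f s * laguerre_fun V T n s \<partial>\<mu>"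
  note f = W_square_integrable(1)[OF Z] and sqZ = W_square_integrable(2)[OF Z]
  note e = W_square_integrable(2)[OF W_eps[OF T]]
  show "square_integrable P (\<lambda>\<omega>. \<Sum>n\<in>J. ?c n * eps V \<tau> \<tau>' T n \<omega>)" for J
    by (intro square_integrable_sum square_integrable_cmult e)
  show "square_integrable P Z" by (rule sqZ)
  have orth: "expectation (\<lambda>\<omega>. eps V \<tau> \<tau>' T n \<omega> * eps V \<tau> \<tau>' T m \<omega>) = (if n = m then 1 else 0)" for n m
    using W_inner[OF W_eps[OF T, of n] W_eps[OF T, of m]] ell_orthonormal[OF T, of n m] by simp
  have eq: "expectation (\<lambda>\<omega>. ((\<Sum>n\<in>J. ?c n * eps V \<tau> \<tau>' T n \<omega>) - Z \<omega>)\<^sup>2) = (\<integral>s. (f s)\<^sup>2 \<partial>\<mu>) - (\<Sum>n\<in>J. (?c n)\<^sup>2)"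
    if "finite J" for J
    unfolding integral_square_orthonormal[OF e orth sqZ that] W_inner[OF Z W_eps[OF T]] W_norm[OF Z]
    by (simp add: power2_eq_square)
  have "((\<lambda>J. (\<integral>s. (f s)\<^sup>2 \<partial>\<mu>) - (\<Sum>n\<in>J. (?c n)\<^sup>2)) \<longlongrightarrow> (\<integral>s. (f s)\<^sup>2 \<partial>\<mu>) - (\<integral>s. (f s)\<^sup>2 \<partial>\<mu>)) (finite_subsets_at_top UNIV)"
    by (intro tendsto_diff tendsto_const laguerre_parseval T f)
  \<comment> \<open>The error formula was derived for finite \<open>J\<close>, which is the eventual
    situation along this filter.\<close>
  moreover have "\<forall>\<^sub>F J in finite_subsets_at_top UNIV. (\<integral>s. (f s)\<^sup>2 \<partial>\<mu>) - (\<Sum>n\<in>J. (?c n)\<^sup>2) =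
      expectation (\<lambda>\<omega>. ((\<Sum>n\<in>J. ?c n * eps V \<tau> \<tau>' T n \<omega>) - Z \<omega>)\<^sup>2)"
    by (rule eventually_finite_subsets_at_top_weakI) (simp add: eq)
  ultimately show "((\<lambda>J. expectation (\<lambda>\<omega>. ((\<Sum>n\<in>J. ?c n * eps V \<tau> \<tau>' T n \<omega>) - Z \<omega>)\<^sup>2)) \<longlongrightarrow> 0) (finite_subsets_at_top UNIV)"
    by (simp only: diff_self) (rule Lim_transform_eventually)
qed

end

theorem theorem5p2:
  fixes P :: "(real \<Rightarrow> real) measure"
    and V :: "real \<Rightarrow> real"
    and \<tau> \<tau>' :: "(real \<Rightarrow> real) \<Rightarrow> (real \<Rightarrow> real)"
    and T :: real
    and f :: "real \<Rightarrow> real"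
    and Z :: "(real \<Rightarrow> real) \<Rightarrow> real"
  assumes "prob_space P"
    and "sets P = sets path_space"
    and "gaussian_process P coord"
    and "martingale P (natural_filtration P coord) coord"
    and "AE \<omega> in P. coord 0 \<omega> = 0"
    and "quadratic_variation P (natural_filtration P coord) coord (\<lambda>t \<omega>. V t)"
    and "strict_mono_on {0..} V"
    and "filterlim V at_top at_top"
    and "transformation P V \<tau>"
    and "inverse_transformation P V \<tau>'"
    and "T > 0"
    and "square_integrable (qv_measure V) f"
    and "wiener_integral P coord V f Z"
  shows "has_L2_sum P
           (\<lambda>n \<omega>. (LINT s|qv_measure V. f s * laguerre_fun V T n s) * eps V \<tau> \<tau>' T n \<omega>) Z
         \<and> prob_space.indep_vars P (\<lambda>_. borel) (eps V \<tau> \<tau>' T) UNIV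
         \<and> (\<forall>n. distr P borel (eps V \<tau> \<tau>' T n) = distr P borel (eps V \<tau> \<tau>' T 0))
         \<and> distributed P lborel (eps V \<tau> \<tau>' T 0) std_normal_density"
proof -
  interpret path_transformation V P \<tau> \<tau>'
    using gaussian_pathsI[OF assms(1-8)] assms(9,10)
    by (simp add: path_transformation_def path_transformation_axioms_def)
  \<comment> \<open>A law depends on its target only through the measurable sets, so
    \<open>lborel\<close> and \<open>borel\<close> are interchangeable here.\<close>
  have "distr P lborel (eps V \<tau> \<tau>' T 0) = distr P borel (eps V \<tau> \<tau>' T 0)"
    by (rule distr_cong) auto
  then have "distributed P lborel (eps V \<tau> \<tau>' T 0) std_normal_density"
    unfolding distributed_def using distr_eps[OF assms(11), of 0] eps_measurable[OF assms(11)] by simp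
  then show ?thesis
    using has_L2_sum_eps[OF assms(11,13)] eps_indep[OF assms(11)] distr_eps[OF assms(11)] by simp
qed

end
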